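(* Let $d\ge 2$ be an integer and $a$ an integer with $2\le a\le d-1$, and let $e\in K$ be a primitive $d$-th root of $1$. Let $I_a\subset K[x,y,z]$ be the artinian ideal generated by all forms of degree $d$ invariant under the action of $M_a=\begin{pmatrix}1&0&0\\0&e&0\\0&0&e^a\end{pmatrix}$. Then: (1) $I_a$ is a monomial minimal GT-system. (2) For any linear form $L=\alpha x+\beta y+\gamma z$ put $L[j]:=\alpha x+\beta e^jy+\gamma e^{aj}z$, $j\ge 0$. Then $L\cdot\prod_{j=1}^{d-1}L[j]\in I_a$. (3) For integers $0\le i,j\le d-1$ put $L_{i,j}:=x+e^iy+e^jz$. The set of $d^2$ lines $\{L_{i,j}\}_{0\le i,j\le d-1}$ gives rise to a Ceva configuration $C(d)=(3d_d,d^2_3)$ of $d^2$ lines and $3d$ points in $\mathbb{P}^2$, with $d$ lines through each point and $3$ points on each line.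
   Context: $K$ is an algebraically closed field of characteristic zero and $R=K[x,y,z]$. $M_a$ acts by $x\mapsto x$, $y\mapsto ey$, $z\mapsto e^az$. A homogeneous artinian ideal $I\subset R$ generated by $r\le d+1$ forms of degree $d$ is a Togliatti system if for every linear form $L$ the map $\times L:(R/I)_{d-1}\to(R/I)_d$ does not have maximal rank. It is a monomial Togliatti system if generated by monomials; a monomial Togliatti system is minimal if no proper subset of its set of minimal monomial generators generates a monomial Togliatti system. A GT-system is a Togliatti system generated by all forms of degree $d$ invariant under a diagonal representation of $\mathbb{Z}/d\mathbb{Z}$, whose associated morphism from $\mathbb{P}^2$ (given by a minimal set of generators) is a Galois covering of its image with cyclic Galois group $\mathbb{Z}/d\mathbb{Z}$. A linear configuration in $\mathbb{P}^2$ is a finite set of points and a finite arrangement of lines such that each point is incident to the same number of lines and each line is incident to the same number of points; it is denoted $(p_s,\ell_r)$ where $p$ is the number of points, $\ell$ the number of lines, $s$ the number of lines per point and $r$ the number of points (of the set) per line. In (3), a linear form stands for the line it defines, and the assertion is that there is a set of $3d$ points which together with these lines is a linear configuration $(3d_d,d^2_3)$, called a Ceva configuration $C(d)$. *)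

theory Defs
  imports
    "HOL-Library.Poly_Mapping"
    "HOL-Library.Numeral_Type"
    "HOL-Computational_Algebra.Polynomial"
    "HOL-Algebra.Bij"
    "HOL-Algebra.Elementary_Groups"
begin

section \<open>Polynomials\<close>

text \<open>
  A polynomial in variables indexed by \<open>'i\<close> is a finitely supported map from exponent vectors
  to coefficients. The ring \<open>K[x,y,z]\<close> is the case \<open>'i = 3\<close>, with \<open>x, y, z\<close> the variables
  of index 0, 1, 2.
\<close>

type_synonym ('i, 'k) mpol = "('i \<Rightarrow>\<^sub>0 nat) \<Rightarrow>\<^sub>0 'k"

definition mconst :: "'k::comm_ring_1 \<Rightarrow> ('i, 'k) mpol" where
  "mconst c = Poly_Mapping.single 0 c"

definition mvar :: "'i \<Rightarrow> ('i, 'k::comm_ring_1) mpol" where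
  "mvar i = Poly_Mapping.single (Poly_Mapping.single i 1) 1"

definition mdeg :: "('i \<Rightarrow>\<^sub>0 nat) \<Rightarrow> nat" where
  "mdeg m = (\<Sum>i\<in>Poly_Mapping.keys m. Poly_Mapping.lookup m i)"

text \<open>Forms of degree \<open>n\<close>, including the zero form.\<close>

definition forms :: "nat \<Rightarrow> ('i, 'k::comm_ring_1) mpol set" where
  "forms n = {F. \<forall>m\<in>Poly_Mapping.keys F. mdeg m = n}"

definition monomials :: "('i, 'k::comm_ring_1) mpol set" where
  "monomials = range (\<lambda>m. Poly_Mapping.single m 1)"

text \<open>Substitution of \<open>\<sigma> i\<close> for the \<open>i\<close>-th variable, the coefficients being mapped by \<open>c\<close>.\<close>

definition msubst ::
  "('k::comm_ring_1 \<Rightarrow> 'r::comm_ring_1) \<Rightarrow> ('i \<Rightarrow> 'r) \<Rightarrow> ('i, 'k) mpol \<Rightarrow> 'r" where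
  "msubst c \<sigma> F =
     (\<Sum>m\<in>Poly_Mapping.keys F. c (Poly_Mapping.lookup F m) *
        (\<Prod>i\<in>Poly_Mapping.keys m. \<sigma> i ^ Poly_Mapping.lookup m i))"

definition mval :: "('i, 'k::comm_ring_1) mpol \<Rightarrow> ('i \<Rightarrow> 'k) \<Rightarrow> 'k" where
  "mval F v = msubst (\<lambda>c. c) v F"

definition triple :: "'a \<Rightarrow> 'a \<Rightarrow> 'a \<Rightarrow> 3 \<Rightarrow> 'a" where
  "triple a b c = (\<lambda>i. if i = 0 then a else if i = 1 then b else c)"

definition lin_form :: "'k \<Rightarrow> 'k \<Rightarrow> 'k \<Rightarrow> (3, 'k::comm_ring_1) mpol" where
  "lin_form \<alpha> \<beta> \<gamma> = mconst \<alpha> * mvar 0 + mconst \<beta> * mvar 1 + mconst \<gamma> * mvar 2"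

section \<open>Ideals and Togliatti systems\<close>

text \<open>The ideals of a commutative ring are its submodules.\<close>

global_interpretation ring_ideal: module "(*) :: 'r \<Rightarrow> 'r \<Rightarrow> 'r::comm_ring_1"
  defines gen_ideal = ring_ideal.span
    and is_ideal = ring_ideal.subspace
  by unfold_locales (simp_all add: algebra_simps)

text \<open>
  An ideal \<open>I\<close> is called artinian if the quotient by \<open>I\<close> is an artinian ring; the ideals of the
  quotient correspond to the ideals that contain \<open>I\<close>.
\<close>

definition artinian_ideal :: "'r::comm_ring_1 set \<Rightarrow> bool" where
  "artinian_ideal I \<longleftrightarrow> is_ideal I \<and>
     (\<forall>J :: nat \<Rightarrow> 'r set.
        (\<forall>n. is_ideal (J n) \<and> I \<subseteq> J n \<and> J (Suc n) \<subseteq> J n) \<longrightarrow> (\<exists>N. \<forall>n\<ge>N. J n = J N))"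

text \<open>The residue class \<open>F + I\<close>, the graded piece \<open>(R/I)\<^sub>n\<close>, and multiplication by \<open>L\<close> on \<open>R/I\<close>.\<close>

definition residue :: "'r::comm_ring_1 set \<Rightarrow> 'r \<Rightarrow> 'r set" where
  "residue I F = {F + G | G. G \<in> I}"

definition graded_quot :: "('i, 'k::comm_ring_1) mpol set \<Rightarrow> nat \<Rightarrow> ('i, 'k) mpol set set" where
  "graded_quot I n = residue I ` forms n"

definition mult_quot :: "'r::comm_ring_1 set \<Rightarrow> 'r \<Rightarrow> 'r set \<Rightarrow> 'r set" where
  "mult_quot I L C = (\<Union>F\<in>C. residue I (L * F))"

definition max_rank :: "('i, 'k::comm_ring_1) mpol set \<Rightarrow> ('i, 'k) mpol \<Rightarrow> nat \<Rightarrow> bool" where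
  "max_rank I L n \<longleftrightarrow>
     inj_on (mult_quot I L) (graded_quot I n) \<or>
     mult_quot I L ` graded_quot I n = graded_quot I (Suc n)"

definition togliatti_system :: "nat \<Rightarrow> (3, 'k::field) mpol set \<Rightarrow> bool" where
  "togliatti_system d I \<longleftrightarrow>
     0 < d \<and> artinian_ideal I \<and>
     (\<exists>S. finite S \<and> card S \<le> d + 1 \<and> S \<subseteq> forms d \<and> I = gen_ideal S) \<and>
     (\<forall>L\<in>forms 1. \<not> max_rank I L (d - 1))"

definition monomial_togliatti_system :: "nat \<Rightarrow> (3, 'k::field) mpol set \<Rightarrow> bool" where
  "monomial_togliatti_system d I \<longleftrightarrow>
     togliatti_system d I \<and> (\<exists>S \<subseteq> monomials. I = gen_ideal S)"

definition min_monomial_gens :: "('i, 'k::comm_ring_1) mpol set \<Rightarrow> ('i, 'k) mpol set" where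
  "min_monomial_gens I =
     {m \<in> monomials \<inter> I. \<forall>m' \<in> monomials \<inter> I. m' dvd m \<longrightarrow> m' = m}"

definition minimal_monomial_togliatti_system :: "nat \<Rightarrow> (3, 'k::field) mpol set \<Rightarrow> bool" where
  "minimal_monomial_togliatti_system d I \<longleftrightarrow>
     monomial_togliatti_system d I \<and>
     (\<forall>S. S \<subset> min_monomial_gens I \<longrightarrow> \<not> monomial_togliatti_system d (gen_ideal S))"

section \<open>The projective plane\<close>

text \<open>
  The point with homogeneous coordinates \<open>v\<close> is the set of nonzero multiples of \<open>v\<close>. The index
  type of the coordinates is arbitrary; for the plane it is \<open>3\<close>.
\<close>

definition ppoint :: "('i \<Rightarrow> 'k::field) \<Rightarrow> ('i \<Rightarrow> 'k) set" where
  "ppoint v = {(\<lambda>i. c * v i) | c. c \<noteq> 0}"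

definition P2 :: "(3 \<Rightarrow> 'k::field) set set" where
  "P2 = {ppoint v | v. v \<noteq> (\<lambda>_. 0)}"

text \<open>A Zariski open set is the complement of the zero locus of a set of forms.\<close>

definition zariski_open :: "(3 \<Rightarrow> 'k::field) set set \<Rightarrow> bool" where
  "zariski_open U \<longleftrightarrow>
     (\<exists>T. (\<forall>F\<in>T. \<exists>n. F \<in> forms n) \<and>
          U = {ppoint v | v. v \<noteq> (\<lambda>_. 0) \<and> (\<exists>F\<in>T. mval F v \<noteq> 0)})"

text \<open>Regular maps of the plane to itself: locally given by three forms of equal degree.\<close>

definition regular_self_map :: "((3 \<Rightarrow> 'k::field) set \<Rightarrow> (3 \<Rightarrow> 'k) set) \<Rightarrow> bool" where
  "regular_self_map \<phi> \<longleftrightarrow>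
     \<phi> ` P2 \<subseteq> P2 \<and>
     (\<forall>p\<in>P2. \<exists>U n F. zariski_open U \<and> p \<in> U \<and> (\<forall>i. F i \<in> forms n) \<and>
        (\<forall>v. v \<noteq> (\<lambda>_. 0) \<and> ppoint v \<in> U \<longrightarrow>
           (\<exists>i. mval (F i) v \<noteq> 0) \<and> \<phi> (ppoint v) = ppoint (\<lambda>i. mval (F i) v)))"

text \<open>
  The group of deck transformations of a map \<open>f\<close> defined on the plane: the automorphisms
  of the variety that commute with \<open>f\<close>.
\<close>

definition deck_group :: "((3 \<Rightarrow> 'k::field) set \<Rightarrow> 'z) \<Rightarrow> ((3 \<Rightarrow> 'k) set \<Rightarrow> (3 \<Rightarrow> 'k) set) monoid" where
  "deck_group f = BijGroup P2 \<lparr>carrier :=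
     {\<phi> \<in> Bij P2. regular_self_map \<phi> \<and> regular_self_map (inv_into P2 \<phi>) \<and>
        (\<forall>p\<in>P2. f (\<phi> p) = f p)}\<rparr>"

section \<open>The morphism given by a set of forms\<close>

text \<open>
  Forms \<open>f\<^sub>1, \<dots>, f\<^sub>r\<close> of the same degree \<open>d\<close> define the map from the plane to projective
  \<open>(r-1)\<close>-space with homogeneous coordinates \<open>(f\<^sub>1 : \<dots> : f\<^sub>r)\<close>. The coordinates of the target are
  indexed by the set \<open>S\<close> of these forms itself, so that no numbering has to be chosen; all
  coordinates with index outside \<open>S\<close> vanish.
\<close>

definition form_coords :: "(3, 'k::field) mpol set \<Rightarrow> (3 \<Rightarrow> 'k) \<Rightarrow> (3, 'k) mpol \<Rightarrow> 'k" where
  "form_coords S v = (\<lambda>f. if f \<in> S then mval f v else 0)"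

definition form_map :: "(3, 'k::field) mpol set \<Rightarrow> (3 \<Rightarrow> 'k) set \<Rightarrow> ((3, 'k) mpol \<Rightarrow> 'k) set" where
  "form_map S p = (\<Union>v\<in>p. ppoint (form_coords S v))"

definition base_point_free :: "(3, 'k::field) mpol set \<Rightarrow> bool" where
  "base_point_free S \<longleftrightarrow> (\<forall>v. v \<noteq> (\<lambda>_. 0) \<longrightarrow> (\<exists>f\<in>S. mval f v \<noteq> 0))"

text \<open>
  The target is covered by the affine charts on which one coordinate \<open>y\<^sub>f\<close>, \<open>f \<in> S\<close>, does
  not vanish. The inverse image of such a chart is the affine variety \<open>f \<noteq> 0\<close>, with coordinate ring
  \<open>{G / f\<^sup>k | G a form of degree k d}\<close> (the degree zero part of the localisation at \<open>f\<close>); the functions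
  on the chart of the image are the \<open>H / y\<^sub>f\<^sup>k\<close> with \<open>H\<close> a form of degree \<open>k\<close>. All these functions are
  written as functions of the homogeneous coordinates, invariant under scaling, and extended by
  zero. The morphism is finite if over each of these charts the coordinate ring upstairs
  is a finitely generated module over the one downstairs.
\<close>

definition chart_ring :: "nat \<Rightarrow> (3, 'k::field) mpol \<Rightarrow> ((3 \<Rightarrow> 'k) \<Rightarrow> 'k) set" where
  "chart_ring d f =
     {(\<lambda>v. if mval f v = 0 then 0 else mval G v / mval f v ^ k) | G k. G \<in> forms (k * d)}"

definition pulled_back_chart_ring ::
  "(3, 'k::field) mpol set \<Rightarrow> (3, 'k) mpol \<Rightarrow> ((3 \<Rightarrow> 'k) \<Rightarrow> 'k) set" where
  "pulled_back_chart_ring S f =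
     {(\<lambda>v. if mval f v = 0 then 0 else mval H (form_coords S v) / mval f v ^ k) | H k.
        H \<in> forms k}"

definition finite_form_map :: "nat \<Rightarrow> (3, 'k::field) mpol set \<Rightarrow> bool" where
  "finite_form_map d S \<longleftrightarrow>
     base_point_free S \<and>
     (\<forall>f\<in>S. \<exists>B. finite B \<and> B \<subseteq> chart_ring d f \<and>
        (\<forall>g\<in>chart_ring d f. \<exists>h. (\<forall>b\<in>B. h b \<in> pulled_back_chart_ring S f) \<and>
           g = (\<lambda>v. \<Sum>b\<in>B. h b v * b v)))"

text \<open>
  A Galois covering of its image with group \<open>\<int>/n\<close>: a finite morphism whose group of deck
  transformations is isomorphic to \<open>\<int>/n\<close> and acts transitively on every fibre.
\<close>

definition cyclic_galois_covering :: "nat \<Rightarrow> nat \<Rightarrow> (3, 'k::field) mpol set \<Rightarrow> bool" where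
  "cyclic_galois_covering n d S \<longleftrightarrow>
     finite_form_map d S \<and>
     deck_group (form_map S) \<cong> integer_mod_group n \<and>
     (\<forall>p\<in>P2. \<forall>q\<in>P2. form_map S p = form_map S q \<longrightarrow>
        (\<exists>\<phi>\<in>carrier (deck_group (form_map S)). \<phi> p = q))"

section \<open>Diagonal actions and GT-systems\<close>

text \<open>The diagonal matrix with diagonal \<open>u\<close> acts on polynomials by scaling the \<open>i\<close>-th variable by \<open>u i\<close>.\<close>

definition diag_act :: "('i \<Rightarrow> 'k) \<Rightarrow> ('i, 'k::comm_ring_1) mpol \<Rightarrow> ('i, 'k) mpol" where
  "diag_act u F = msubst mconst (\<lambda>i. mconst (u i) * mvar i) F"

definition diag_rep :: "nat \<Rightarrow> (int \<Rightarrow> 3 \<Rightarrow> 'k::field) \<Rightarrow> bool" where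
  "diag_rep d \<rho> \<longleftrightarrow>
     (\<forall>g\<in>carrier (integer_mod_group d). \<forall>i. \<rho> g i \<noteq> 0) \<and>
     (\<forall>g\<in>carrier (integer_mod_group d). \<forall>h\<in>carrier (integer_mod_group d). \<forall>i.
        \<rho> (g \<otimes>\<^bsub>integer_mod_group d\<^esub> h) i = \<rho> g i * \<rho> h i)"

definition min_form_gens :: "nat \<Rightarrow> (3, 'k::field) mpol set \<Rightarrow> (3, 'k) mpol set \<Rightarrow> bool" where
  "min_form_gens d I S \<longleftrightarrow>
     finite S \<and> S \<subseteq> forms d \<and> gen_ideal S = I \<and> (\<forall>S'. S' \<subset> S \<longrightarrow> gen_ideal S' \<noteq> I)"

text \<open>
  The morphism attached to \<open>I\<close> does not depend, up to a linear change of coordinates in the target, on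
  the minimal set of generators. The condition is imposed for all of them; at least one exists,
  since a Togliatti system is generated by finitely many forms of degree \<open>d\<close>.
\<close>

definition gt_system :: "nat \<Rightarrow> (3, 'k::field) mpol set \<Rightarrow> bool" where
  "gt_system d I \<longleftrightarrow>
     togliatti_system d I \<and>
     (\<exists>\<rho>. diag_rep d \<rho> \<and>
        I = gen_ideal {F \<in> forms d. \<forall>g\<in>carrier (integer_mod_group d). diag_act (\<rho> g) F = F}) \<and>
     (\<forall>S. min_form_gens d I S \<longrightarrow> cyclic_galois_covering d d S)"

definition primitive_root_of_one :: "nat \<Rightarrow> 'k::field \<Rightarrow> bool" where
  "primitive_root_of_one d e \<longleftrightarrow> e ^ d = 1 \<and> (\<forall>k. 0 < k \<and> k < d \<longrightarrow> e ^ k \<noteq> 1)"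

definition GT_ideal :: "nat \<Rightarrow> 'k::field \<Rightarrow> nat \<Rightarrow> (3, 'k) mpol set" where
  "GT_ideal d e a = gen_ideal {F \<in> forms d. diag_act (triple 1 e (e ^ a)) F = F}"

section \<open>Linear configurations\<close>

definition line_of :: "(3, 'k::field) mpol \<Rightarrow> (3 \<Rightarrow> 'k) set set" where
  "line_of L = {ppoint v | v. v \<noteq> (\<lambda>_. 0) \<and> mval L v = 0}"

definition lines :: "(3 \<Rightarrow> 'k::field) set set set" where
  "lines = {line_of L | L. L \<in> forms 1 \<and> L \<noteq> 0}"

text \<open>
  A configuration \<open>(p\<^sub>s, l\<^sub>r)\<close>: \<open>p\<close> points, \<open>l\<close> lines, \<open>s\<close> lines through each point, \<open>r\<close> of the
  points on each line.
\<close>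

definition linear_configuration ::
  "(3 \<Rightarrow> 'k::field) set set \<Rightarrow> (3 \<Rightarrow> 'k) set set set \<Rightarrow> nat \<Rightarrow> nat \<Rightarrow> nat \<Rightarrow> nat \<Rightarrow> bool" where
  "linear_configuration P A p s l r \<longleftrightarrow>
     P \<subseteq> P2 \<and> finite P \<and> card P = p \<and> A \<subseteq> lines \<and> finite A \<and> card A = l \<and>
     (\<forall>x\<in>P. card {M \<in> A. x \<in> M} = s) \<and>
     (\<forall>M\<in>A. card {x \<in> P. x \<in> M} = r)"

end

theory Submission
  imports Defs "Jordan_Normal_Form.Determinant"
begin

text \<open>
  The degree \<open>d\<close> part of \<open>I\<^sub>a\<close> is spanned by the at most \<open>d + 1\<close> invariant monomials. The product of the
  forms \<open>L[j]\<close> is invariant, hence in \<open>I\<^sub>a\<close>; so \<open>\<times>L\<close> is not injective, and by counting dimensions it is not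
  surjective. For minimality, an invariant form that is divisible by \<open>x + y + z\<close> is divisible by all its
  conjugates, so it is a multiple of their product. That product is a Sylvester determinant. The number of
  inversions of a permutation occurring in its expansion depends modulo \<open>2\<close> only on the monomial, so nothing
  cancels, and every invariant monomial occurs with nonzero coefficient. For the covering, the
  invariant monomials separate the orbits of the group, and a deck transformation agrees at every point with
  some element of the group, hence with the same element at all points as the plane is irreducible.
\<close>

(* As a simplification rule it reverses mult.assoc, which makes ac_simps and algebra_simps diverge. *)
declare ring_ideal.scale_scale [simp del]

subsection \<open>Inversions of permutations\<close>

text \<open>The norm of x + y + z could also be expanded as a d x d circulant determinant, but there
  the reduction of column indices modulo d hides the signs. The a extra rows of the Sylvester matrix
  record these reductions as \<open>drops\<close>. Their number h is tied to the exponents j of y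
  and k of z by j + a k = d h, and this makes the parity of the inversions computable. Absence of
  cancellation shows nothing unless each invariant monomial arises from at least one permutation;
  such a permutation is constructed explicitly from the residues of n k modulo d. The determinant
  enters through its expansion, its vanishing on x + y + z = 0 and its coefficient 1 at x^d; the
  last two determine an invariant form of degree d. Characteristic zero keeps the nonzero integer
  coefficients nonzero in K and provides points where a given nonzero polynomial does not vanish.
  Algebraic closedness provides the d-th root that absorbs the factor between two homogeneous
  coordinate vectors of the same image point.\<close>

definition inversions :: "nat \<Rightarrow> (nat \<Rightarrow> nat) \<Rightarrow> (nat \<times> nat) set" where
  "inversions n p = {(i, j). i < j \<and> j < n \<and> p j < p i}"

lemma finite_inversions [simp]: "finite (inversions n p)"
  by (rule finite_subset[of _ "{..<n} \<times> {..<n}"]) (auto simp: inversions_def)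

text \<open>Base case of the sorting argument in \<open>sign_eq_inversions\<close>: ascents give i
  <= p i by induction, and a permutation of an initial segment that lowers no element is the
  identity.\<close>

lemma no_descent_imp_id:
  assumes p: "p permutes {0..<n}" and asc: "\<And>i. Suc i < n \<Longrightarrow> p i < p (Suc i)"
  shows "p = id"
proof -
  have "i < n \<longrightarrow> i \<le> p i" for i
    by (induction i) (use asc in \<open>auto simp: Suc_le_eq intro: le_less_trans\<close>)
  then show ?thesis
    using permutes_natset_ge[OF p] by auto
qed

text \<open>Bubble sort: exchanging the two values at an adjacent descent reverses the sign and
  removes exactly one inversion.\<close>

lemma sign_eq_inversions:
  assumes "p permutes {0..<n}"
  shows "sign p = (- 1) ^ card (inversions n p)"
  using assms
proof (induction "card (inversions n p)" arbitrary: p rule: less_induct)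
  case less
  show ?case
  proof (cases "\<exists>i. Suc i < n \<and> p (Suc i) < p i")
    case False
    have inj: "inj p" using less.prems by (simp add: permutes_inj)
    have "p i < p (Suc i)" if "Suc i < n" for i
      using False that injD[OF inj, of i "Suc i"] by (metis linorder_neqE_nat n_not_Suc_n)
    then have "p = id" by (rule no_descent_imp_id[OF less.prems])
    moreover have "inversions n id = {}" by (auto simp: inversions_def)
    ultimately show ?thesis by simp
  next
    case True
    then obtain i where i: "Suc i < n" "p (Suc i) < p i" by blast
    define t where "t = transpose i (Suc i)"
    define q where "q = p \<circ> t"
    have t: "t permutes {0..<n}" unfolding t_def using i by (intro permutes_swap_id) auto
    have q: "q permutes {0..<n}" unfolding q_def using t less.prems by (rule permutes_compose)
    have tt [simp]: "t (t x) = x" for x by (simp add: t_def)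
    have t_less: "t x < t y" if "x < y" "\<not> (x = i \<and> y = Suc i)" for x y
      using that by (auto simp: t_def transpose_def)
    \<comment> \<open>Relabelling positions by \<open>t\<close> keeps the order of every pair except
      (i, i + 1), so the inversions of \<open>q\<close> correspond to those of \<open>p\<close>
      other than the removed descent.\<close>
    have "map_prod t t ` inversions n q = inversions n p - {(i, Suc i)}" (is "?l = ?r")
    proof (intro equalityI subsetI)
      fix w assume "w \<in> ?l"
      then obtain x y where w: "w = (t x, t y)" and xy: "x < y" "y < n" "q y < q x"
        by (auto simp: inversions_def)
      have ne: "\<not> (x = i \<and> y = Suc i)" using xy i by (auto simp: q_def t_def)
      have "t y < n" using t xy by (metis atLeastLessThan_iff permutes_in_image zero_le)
      moreover have "(t x, t y) \<noteq> (i, Suc i)"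
      proof
        assume "(t x, t y) = (i, Suc i)"
        then have "x = t i" "y = t (Suc i)" by (metis Pair_inject tt)+
        then show False using xy by (simp add: t_def)
      qed
      ultimately show "w \<in> ?r" using w xy t_less[OF xy(1) ne]
        by (auto simp: inversions_def q_def)
    next
      fix w assume "w \<in> ?r"
      then obtain x y where w: "w = (x, y)" and xy: "x < y" "y < n" "p y < p x"
        and ne: "\<not> (x = i \<and> y = Suc i)"
        by (auto simp: inversions_def)
      have "t y < n" using t xy by (metis atLeastLessThan_iff permutes_in_image zero_le)
      then have "(t x, t y) \<in> inversions n q"
        using xy t_less[OF xy(1) ne] by (auto simp: inversions_def q_def)
      then show "w \<in> ?l" unfolding w by (metis map_prod_simp rev_image_eqI tt)
    qed
    moreover have "inj (map_prod t t)"
      using t by (simp add: permutes_inj prod.inj_map)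
    ultimately have "card (inversions n q) = card (inversions n p - {(i, Suc i)})"
      by (metis card_image inj_on_subset top_greatest)
    moreover have "(i, Suc i) \<in> inversions n p" using i by (simp add: inversions_def)
    ultimately have card: "card (inversions n p) = Suc (card (inversions n q))"
      by (metis card_Suc_Diff1 finite_inversions)
    have "sign q = (- 1) ^ card (inversions n q)"
      using less.hyps[OF _ q] card by simp
    moreover have "sign q = sign p * sign t"
      unfolding q_def using less.prems t
      by (intro sign_compose) (auto intro: permutation_permutes[THEN iffD2])
    moreover have "sign t = -1" by (simp add: t_def sign_swap_id)
    ultimately show ?thesis using card by simp
  qed
qed

text \<open>Two counts share the earlier smaller values: the p i values below p i split into later
  and earlier ones, the i earlier positions into smaller and larger ones. If there are no inversions
  on one side of a position, its displacement alone gives their number on the other side.\<close>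

lemma card_later_smaller:
  assumes p: "p permutes {0..<n}" and i: "i < n"
  shows "card {j. i < j \<and> j < n \<and> p j < p i} + i = p i + card {j. j < i \<and> p i < p j}"
proof -
  have inj: "inj p" using p by (simp add: permutes_inj)
  have pi: "p i < n" using p i by (metis atLeastLessThan_iff permutes_in_image zero_le)
  have "p ` {j. j < n \<and> p j < p i} = {0..<p i}"
  proof (intro equalityI subsetI)
    fix v assume v: "v \<in> {0..<p i}"
    then have "v \<in> p ` {0..<n}" using p pi by (simp add: permutes_image)
    then show "v \<in> p ` {j. j < n \<and> p j < p i}" using v by auto
  qed auto
  then have "card {j. j < n \<and> p j < p i} = p i"
    by (metis card_atLeastLessThan card_image diff_zero inj inj_on_subset top_greatest)
  moreover have "{j. j < n \<and> p j < p i} =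
      {j. i < j \<and> j < n \<and> p j < p i} \<union> {j. j < i \<and> p j < p i}"
    using i by (auto simp: not_less) (metis le_neq_implies_less less_irrefl)
  moreover have "card ({j. i < j \<and> j < n \<and> p j < p i} \<union> {j. j < i \<and> p j < p i}) =
      card {j. i < j \<and> j < n \<and> p j < p i} + card {j. j < i \<and> p j < p i}"
    by (rule card_Un_disjoint) auto
  moreover have "{..<i} = {j. j < i \<and> p j < p i} \<union> {j. j < i \<and> p i < p j}"
  proof -
    have "p j \<noteq> p i" if "j < i" for j using injD[OF inj, of j i] that by auto
    then show ?thesis by (auto simp: not_less le_less)
  qed
  then have "i = card ({j. j < i \<and> p j < p i} \<union> {j. j < i \<and> p i < p j})"
    by (metis card_lessThan)
  moreover have "card ({j. j < i \<and> p j < p i} \<union> {j. j < i \<and> p i < p j}) =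
      card {j. j < i \<and> p j < p i} + card {j. j < i \<and> p i < p j}"
    by (rule card_Un_disjoint) auto
  ultimately show ?thesis by simp
qed

lemma card_earlier_larger:
  assumes p: "p permutes {0..<n}" and j: "j < n"
  shows "card {i. i < j \<and> p j < p i} + p j = j + card {i. j < i \<and> i < n \<and> p i < p j}"
  using card_later_smaller[OF assms] by simp

section \<open>The Sylvester determinant and its expansion\<close>

text \<open>
  The Sylvester matrix of \<open>x + y X + z X\<^sup>a\<close> and \<open>X\<^sup>d - 1\<close>: its determinant is the product of the
  forms \<open>L[j]\<close>, but it expands into monomials without any cyclic wrap-around.
\<close>

definition sylv :: "nat \<Rightarrow> nat \<Rightarrow> 'r::comm_ring_1 \<Rightarrow> 'r \<Rightarrow> 'r \<Rightarrow> 'r mat" where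
  "sylv d a x y z = mat (d + a) (d + a) (\<lambda>(i, j).
     if i < d then (if j = i then x else if j = i + 1 then y else if j = i + a then z else 0)
     else (if j = i then 1 else if j + d = i then - 1 else 0))"

text \<open>The permutations that avoid the zero entries of \<open>sylv\<close>, hence the ones that
  contribute to its Leibniz expansion. A row with index below d moves right by 0, 1 or a, selecting
  x, y or z; any other row stays, selecting 1, or moves left by d, selecting -1.\<close>

definition sylv_perms :: "nat \<Rightarrow> nat \<Rightarrow> (nat \<Rightarrow> nat) set" where
  "sylv_perms d a = {p. p permutes {0..<d + a} \<and>
     (\<forall>n<d. p n = n \<or> p n = n + 1 \<or> p n = n + a) \<and> (\<forall>n\<in>{d..<d + a}. p n = n \<or> p n + d = n)}"

definition steps :: "nat \<Rightarrow> nat \<Rightarrow> (nat \<Rightarrow> nat) \<Rightarrow> nat set" where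
  "steps d s p = {n. n < d \<and> p n = n + s}"

definition drops :: "nat \<Rightarrow> nat \<Rightarrow> (nat \<Rightarrow> nat) \<Rightarrow> nat set" where
  "drops d a p = {n \<in> {d..<d + a}. p n + d = n}"

lemma finite_steps [simp]: "finite (steps d s p)" by (simp add: steps_def)
lemma finite_drops [simp]: "finite (drops d s p)" by (simp add: drops_def)

lemma card_steps:
  assumes "2 \<le> a" "p \<in> sylv_perms d a"
  shows "card (steps d 0 p) + card (steps d 1 p) + card (steps d a p) = d"
proof -
  have "{..<d} = steps d 0 p \<union> steps d 1 p \<union> steps d a p"
    using assms by (auto simp: sylv_perms_def steps_def)
  then have "d = card (steps d 0 p \<union> steps d 1 p \<union> steps d a p)"
    by (metis card_lessThan)
  also have "\<dots> = card (steps d 0 p \<union> steps d 1 p) + card (steps d a p)"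
    using assms by (intro card_Un_disjoint) (auto simp: steps_def)
  also have "card (steps d 0 p \<union> steps d 1 p) = card (steps d 0 p) + card (steps d 1 p)"
    by (intro card_Un_disjoint) (auto simp: steps_def)
  finally show ?thesis by simp
qed

text \<open>The displacements of a permutation sum to zero. This is why only invariant monomials
  occur in the determinant: the exponents satisfy j + a k = d h, where h counts the drops.\<close>

lemma steps_drops:
  assumes a: "2 \<le> a" and p: "p \<in> sylv_perms d a"
  shows "card (steps d 1 p) + a * card (steps d a p) = d * card (drops d a p)"
proof -
  have perm: "p permutes {0..<d + a}" using p by (simp add: sylv_perms_def)
  have "(\<Sum>n = 0..<d + a. int (p n)) = (\<Sum>n = 0..<d + a. int n)"
    by (rule sum.reindex_bij_betw[OF permutes_imp_bij[OF perm]])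
  then have "0 = (\<Sum>n = 0..<d + a. int (p n) - int n)"
    by (simp add: sum_subtractf)
  also have "\<dots> = (\<Sum>n = 0..<d + a.
      of_bool (n \<in> steps d 1 p) + int a * of_bool (n \<in> steps d a p)
        - int d * of_bool (n \<in> drops d a p))"
  proof (rule sum.cong[OF refl])
    fix n assume "n \<in> {0..<d + a}"
    then show "int (p n) - int n = of_bool (n \<in> steps d 1 p)
        + int a * of_bool (n \<in> steps d a p) - int d * of_bool (n \<in> drops d a p)"
      using p a by (cases "n < d") (force simp: sylv_perms_def steps_def drops_def)+
  qed
  also have "\<dots> = (\<Sum>n = 0..<d + a. of_bool (n \<in> steps d 1 p))
      + int a * (\<Sum>n = 0..<d + a. of_bool (n \<in> steps d a p))
      - int d * (\<Sum>n = 0..<d + a. of_bool (n \<in> drops d a p))"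
    by (simp only: sum.distrib sum_subtractf sum_distrib_left)
  also have "\<dots> = int (card (steps d 1 p)) + int a * int (card (steps d a p))
      - int d * int (card (drops d a p))"
  proof -
    have "(\<Sum>n = 0..<d + a. of_bool (n \<in> S)) = int (card S)" if "S \<subseteq> {0..<d + a}" for S
      using that by (simp add: Int_absorb1)
    note this[of "steps d 1 p"] this[of "steps d a p"] this[of "drops d a p"]
    moreover have "steps d 1 p \<subseteq> {0..<d + a}" "steps d a p \<subseteq> {0..<d + a}"
      "drops d a p \<subseteq> {0..<d + a}"
      by (auto simp: steps_def drops_def)
    ultimately show ?thesis by simp
  qed
  finally have "int (card (steps d 1 p) + a * card (steps d a p)) = int (d * card (drops d a p))"
    by simp
  then show ?thesis by (simp only: of_nat_eq_iff)
qed

text \<open>An inversion (i, j) starts at a step by a or ends at a drop, as otherwise p i <= i + 1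
  <= j <= p j. No earlier value exceeds that of a step by a, so it starts exactly a inversions; no
  later value is below that of a drop, so it ends exactly d of them. The k h pairs of a step and a
  drop are all inversions and are counted twice.\<close>

lemma inversions_sylv:
  assumes a: "2 \<le> a" and p: "p \<in> sylv_perms d a"
  defines "k \<equiv> card (steps d a p)" and "h \<equiv> card (drops d a p)"
  shows "card (inversions (d + a) p) + k * h = a * k + d * h"
proof -
  let ?T = "steps d a p" and ?H = "drops d a p" and ?I = "inversions (d + a) p"
  have perm: "p permutes {0..<d + a}" using p by (simp add: sylv_perms_def)
  have low: "p n = n \<or> p n = n + 1 \<or> p n = n + a" if "n < d" for n
    using p that by (auto simp: sylv_perms_def)
  have high: "p n = n \<or> p n + d = n" if "n < d + a" "d \<le> n" for n
    using p that by (auto simp: sylv_perms_def)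
  define A where "A = (SIGMA i:?T. {j. i < j \<and> j < d + a \<and> p j < p i})"
  define B where "B = (SIGMA j:?H. {i. i < j \<and> p j < p i})"
  have cA: "card {j. i < j \<and> j < d + a \<and> p j < p i} = a" if "i \<in> ?T" for i
  proof -
    have i: "i < d" "p i = i + a" using that by (auto simp: steps_def)
    have "p j \<le> p i" if "j < i" for j using low[of j] i a that by auto
    then have "{j. j < i \<and> p i < p j} = {}" by (auto simp flip: not_le)
    then show ?thesis using card_later_smaller[OF perm, of i] i by simp
  qed
  have cB: "card {i. i < j \<and> p j < p i} = d" if "j \<in> ?H" for j
  proof -
    have j: "j < d + a" "d \<le> j" "p j + d = j" using that by (auto simp: drops_def)
    have "p j \<le> p i" if "j < i" "i < d + a" for i using high[of i] j that by auto
    then have "{i. j < i \<and> i < d + a \<and> p i < p j} = {}" by (auto simp flip: not_le)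
    then have "card {i. j < i \<and> i < d + a \<and> p i < p j} = 0" by (simp only: card.empty)
    then show ?thesis using card_earlier_larger[OF perm, of j] j by linarith
  qed
  have AB: "?I = A \<union> prod.swap ` B"
  proof (intro equalityI subsetI)
    fix w assume "w \<in> ?I"
    then obtain i j where w: "w = (i, j)" and ij: "i < j" "j < d + a" "p j < p i"
      by (auto simp: inversions_def)
    have "i \<in> ?T \<or> j \<in> ?H"
    proof (rule ccontr)
      assume neg: "\<not> (i \<in> ?T \<or> j \<in> ?H)"
      have "p i \<le> i + 1"
        using low[of i] high[of i] ij neg by (cases "i < d") (auto simp: steps_def)
      moreover have "j \<le> p j"
        using low[of j] high[of j] ij neg by (cases "j < d") (auto simp: drops_def)
      ultimately show False using ij by simp
    qed
    then show "w \<in> A \<union> prod.swap ` B"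
      using w ij by (auto simp: A_def B_def)
  next
    fix w assume "w \<in> A \<union> prod.swap ` B"
    then show "w \<in> ?I" by (auto simp: A_def B_def inversions_def drops_def)
  qed
  have TH: "A \<inter> prod.swap ` B = ?T \<times> ?H"
    by (auto simp: A_def B_def steps_def drops_def)
  have fin: "finite {j. i < j \<and> j < d + a \<and> p j < p i}" "finite {i'. i' < j \<and> p j < p i'}" for i j
    by (auto intro: finite_subset[of _ "{..<d + a}"])
  have "card A = a * k" unfolding A_def using cA fin by (simp add: k_def)
  moreover have "card (prod.swap ` B) = d * h"
    unfolding B_def using cB fin by (simp add: h_def card_image)
  moreover have "finite A" "finite B" unfolding A_def B_def using fin by auto
  then have "card A + card (prod.swap ` B) = card ?I + card (?T \<times> ?H)"
    unfolding AB TH[symmetric] by (intro card_Un_Int) auto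
  ultimately show ?thesis by (simp add: k_def h_def)
qed

text \<open>The coefficient of x^(d-j-k) y^j z^k in the determinant. It is kept as an integer, so
  that one nonvanishing statement serves every field of characteristic zero.\<close>

definition norm_coeff :: "nat \<Rightarrow> nat \<Rightarrow> nat \<Rightarrow> nat \<Rightarrow> int" where
  "norm_coeff d a j k = (\<Sum>p | p \<in> sylv_perms d a \<and> card (steps d 1 p) = j \<and> card (steps d a p) = k.
     sign p * (- 1) ^ card (drops d a p))"

lemma finite_sylv_perms [simp]: "finite (sylv_perms d a)"
  by (rule finite_subset[OF _ finite_permutations[of "{0..<d + a}"]]) (auto simp: sylv_perms_def)

text \<open>Fixing j and k fixes h through d h = j + a k, and then \<open>inversions_sylv\<close>
  fixes the sign of each summand; up to sign the sum is the number of permutations with these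
  exponents.\<close>

lemma norm_coeff_nonzero:
  assumes a: "2 \<le> a" and d: "0 < d"
    and p: "p \<in> sylv_perms d a" "card (steps d 1 p) = j" "card (steps d a p) = k"
  shows "norm_coeff d a j k \<noteq> 0"
proof -
  let ?P = "{p \<in> sylv_perms d a. card (steps d 1 p) = j \<and> card (steps d a p) = k}"
  define h where "h = card (drops d a p)"
  have "sign q * (- 1) ^ card (drops d a q) = (- 1) ^ (a * k + d * h + k * h + h)"
    if q: "q \<in> ?P" for q
  proof -
    have "d * card (drops d a q) = d * h"
      using steps_drops[OF a, of q d] steps_drops[OF a p(1)] q p by (simp add: h_def)
    then have h: "card (drops d a q) = h" using d by simp
    have "card (inversions (d + a) q) + k * h = a * k + d * h"
      using inversions_sylv[OF a, of q d] q h by simp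
    then have "even (card (inversions (d + a) q)) = even (a * k + d * h + k * h)"
      by (metis even_add add.assoc)
    moreover have "sign q = (- 1) ^ card (inversions (d + a) q)"
      using q by (intro sign_eq_inversions) (simp add: sylv_perms_def)
    ultimately show ?thesis unfolding h by (simp add: power_add minus_one_power_iff)
  qed
  then have "norm_coeff d a j k = of_nat (card ?P) * (- 1) ^ (a * k + d * h + k * h + h)"
    by (simp add: norm_coeff_def)
  moreover have "card ?P \<noteq> 0" using p by (subst card_0_eq) auto
  ultimately show ?thesis by simp
qed

lemma det_sylv_perms:
  fixes x y z :: "'r::comm_ring_1"
  assumes a: "2 \<le> a" and d: "0 < d"
  shows "det (sylv d a x y z) = (\<Sum>p\<in>sylv_perms d a.
    of_int (sign p * (- 1) ^ card (drops d a p)) *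
      (x ^ card (steps d 0 p) * y ^ card (steps d 1 p) * z ^ card (steps d a p)))"
proof -
  let ?M = "sylv d a x y z" and ?N = "{0..<d + a}"
  have entry: "?M $$ (i, p i) = (if i < d then
      (if p i = i then x else if p i = i + 1 then y else if p i = i + a then z else 0)
      else (if p i = i then 1 else if p i + d = i then - 1 else 0))"
    if "p permutes ?N" "i < d + a" for p i
  proof -
    have "p i < d + a" using that by (metis atLeastLessThan_iff permutes_in_image zero_le)
    then show ?thesis using that by (simp add: sylv_def)
  qed
  have "det ?M = (\<Sum>p | p permutes ?N. signof p * (\<Prod>i\<in>?N. ?M $$ (i, p i)))"
    by (simp add: det_def sylv_def)
  also have "\<dots> = (\<Sum>p\<in>sylv_perms d a. signof p * (\<Prod>i\<in>?N. ?M $$ (i, p i)))"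
  proof (rule sum.mono_neutral_right)
    show "\<forall>p\<in>{p. p permutes ?N} - sylv_perms d a. signof p * (\<Prod>i\<in>?N. ?M $$ (i, p i)) = 0"
    proof
      fix p assume p: "p \<in> {p. p permutes ?N} - sylv_perms d a"
      then have perm: "p permutes ?N" by simp
      have "\<exists>i<d + a. ?M $$ (i, p i) = 0"
      proof (rule ccontr)
        assume nz: "\<not> (\<exists>i<d + a. ?M $$ (i, p i) = 0)"
        have "p \<in> sylv_perms d a"
          unfolding sylv_perms_def
        proof (intro CollectI conjI allI ballI impI perm)
          fix n assume "n < d"
          then show "p n = n \<or> p n = n + 1 \<or> p n = n + a"
            using nz entry[OF perm, of n] by (auto split: if_splits)
        next
          fix n assume "n \<in> {d..<d + a}"
          then show "p n = n \<or> p n + d = n"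
            using nz entry[OF perm, of n] by (auto split: if_splits)
        qed
        then show False using p by simp
      qed
      then have "(\<Prod>i\<in>?N. ?M $$ (i, p i)) = 0"
        by (intro prod_zero) auto
      then show "signof p * (\<Prod>i\<in>?N. ?M $$ (i, p i)) = 0" by simp
    qed
  qed (auto simp: finite_permutations sylv_perms_def)
  also have "\<dots> = (\<Sum>p\<in>sylv_perms d a. of_int (sign p * (- 1) ^ card (drops d a p)) *
      (x ^ card (steps d 0 p) * y ^ card (steps d 1 p) * z ^ card (steps d a p)))"
  proof (rule sum.cong[OF refl])
    fix p assume p: "p \<in> sylv_perms d a"
    then have perm: "p permutes ?N" by (simp add: sylv_perms_def)
    \<comment> \<open>The four index sets are disjoint, so each entry is a product of conditional
      factors of which at most one differs from the default 1; the product over the rows then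
      separates into powers.\<close>
    define f where "f i = (if i \<in> steps d 0 p then x else 1) * (if i \<in> steps d 1 p then y else 1)
      * (if i \<in> steps d a p then z else 1) * (if i \<in> drops d a p then - 1 else 1)" for i
    have "(\<Prod>i\<in>?N. ?M $$ (i, p i)) = (\<Prod>i\<in>?N. f i)"
    proof (rule prod.cong[OF refl])
      fix i assume i: "i \<in> ?N"
      show "?M $$ (i, p i) = f i"
      proof (cases "i < d")
        case True
        then have "p i = i \<or> p i = i + 1 \<or> p i = i + a" using p by (simp add: sylv_perms_def)
        then show ?thesis
          unfolding entry[OF perm i[simplified]] f_def steps_def drops_def using True a by auto
      next
        case False
        then have "p i = i \<or> p i + d = i" using p i by (simp add: sylv_perms_def)
        then show ?thesis
          unfolding entry[OF perm i[simplified]] f_def steps_def drops_def using False d i by auto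
      qed
    qed
    also have "\<dots> = x ^ card (steps d 0 p) * y ^ card (steps d 1 p) * z ^ card (steps d a p)
        * (- 1) ^ card (drops d a p)"
    proof -
      have *: "(\<Prod>i\<in>?N. if i \<in> S then c else 1) = c ^ card S" if "S \<subseteq> ?N" for S and c :: 'r
        using that by (simp add: prod.If_cases Int_absorb1)
      have sub: "steps d 0 p \<subseteq> ?N" "steps d 1 p \<subseteq> ?N" "steps d a p \<subseteq> ?N" "drops d a p \<subseteq> ?N"
        by (auto simp: steps_def drops_def)
      show ?thesis
        unfolding f_def prod.distrib sub[THEN *] ..
    qed
    finally have eq: "(\<Prod>i\<in>?N. ?M $$ (i, p i)) = \<dots>" .
    show "signof p * (\<Prod>i\<in>?N. ?M $$ (i, p i)) =
      of_int (sign p * (- 1) ^ card (drops d a p)) *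
      (x ^ card (steps d 0 p) * y ^ card (steps d 1 p) * z ^ card (steps d a p))"
      unfolding eq of_int_mult of_int_power of_int_minus of_int_1 by (simp only: ac_simps)
  qed
  finally show ?thesis .
qed

text \<open>Exponents of y and z in the invariant monomials of degree d; the exponent of x is d - j
  - k.\<close>

definition inv_pairs :: "nat \<Rightarrow> nat \<Rightarrow> (nat \<times> nat) set" where
  "inv_pairs d a = {(j, k). j + k \<le> d \<and> d dvd j + a * k}"

lemma finite_inv_pairs [simp]: "finite (inv_pairs d a)"
  by (rule finite_subset[of _ "{..d} \<times> {..d}"]) (auto simp: inv_pairs_def)

lemma det_sylv:
  fixes x y z :: "'r::comm_ring_1"
  assumes a: "2 \<le> a" and d: "0 < d"
  shows "det (sylv d a x y z) = (\<Sum>(j, k)\<in>inv_pairs d a.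
    of_int (norm_coeff d a j k) * (x ^ (d - j - k) * y ^ j * z ^ k))"
proof -
  define g where "g p = (card (steps d 1 p), card (steps d a p))" for p
  define h where "h p = of_int (sign p * (- 1) ^ card (drops d a p)) *
    (x ^ (d - fst (g p) - snd (g p)) * y ^ fst (g p) * z ^ snd (g p))" for p
  have "det (sylv d a x y z) = (\<Sum>p\<in>sylv_perms d a. h p)"
    unfolding det_sylv_perms[OF assms]
  proof (rule sum.cong[OF refl])
    fix p assume "p \<in> sylv_perms d a"
    from card_steps[OF a this]
    have "card (steps d 0 p) = d - fst (g p) - snd (g p)" by (simp add: g_def)
    then show "of_int (sign p * (- 1) ^ card (drops d a p)) *
      (x ^ card (steps d 0 p) * y ^ card (steps d 1 p) * z ^ card (steps d a p)) = h p"
      by (simp add: h_def g_def)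
  qed
  also have "\<dots> = (\<Sum>w\<in>inv_pairs d a. \<Sum>p | p \<in> sylv_perms d a \<and> g p = w. h p)"
  proof (rule sum.group[symmetric])
    show "g ` sylv_perms d a \<subseteq> inv_pairs d a"
    proof
      fix w assume "w \<in> g ` sylv_perms d a"
      then obtain p where p: "p \<in> sylv_perms d a" "w = g p" by blast
      then show "w \<in> inv_pairs d a"
        using card_steps[OF a p(1)] steps_drops[OF a p(1)] by (simp add: g_def inv_pairs_def)
    qed
  qed auto
  also have "\<dots> = (\<Sum>(j, k)\<in>inv_pairs d a.
      of_int (norm_coeff d a j k) * (x ^ (d - j - k) * y ^ j * z ^ k))"
  proof (rule sum.cong[OF refl], clarify)
    fix j k
    have "(\<Sum>p | p \<in> sylv_perms d a \<and> g p = (j, k). h p) =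
      (\<Sum>p | p \<in> sylv_perms d a \<and> g p = (j, k).
        of_int (sign p * (- 1) ^ card (drops d a p)) * (x ^ (d - j - k) * y ^ j * z ^ k))"
      by (rule sum.cong) (auto simp: h_def)
    also have "\<dots> = of_int (norm_coeff d a j k) * (x ^ (d - j - k) * y ^ j * z ^ k)"
      by (simp add: norm_coeff_def g_def sum_distrib_right)
    finally show "(\<Sum>p | p \<in> sylv_perms d a \<and> g p = (j, k). h p) =
      of_int (norm_coeff d a j k) * (x ^ (d - j - k) * y ^ j * z ^ k)" .
  qed
  finally show ?thesis .
qed

text \<open>When x + y + z = 0, the polynomials x + y X + z X^a and X^d - 1 share the root X = 1, so
  the vector of the powers of 1 lies in the kernel of the matrix.\<close>

lemma det_sylv_zero:
  fixes x y z :: "'r::idom"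
  assumes a: "2 \<le> a" and d: "0 < d" and s: "x + y + z = 0"
  shows "det (sylv d a x y z) = 0"
proof -
  let ?n = "d + a" and ?v = "vec (d + a) (\<lambda>_. 1 :: 'r)"
  have "sylv d a x y z *\<^sub>v ?v = 0\<^sub>v ?n"
  proof (rule eq_vecI)
    fix i assume "i < dim_vec (0\<^sub>v ?n :: 'r vec)"
    then have i: "i < ?n" by simp
    have "(sylv d a x y z *\<^sub>v ?v) $ i = (\<Sum>j = 0..<?n. sylv d a x y z $$ (i, j))"
      using i by (simp add: sylv_def scalar_prod_def)
    also have "\<dots> = 0"
    proof (cases "i < d")
      case True
      have "(\<Sum>j = 0..<?n. sylv d a x y z $$ (i, j)) =
          (\<Sum>j = 0..<?n. (if j = i then x else 0) + (if j = i + 1 then y else 0)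
            + (if j = i + a then z else 0))"
        by (rule sum.cong) (use True a in \<open>auto simp: sylv_def\<close>)
      also have "\<dots> = x + y + z" using True a by (simp add: sum.distrib)
      finally show ?thesis using s by simp
    next
      case False
      have "(\<Sum>j = 0..<?n. sylv d a x y z $$ (i, j)) =
          (\<Sum>j = 0..<?n. (if j = i then 1 else 0) + (if j = i - d then - 1 else 0))"
        by (rule sum.cong) (use False d i in \<open>auto simp: sylv_def\<close>)
      also have "\<dots> = 0" using i by (simp add: sum.distrib)
      finally show ?thesis .
    qed
    finally show "(sylv d a x y z *\<^sub>v ?v) $ i = 0\<^sub>v ?n $ i" using i by simp
  qed (simp add: sylv_def)
  moreover have "?v \<noteq> 0\<^sub>v ?n" using d by (auto simp: vec_eq_iff)
  moreover have "sylv d a x y z \<in> carrier_mat ?n ?n" by (simp add: sylv_def)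
  moreover have "?v \<in> carrier_vec ?n" by simp
  ultimately show ?thesis by (metis det_0_iff_vec_prod_zero)
qed

text \<open>Without upward moves the rows with index below d are fixed, and a drop from n >= d would
  reach n - d < a < d, a column already taken. So only the identity contributes.\<close>

lemma norm_coeff_0_0:
  assumes a: "2 \<le> a" "a < d"
  shows "norm_coeff d a 0 0 = 1"
proof -
  have "{p \<in> sylv_perms d a. card (steps d 1 p) = 0 \<and> card (steps d a p) = 0} = {id}"
  proof (intro equalityI subsetI)
    fix p assume p: "p \<in> {p \<in> sylv_perms d a. card (steps d 1 p) = 0 \<and> card (steps d a p) = 0}"
    then have perm: "p permutes {0..<d + a}" by (simp add: sylv_perms_def)
    have low: "p n = n" if "n < d" for n
      using p that by (auto simp: sylv_perms_def steps_def)
    have "n \<le> p n" if "n \<in> {0..<d + a}" for n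
    proof (cases "n < d")
      case False
      have "p n + d \<noteq> n"
      proof
        assume h: "p n + d = n"
        then have "p (p n) = p n" using that a low by simp
        then show False using h a permutes_inj[OF perm] by (metis add_cancel_right_right injD not_less0)
      qed
      moreover have "p n = n \<or> p n + d = n" using p that False by (simp add: sylv_perms_def)
      ultimately show ?thesis by simp
    qed (simp add: low)
    then show "p \<in> {id}" using permutes_natset_ge[OF perm] by simp
  qed (use a in \<open>auto simp: sylv_perms_def steps_def permutes_id\<close>)
  moreover have "drops d a id = {}" using a by (auto simp: drops_def)
  ultimately show ?thesis by (simp add: norm_coeff_def)
qed

section \<open>A permutation for every invariant monomial\<close>

lemma sum_shift_div:
  fixes k d :: int
  assumes "0 < d"
  shows "(\<Sum>n<nat d. ((int n - int t) * k) div d) = (\<Sum>n<nat d. (int n * k) div d) - int t * k"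
proof (induction t)
  case (Suc t)
  \<comment> \<open>Neighbouring windows of length d differ in their end terms, which lie d places
    apart and therefore differ by k.\<close>
  define F where "F n = ((int n - int (Suc t)) * k) div d" for n
  have "(\<Sum>n<nat d. F (Suc n)) - (\<Sum>n<nat d. F n) = F (nat d) - F 0"
    by (simp add: sum_subtractf[symmetric] sum_lessThan_telescope)
  also have "F (nat d) = F 0 + k"
  proof -
    have "(int (nat d) - int (Suc t)) * k = - int (Suc t) * k + k * d"
      using assms by (simp add: algebra_simps)
    then show ?thesis using assms unfolding F_def by simp
  qed
  finally have "(\<Sum>n<nat d. F n) = (\<Sum>n<nat d. F (Suc n)) - k" by simp
  moreover have "F (Suc n) = ((int n - int t) * k) div d" for n by (simp add: F_def)
  ultimately show ?case using Suc.IH by (simp add: F_def algebra_simps)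
qed simp

text \<open>Adding c carries m past a multiple of d exactly when the residue of m is at least d - c.
  Counting large residues thus becomes a difference of two sums of quotients.\<close>

lemma of_bool_mod_ge:
  fixes m c d :: int
  assumes "0 < d" "0 \<le> c" "c \<le> d"
  shows "of_bool (d - c \<le> m mod d) = (m + c) div d - m div d"
proof -
  have "(m + c) div d = (m div d * d + (m mod d + c)) div d" by (simp flip: add.assoc)
  also have "\<dots> = (m mod d + c) div d + m div d"
    using assms div_mult_self3[of d "m div d" "m mod d + c"] by simp
  also have "(m mod d + c) div d = of_bool (d - c \<le> m mod d)"
  proof (cases "d - c \<le> m mod d")
    case True
    have "m mod d < d" using assms by simp
    then have "m mod d + c - d < d" "0 \<le> m mod d + c - d" using True assms by linarith+
    then have "(m mod d + c - d) div d = 0" by (intro div_pos_pos_trivial)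
    then have "(m mod d + c) div d = 1" using True assms by (subst div_pos_geq) auto
    then show ?thesis using True by simp
  next
    case False
    then show ?thesis using assms by (simp add: div_pos_pos_trivial)
  qed
  finally show ?thesis by simp
qed

text \<open>Each count is a sum of floor((n k + c) / d) - floor(n k / d). For c = k it telescopes.
  For c = j + k the relation j + a k = d h rewrites n k + c as (n - (a - 1)) k + d h, a shifted
  window plus a constant. In \<open>sylv_perm_exists\<close> the first set consists of the n below d
  that step by a, the second of all n below d that move.\<close>

lemma card_phase_ge:
  assumes d: "0 < d" and jk: "(j, k) \<in> inv_pairs d a" and a: "1 \<le> a"
  shows "card {n \<in> {..<d}. d - k \<le> n * k mod d} = k"
    and "card {n \<in> {..<d}. d - j - k \<le> n * k mod d} = j + k"
proof -
  define F where "F n = (n * int k) div int d" for n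
  have jk': "j + k \<le> d" "d dvd j + a * k" using jk by (auto simp: inv_pairs_def)
  have count: "int (card {n \<in> {..<d}. d - c \<le> n * k mod d}) =
      (\<Sum>n<d. (int n * int k + int c) div int d) - (\<Sum>n<d. F (int n))" if "c \<le> d" for c
  proof -
    have "int (card {n \<in> {..<d}. d - c \<le> n * k mod d}) = (\<Sum>n<d. of_bool (d - c \<le> n * k mod d))"
      by (simp add: Collect_conj_eq lessThan_def)
    also have "\<dots> = (\<Sum>n<d. (int n * int k + int c) div int d - F (int n))"
    proof (rule sum.cong[OF refl])
      fix n
      have "(d - c \<le> n * k mod d) = (int d - int c \<le> int n * int k mod int d)"
        using that by (simp flip: of_nat_mult of_nat_mod of_nat_diff)
      then show "of_bool (d - c \<le> n * k mod d) = (int n * int k + int c) div int d - F (int n)"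
        using of_bool_mod_ge[of "int d" "int c" "int n * int k"] that d by (simp add: F_def)
    qed
    finally show ?thesis by (simp only: sum_subtractf)
  qed
  have "(\<Sum>n<d. F (int n + 1)) - (\<Sum>n<d. F (int n)) = F (int d) - F (int 0)"
    using sum_lessThan_telescope[of "\<lambda>n. F (int n)" d] by (simp add: sum_subtractf add.commute)
  also have "\<dots> = int k" using d by (simp add: F_def)
  finally show "card {n \<in> {..<d}. d - k \<le> n * k mod d} = k"
    using count[of k] jk' by (simp add: F_def algebra_simps)
  obtain h where h: "j + a * k = d * h" using jk'(2) by blast
  have "(int n * int k + int (j + k)) div int d = F (int n - int (a - 1)) + int h" for n
  proof -
    have "int j + int a * int k = int d * int h" using h by (simp flip: of_nat_mult of_nat_add)
    then have "int n * int k + int (j + k) = (int n - int (a - 1)) * int k + int h * int d"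
      using a by (simp add: algebra_simps of_nat_diff)
    then show ?thesis using d by (simp add: F_def)
  qed
  then have "(\<Sum>n<d. (int n * int k + int (j + k)) div int d) =
      (\<Sum>n<d. F (int n - int (a - 1))) + int d * int h"
    by (simp add: sum.distrib)
  also have "(\<Sum>n<d. F (int n - int (a - 1))) = (\<Sum>n<d. F (int n)) - int (a - 1) * int k"
    using sum_shift_div[of "int d" "a - 1" "int k"] d by (simp add: F_def)
  finally have "int (card {n \<in> {..<d}. d - (j + k) \<le> n * k mod d}) = int d * int h - int (a - 1) * int k"
    using count[of "j + k"] jk' by simp
  also have "\<dots> = int (j + k)"
    using h a by (simp add: algebra_simps of_nat_diff flip: of_nat_mult of_nat_add)
  finally show "card {n \<in> {..<d}. d - j - k \<le> n * k mod d} = j + k"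
    by simp
qed

text \<open>
  Give \<open>n\<close> the phase \<open>n k mod d\<close>. The step assigned to \<open>n\<close> depends on which of the consecutive
  intervals of lengths \<open>i\<close>, \<open>j\<close>, \<open>k\<close> contains its phase; the steps \<open>1\<close> and \<open>a\<close> add \<open>k\<close> and \<open>-j\<close> to the
  phase, so that they only exchange the last two intervals.
\<close>

lemma sylv_perm_exists:
  assumes a: "2 \<le> a" "a < d" and jk: "(j, k) \<in> inv_pairs d a"
  shows "\<exists>p\<in>sylv_perms d a. card (steps d 1 p) = j \<and> card (steps d a p) = k"
proof -
  have jk': "j + k \<le> d" "d dvd j + a * k" using jk by (auto simp: inv_pairs_def)
  define i where "i = d - j - k"
  have ijk: "i + j + k = d" using jk' by (simp add: i_def)
  define ph where "ph n = n * k mod d" for n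
  have ph_less: "ph n < d" for n using a by (simp add: ph_def)
  define q where "q n = n + (if ph n < i then 0 else if ph n < i + j then 1 else a)" for n
  have ph_mod: "ph (n mod d) = ph n" for n by (simp add: ph_def mod_mult_left_eq)
  \<comment> \<open>Because i + j + k = d, adding k to a phase below i + j, or subtracting j from a
    phase of at least i + j, stays within 0..d-1.\<close>
  have ph1: "ph (n + 1) = ph n + k" if "ph n < i + j" for n
  proof -
    have "ph (n + 1) = (ph n + k) mod d" by (simp add: ph_def mod_simps algebra_simps)
    then show ?thesis using that ijk by simp
  qed
  have pha: "ph (n + a) = ph n - j" if "i + j \<le> ph n" for n
  proof -
    have "ph (n + a) = (ph n + a * k) mod d" by (simp add: ph_def mod_simps algebra_simps)
    also have "ph n + a * k = ph n - j + (j + a * k)" using that by simp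
    finally have "ph (n + a) = (ph n - j + (j + a * k)) mod d" .
    also have "\<dots> = ph n - j" using jk'(2) ph_less[of n] by (auto elim!: dvdE)
    finally show ?thesis .
  qed
  have phq: "ph (q n) = (if ph n < i then ph n else if ph n < i + j then ph n + k else ph n - j)" for n
    using ph1[of n] pha[of n] by (simp add: q_def)
  \<comment> \<open>The three intervals have disjoint images: [0, i) stays, [i, i+j) moves to [i+k,
    d) and [i+j, d) moves to [i, i+k). So the phase of \<open>q n\<close> reveals the step taken,
    and the class of \<open>q n\<close> modulo d determines n.\<close>
  have q_mod: "m = n" if "m < d" "n < d" "q m mod d = q n mod d" for m n
  proof -
    have "ph (q m) = ph (q n)" using that(3) ph_mod by metis
    from this[unfolded phq] have "q m - m = q n - n"
      using ijk ph_less[of m] ph_less[of n] unfolding q_def by (auto split: if_splits)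
    then obtain s where s: "q m = m + s" "q n = n + s"
      unfolding q_def by (metis add_diff_cancel_left')
    have "m mod d = n mod d" using that(3) unfolding s by (simp add: nat_mod_eq_iff)
    then show ?thesis using that by simp
  qed
  \<comment> \<open>A row n >= d takes the column n - d if \<open>q\<close> leaves it free.
    Otherwise it takes its own column n, which \<open>q\<close> then misses because its values are
    distinct modulo d.\<close>
  define p where "p n = (if n < d then q n
    else if n < d + a \<and> n - d \<notin> q ` {..<d} then n - d else n)" for n
  have q_less: "q n < d + a" if "n < d" for n using a that by (simp add: q_def)
  have q_d: "q n \<noteq> n' + d" if "n < d" "q n'' = n'" "n'' < d" for n n' n''
  proof
    assume "q n = n' + d"
    then have "q n mod d = q n'' mod d" using that by simp
    then have "n = n''" using q_mod that by blast
    then show False using \<open>q n = n' + d\<close> that a by simp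
  qed
  have "inj_on p {0..<d + a}"
  proof (rule linorder_inj_onI)
    fix m n assume mn: "m < n" "m \<in> {0..<d + a}" "n \<in> {0..<d + a}"
    consider "n < d" | "m < d" "d \<le> n" "n - d \<in> q ` {..<d}"
      | "m < d" "d \<le> n" "n - d \<notin> q ` {..<d}" | "d \<le> m" by linarith
    then show "p m \<noteq> p n"
    proof cases
      case 1
      then show ?thesis using mn q_mod[of m n] by (auto simp: p_def)
    next
      case 2
      then obtain n'' where "n'' < d" "q n'' = n - d" by auto
      with q_d[of m n'' "n - d"] show ?thesis using 2 by (auto simp: p_def)
    next
      case 3
      then have "q m \<noteq> n - d" by (metis imageI lessThan_iff)
      then show ?thesis using 3 mn by (simp add: p_def)
    next
      case 4
      then show ?thesis using mn a by (auto simp: p_def)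
    qed
  qed auto
  moreover have "p ` {0..<d + a} \<subseteq> {0..<d + a}"
    using q_less a by (auto simp: p_def)
  ultimately have "bij_betw p {0..<d + a} {0..<d + a}"
    by (simp add: bij_betw_def endo_inj_surj)
  then have "p permutes {0..<d + a}"
    by (rule bij_imp_permutes) (auto simp: p_def)
  then have p: "p \<in> sylv_perms d a"
    by (auto simp: sylv_perms_def p_def q_def)
  have "steps d a p = {n \<in> {..<d}. d - k \<le> n * k mod d}"
    using a ijk by (auto simp: steps_def p_def q_def ph_def split: if_splits)
  then have k: "card (steps d a p) = k" using card_phase_ge[OF _ jk] a by simp
  have "{n \<in> {..<d}. d - j - k \<le> n * k mod d} = steps d 1 p \<union> steps d a p"
    using a ijk by (auto simp: steps_def p_def q_def ph_def i_def split: if_splits)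
  then have "j + k = card (steps d 1 p \<union> steps d a p)"
    using card_phase_ge[OF _ jk] a by simp
  also have "\<dots> = card (steps d 1 p) + card (steps d a p)"
    by (rule card_Un_disjoint) (use a in \<open>auto simp: steps_def\<close>)
  finally show ?thesis using p k by auto
qed

lemma norm_coeff_neq_0:
  assumes "2 \<le> a" "a < d" "(j, k) \<in> inv_pairs d a"
  shows "norm_coeff d a j k \<noteq> 0"
  using sylv_perm_exists[OF assms] norm_coeff_nonzero assms by auto

abbreviation "lookup \<equiv> Poly_Mapping.lookup"
abbreviation "keys \<equiv> Poly_Mapping.keys"
abbreviation "single \<equiv> Poly_Mapping.single"

subsection \<open>Evaluation of polynomials\<close>

definition mon_val :: "('i \<Rightarrow> 'r::comm_ring_1) \<Rightarrow> ('i \<Rightarrow>\<^sub>0 nat) \<Rightarrow> 'r" where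
  "mon_val \<sigma> m = (\<Prod>i\<in>keys m. \<sigma> i ^ lookup m i)"

lemma mon_val_superset:
  assumes "finite A" "keys m \<subseteq> A"
  shows "mon_val \<sigma> m = (\<Prod>i\<in>A. \<sigma> i ^ lookup m i)"
  unfolding mon_val_def using assms
  by (intro prod.mono_neutral_left) (auto simp: in_keys_iff)

lemma mon_val_add: "mon_val \<sigma> (m + n) = mon_val \<sigma> m * mon_val \<sigma> n"
proof -
  let ?A = "keys m \<union> keys n"
  have "mon_val \<sigma> (m + n) = (\<Prod>i\<in>?A. \<sigma> i ^ lookup (m + n) i)"
    using keys_add[of m n] by (intro mon_val_superset) auto
  also have "\<dots> = mon_val \<sigma> m * mon_val \<sigma> n"
    by (simp add: mon_val_superset[of ?A] lookup_add power_add prod.distrib)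
  finally show ?thesis .
qed

lemma mon_val_0 [simp]: "mon_val \<sigma> 0 = 1"
  by (simp add: mon_val_def)

lemma mon_val_single [simp]: "mon_val \<sigma> (single i n) = \<sigma> i ^ n"
  by (cases "n = 0") (simp_all add: mon_val_def)

lemma mon_val_mult: "mon_val (\<lambda>i. \<sigma> i * \<tau> i) m = mon_val \<sigma> m * mon_val \<tau> m"
  by (simp add: mon_val_def power_mult_distrib prod.distrib)

lemma mon_val_power: "mon_val (\<lambda>i. \<sigma> i ^ n) m = mon_val \<sigma> m ^ n"
  by (simp add: mon_val_def prod_power_distrib mult.commute flip: power_mult)

lemma mdeg_superset:
  assumes "finite A" "keys m \<subseteq> A"
  shows "mdeg m = (\<Sum>i\<in>A. lookup m i)"
  unfolding mdeg_def using assms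
  by (intro sum.mono_neutral_left) (auto simp: in_keys_iff)

lemma mdeg_add [simp]: "mdeg (m + n) = mdeg m + mdeg n"
proof -
  let ?A = "keys m \<union> keys n"
  have "mdeg (m + n) = (\<Sum>i\<in>?A. lookup (m + n) i)"
    using keys_add[of m n] by (intro mdeg_superset) auto
  also have "\<dots> = mdeg m + mdeg n"
    by (simp add: mdeg_superset[of ?A] lookup_add sum.distrib)
  finally show ?thesis .
qed

lemma mdeg_0 [simp]: "mdeg 0 = 0"
  by (simp add: mdeg_def)

lemma mdeg_single [simp]: "mdeg (single i n) = n"
  by (cases "n = 0") (simp_all add: mdeg_def)

lemma mdeg_eq_0 [simp]: "mdeg m = 0 \<longleftrightarrow> m = 0"
  by (auto simp: mdeg_def in_keys_iff intro: poly_mapping_eqI)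

lemma mon_val_const_mult: "mon_val (\<lambda>i. c * \<sigma> i) m = c ^ mdeg m * mon_val \<sigma> m"
  by (simp add: mon_val_def mdeg_def power_mult_distrib prod.distrib power_sum)

lemma poly_mapping_eq_sum_single:
  assumes "finite A" "keys F \<subseteq> A"
  shows "F = (\<Sum>m\<in>A. single m (lookup F m))"
proof (rule poly_mapping_eqI)
  fix n
  have "lookup F n = (\<Sum>m\<in>A. if m = n then lookup F m else 0)"
    using assms by (auto simp: in_keys_iff)
  also have "\<dots> = lookup (\<Sum>m\<in>A. single m (lookup F m)) n"
    unfolding lookup_sum by (rule sum.cong) (auto simp: lookup_single when_def)
  finally show "lookup F n = lookup (\<Sum>m\<in>A. single m (lookup F m)) n" .
qed

text \<open>Shared by evaluation at points (\<open>c\<close> the identity), by the diagonal action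
  (\<open>c\<close> is \<open>mconst\<close>) and by substitution of univariate polynomials
  (\<open>c\<close> embeds the constants).\<close>

locale coeff_hom =
  fixes c :: "'k::comm_ring_1 \<Rightarrow> 'r::comm_ring_1"
  assumes c_0: "c 0 = 0" and c_1: "c 1 = 1"
    and c_add: "c (s + t) = c s + c t" and c_mult: "c (s * t) = c s * c t"
begin

lemma msubst_superset:
  assumes "finite A" "keys F \<subseteq> A"
  shows "msubst c \<sigma> F = (\<Sum>m\<in>A. c (lookup F m) * mon_val \<sigma> m)"
  unfolding msubst_def mon_val_def[symmetric] using assms
  by (intro sum.mono_neutral_left) (auto simp: in_keys_iff c_0)

lemma msubst_single [simp]: "msubst c \<sigma> (single m k) = c k * mon_val \<sigma> m"
  by (simp add: msubst_superset[of "{m}"] c_0)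

lemma msubst_0 [simp]: "msubst c \<sigma> 0 = 0"
  by (simp add: msubst_def)

lemma msubst_add: "msubst c \<sigma> (F + G) = msubst c \<sigma> F + msubst c \<sigma> G"
proof -
  let ?A = "keys F \<union> keys G"
  have "msubst c \<sigma> (F + G) = (\<Sum>m\<in>?A. c (lookup (F + G) m) * mon_val \<sigma> m)"
    using keys_add[of F G] by (intro msubst_superset) auto
  also have "\<dots> = msubst c \<sigma> F + msubst c \<sigma> G"
    by (simp add: msubst_superset[of ?A] lookup_add c_add distrib_right sum.distrib)
  finally show ?thesis .
qed

lemma msubst_sum: "msubst c \<sigma> (sum f A) = (\<Sum>x\<in>A. msubst c \<sigma> (f x))"
  by (induction A rule: infinite_finite_induct) (simp_all add: msubst_add)

lemma msubst_mult: "msubst c \<sigma> (F * G) = msubst c \<sigma> F * msubst c \<sigma> G"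
proof -
  have "F * G = (\<Sum>m\<in>keys F. single m (lookup F m)) * (\<Sum>n\<in>keys G. single n (lookup G n))"
    by (intro arg_cong2[of _ _ _ _ "(*)"] poly_mapping_eq_sum_single) auto
  also have "\<dots> = (\<Sum>m\<in>keys F. \<Sum>n\<in>keys G. single (m + n) (lookup F m * lookup G n))"
    by (simp add: sum_product mult_single)
  also have "msubst c \<sigma> \<dots> = (\<Sum>m\<in>keys F. \<Sum>n\<in>keys G.
      (c (lookup F m) * mon_val \<sigma> m) * (c (lookup G n) * mon_val \<sigma> n))"
    by (simp only: msubst_sum msubst_single mon_val_add c_mult ac_simps)
  also have "\<dots> = msubst c \<sigma> F * msubst c \<sigma> G"
    by (simp add: msubst_superset[of "keys F"] msubst_superset[of "keys G"] sum_product)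
  finally show ?thesis .
qed

lemma msubst_const [simp]: "msubst c \<sigma> (mconst k) = c k"
  by (simp add: mconst_def)

lemma msubst_var [simp]: "msubst c \<sigma> (mvar i) = \<sigma> i"
  by (simp add: mvar_def c_1)

lemma msubst_1 [simp]: "msubst c \<sigma> 1 = 1"
  using msubst_const[of \<sigma> 1] by (simp add: mconst_def c_1)

lemma msubst_prod: "msubst c \<sigma> (prod f A) = (\<Prod>x\<in>A. msubst c \<sigma> (f x))"
  by (induction A rule: infinite_finite_induct) (simp_all add: msubst_mult)

lemma msubst_power: "msubst c \<sigma> (F ^ n) = msubst c \<sigma> F ^ n"
  by (induction n) (simp_all add: msubst_mult)

lemma msubst_lin_form [simp]:
  "msubst c \<sigma> (lin_form \<alpha> \<beta> \<gamma>) = c \<alpha> * \<sigma> 0 + c \<beta> * \<sigma> 1 + c \<gamma> * \<sigma> 2"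
  by (simp add: lin_form_def msubst_add msubst_mult)

end

lemma mconst_0 [simp]: "mconst 0 = 0"
  and mconst_1 [simp]: "mconst 1 = 1"
  by (simp_all add: mconst_def)

lemma mconst_add: "mconst (a + b) = mconst a + mconst b"
  and mconst_mult: "mconst (a * b) = mconst a * mconst b"
  and mconst_uminus: "mconst (- a) = - mconst a"
  and mconst_power: "mconst (a ^ n) = mconst a ^ n"
proof -
  show "mconst (a + b) = mconst a + mconst b" "mconst (- a) = - mconst a"
    by (simp_all add: mconst_def single_add single_uminus)
  show *: "mconst (a * b) = mconst a * mconst b" for a b :: 'b by (simp add: mconst_def mult_single)
  show "mconst (a ^ n) = mconst a ^ n" by (induction n) (simp_all add: *)
qed

lemma mconst_prod: "mconst (prod f A) = (\<Prod>x\<in>A. mconst (f x))"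
  by (induction A rule: infinite_finite_induct) (simp_all add: mconst_mult)

interpretation val: coeff_hom "\<lambda>c :: 'k::comm_ring_1. c"
  by unfold_locales simp_all

interpretation act: coeff_hom "mconst :: 'k::comm_ring_1 \<Rightarrow> ('i, 'k) mpol"
  by unfold_locales (simp_all add: mconst_add mconst_mult)

lemmas mval_simps [simp] =
  val.msubst_single[folded mval_def] val.msubst_0[folded mval_def] val.msubst_const[folded mval_def]
  val.msubst_var[folded mval_def] val.msubst_1[folded mval_def] val.msubst_lin_form[folded mval_def]

lemmas mval_hom =
  val.msubst_add[folded mval_def] val.msubst_mult[folded mval_def] val.msubst_sum[folded mval_def]
  val.msubst_prod[folded mval_def] val.msubst_power[folded mval_def]

lemma mval_superset:
  assumes "finite A" "keys F \<subseteq> A"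
  shows "mval F v = (\<Sum>m\<in>A. lookup F m * mon_val v m)"
  unfolding mval_def by (rule val.msubst_superset[OF assms])

lemma lookup_mconst_mult [simp]: "lookup (mconst c * F) m = c * lookup F m"
proof -
  have "mconst c * F = Poly_Mapping.map ((*) c) F"
    by (simp add: mconst_def mult_map_scale_conv_mult)
  then show ?thesis by (simp add: Poly_Mapping.map.rep_eq when_def)
qed

lemma single_eq_mconst_mult: "single m c = mconst c * single m 1"
  by (simp add: mconst_def mult_single)

lemma prod_single: "(\<Prod>i\<in>A. single (f i) 1) = single (\<Sum>i\<in>A. f i) (1 :: 'k::comm_ring_1)"
  by (induction A rule: infinite_finite_induct) (simp_all add: mult_single)

lemma mon_val_mvar: "mon_val mvar m = single m 1"
proof -
  have "mvar i ^ k = single (single i k) (1 :: 'b)" for i :: 'a and k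
    by (induction k) (simp_all add: mvar_def mult_single flip: single_add)
  then have "mon_val mvar m = (\<Prod>i\<in>keys m. single (single i (lookup m i)) (1 :: 'b))"
    by (simp add: mon_val_def)
  also have "\<dots> = single (\<Sum>i\<in>keys m. single i (lookup m i)) 1"
    by (rule prod_single)
  also have "(\<Sum>i\<in>keys m. single i (lookup m i)) = m"
    by (rule poly_mapping_eq_sum_single[symmetric]) auto
  finally show ?thesis .
qed

lemma mon_val_scaled_vars: "mon_val (\<lambda>i. mconst (u i) * mvar i) m = single m (mon_val u m)"
proof -
  have "mon_val (\<lambda>i. mconst (u i)) m = (mconst (mon_val u m) :: ('a, 'b) mpol)"
    by (simp add: mon_val_def mconst_prod mconst_power)
  then show ?thesis by (simp add: mon_val_mult mon_val_mvar mconst_def mult_single)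
qed

text \<open>Every monomial is an eigenvector of a diagonal matrix, so a form is fixed exactly when
  all its monomials are; this is why the ideal of invariants is monomial.\<close>

lemma lookup_diag_act [simp]: "lookup (diag_act u F) m = lookup F m * mon_val u m"
proof -
  have "diag_act u F = (\<Sum>n\<in>keys F. single n (lookup F n * mon_val u n))"
    unfolding diag_act_def act.msubst_superset[OF finite_keys order_refl] mon_val_scaled_vars
    by (simp add: mconst_def mult_single)
  also have "lookup \<dots> m = (\<Sum>n\<in>keys F. if n = m then lookup F m * mon_val u m else 0)"
    unfolding lookup_sum by (rule sum.cong) (auto simp: lookup_single when_def)
  also have "\<dots> = lookup F m * mon_val u m" by (simp add: in_keys_iff)
  finally show ?thesis .
qed

subsection \<open>Forms\<close>

lemma forms_iff: "F \<in> forms n \<longleftrightarrow> (\<forall>m. lookup F m \<noteq> 0 \<longrightarrow> mdeg m = n)"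
  by (auto simp: forms_def in_keys_iff)

lemma forms_0 [simp]: "0 \<in> forms n" by (simp add: forms_def)

lemma forms_add: "F \<in> forms n \<Longrightarrow> G \<in> forms n \<Longrightarrow> F + G \<in> forms n"
  unfolding forms_def using keys_add[of F G] by blast

lemma forms_sum: "(\<And>x. x \<in> A \<Longrightarrow> f x \<in> forms n) \<Longrightarrow> sum f A \<in> forms n"
  by (induction A rule: infinite_finite_induct) (simp_all add: forms_add)

lemma forms_mult: "F \<in> forms n \<Longrightarrow> G \<in> forms k \<Longrightarrow> F * G \<in> forms (n + k)"
  unfolding forms_def using keys_mult[of F G] by fastforce

lemma forms_single [simp]: "single m c \<in> forms n \<longleftrightarrow> c = 0 \<or> mdeg m = n"
  by (simp add: forms_def)

lemma forms_const [simp]: "mconst c \<in> forms 0" by (simp add: mconst_def)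

lemma forms_const_mult: "F \<in> forms n \<Longrightarrow> mconst c * F \<in> forms n"
  unfolding forms_iff lookup_mconst_mult by (metis mult_zero_right)

lemma forms_var [simp]: "mvar i \<in> forms 1" by (simp add: mvar_def)

lemma forms_prod: "(\<And>x. x \<in> A \<Longrightarrow> f x \<in> forms (g x)) \<Longrightarrow> prod f A \<in> forms (sum g A)"
proof (induction A rule: infinite_finite_induct)
  case (insert x A)
  then show ?case by (simp add: forms_mult)
qed (use forms_const[of 1] in simp_all)

lemma forms_power: "F \<in> forms n \<Longrightarrow> F ^ k \<in> forms (k * n)"
proof (induction k)
  case 0
  then show ?case using forms_const[of 1] by simp
qed (simp add: forms_mult)

lemma forms_lin_form [simp]: "lin_form \<alpha> \<beta> \<gamma> \<in> forms 1"
  unfolding lin_form_def by (intro forms_add forms_const_mult forms_var)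

lemma mval_scale:
  assumes "F \<in> forms n"
  shows "mval F (\<lambda>i. c * v i) = c ^ n * mval F v"
proof -
  have "mval F (\<lambda>i. c * v i) = (\<Sum>m\<in>keys F. c ^ n * (lookup F m * mon_val v m))"
    unfolding mval_superset[of "keys F" F, simplified]
    using assms by (intro sum.cong) (auto simp: forms_def mon_val_const_mult)
  then show ?thesis
    by (simp add: mval_superset[of "keys F"] sum_distrib_left)
qed

definition hcomp :: "nat \<Rightarrow> ('i, 'k::comm_ring_1) mpol \<Rightarrow> ('i, 'k) mpol" where
  "hcomp n F = (\<Sum>m | m \<in> keys F \<and> mdeg m = n. single m (lookup F m))"

lemma lookup_hcomp [simp]: "lookup (hcomp n F) m = (if mdeg m = n then lookup F m else 0)"
proof -
  have "lookup (hcomp n F) m = (\<Sum>k | k \<in> keys F \<and> mdeg k = n. if k = m then lookup F k else 0)"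
    unfolding hcomp_def lookup_sum by (rule sum.cong) (auto simp: lookup_single when_def)
  also have "\<dots> = (if m \<in> {k. k \<in> keys F \<and> mdeg k = n} then lookup F m else 0)"
    by (rule sum.delta) simp
  also have "\<dots> = (if mdeg m = n then lookup F m else 0)"
    by (cases "m \<in> keys F") (simp_all add: in_keys_iff)
  finally show ?thesis .
qed

lemma hcomp_forms [simp]: "F \<in> forms n \<Longrightarrow> hcomp n F = F"
  by (rule poly_mapping_eqI) (auto simp: forms_iff)

lemma hcomp_add: "hcomp n (F + G) = hcomp n F + hcomp n G"
  by (rule poly_mapping_eqI) (simp only: lookup_add lookup_hcomp split: if_split, simp)

lemma hcomp_sum: "hcomp n (sum f A) = (\<Sum>x\<in>A. hcomp n (f x))"
  by (induction A rule: infinite_finite_induct) (simp_all add: hcomp_add hcomp_forms)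

text \<open>A term of F of positive degree lifts G above degree n, so only the constant term of F
  survives.\<close>

lemma hcomp_mult_form:
  assumes "G \<in> forms n"
  shows "hcomp n (F * G) = mconst (lookup F 0) * G"
proof -
  have *: "hcomp n (single m c * G) = (if m = 0 then mconst c * G else 0)" for m and c :: 'b
  proof (cases "m = 0")
    case True
    then have "single m c = mconst c" by (simp add: mconst_def)
    then show ?thesis using assms True by (simp add: forms_const_mult)
  next
    case False
    have "single m c * G \<in> forms (mdeg m + n)" using assms by (intro forms_mult) auto
    then have "lookup (single m c * G) k \<noteq> 0 \<Longrightarrow> mdeg k \<noteq> n" for k
      using False by (auto simp: forms_iff)
    then show ?thesis using False by (intro poly_mapping_eqI) auto
  qed
  have "F = (\<Sum>m\<in>insert 0 (keys F). single m (lookup F m))"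
    by (rule poly_mapping_eq_sum_single) auto
  from arg_cong[OF this, of "\<lambda>F. hcomp n (F * G)"]
  have "hcomp n (F * G) = hcomp n (\<Sum>m\<in>insert 0 (keys F). single m (lookup F m) * G)"
    unfolding sum_distrib_right .
  also have "\<dots> = (\<Sum>m\<in>insert 0 (keys F). if m = 0 then mconst (lookup F m) * G else 0)"
    unfolding hcomp_sum * ..
  also have "\<dots> = mconst (lookup F 0) * G" by simp
  finally show ?thesis .
qed

subsection \<open>Polynomials in three variables\<close>

lemma three_cases: "(i :: 3) = 0 \<or> i = 1 \<or> i = 2"
proof (cases i)
  case (of_int z)
  then have "z = 0 \<or> z = 1 \<or> z = 2" by auto
  then show ?thesis using of_int by auto
qed

lemma UNIV_3: "(UNIV :: 3 set) = {0, 1, 2}"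
  using three_cases by auto

lemma all_3: "(\<forall>i::3. P i) \<longleftrightarrow> P 0 \<and> P 1 \<and> P 2"
  using three_cases by metis

lemma triple_simps [simp]: "triple a b c 0 = a" "triple a b c 1 = b" "triple a b c 2 = c"
  by (simp_all add: triple_def)

definition mon3 :: "nat \<Rightarrow> nat \<Rightarrow> nat \<Rightarrow> (3 \<Rightarrow>\<^sub>0 nat)" where
  "mon3 i j k = single 0 i + single 1 j + single 2 k"

lemma lookup_mon3 [simp]:
  "lookup (mon3 i j k) 0 = i" "lookup (mon3 i j k) 1 = j" "lookup (mon3 i j k) 2 = k"
  by (simp_all add: mon3_def lookup_add lookup_single)

lemma exp3_eq_iff: "m = n \<longleftrightarrow> lookup m 0 = lookup n 0 \<and> lookup m 1 = lookup n 1 \<and> lookup m 2 = lookup n 2"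
  for m n :: "3 \<Rightarrow>\<^sub>0 nat"
  unfolding poly_mapping_eq_iff fun_eq_iff all_3 ..

lemma mon3_eta [simp]: "mon3 (lookup m 0) (lookup m 1) (lookup m 2) = m"
  by (simp add: exp3_eq_iff)

lemma mdeg3: "mdeg m = lookup m 0 + lookup m 1 + lookup m 2" for m :: "3 \<Rightarrow>\<^sub>0 nat"
proof -
  have "mdeg m = (\<Sum>i\<in>{0, 1, 2}. lookup m i)"
    by (rule mdeg_superset) (simp_all flip: UNIV_3)
  then show ?thesis by simp
qed

lemma mon_val3: "mon_val \<sigma> m = \<sigma> 0 ^ lookup m 0 * \<sigma> 1 ^ lookup m 1 * \<sigma> 2 ^ lookup m 2"
  for m :: "3 \<Rightarrow>\<^sub>0 nat"
proof -
  have "mon_val \<sigma> m = (\<Prod>i\<in>{0, 1, 2}. \<sigma> i ^ lookup m i)"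
    by (rule mon_val_superset) (simp_all flip: UNIV_3)
  also have "\<dots> = \<sigma> 0 ^ lookup m 0 * (\<sigma> 1 ^ lookup m 1 * \<sigma> 2 ^ lookup m 2)"
    by (subst prod.insert; simp)
  finally show ?thesis by (simp only: mult.assoc)
qed

lemma mon3_eq_iff [simp]: "mon3 i j k = mon3 i' j' k' \<longleftrightarrow> i = i' \<and> j = j' \<and> k = k'"
  by (simp only: exp3_eq_iff lookup_mon3)

lemma mvar_mon3:
  "mvar 0 = single (mon3 1 0 0) 1" "mvar 1 = single (mon3 0 1 0) 1" "mvar 2 = single (mon3 0 0 1) 1"
  by (simp_all only: mvar_def mon3_def single_zero add_0_left add_0_right)

lemma lin_form_mon3: "lin_form \<alpha> \<beta> \<gamma> =
    single (mon3 1 0 0) \<alpha> + single (mon3 0 1 0) \<beta> + single (mon3 0 0 1) \<gamma>"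
  by (simp only: lin_form_def mvar_mon3 single_eq_mconst_mult[symmetric])

lemma lookup_lin_form:
  "lookup (lin_form \<alpha> \<beta> \<gamma>) (mon3 1 0 0) = \<alpha>"
  "lookup (lin_form \<alpha> \<beta> \<gamma>) (mon3 0 1 0) = \<beta>"
  "lookup (lin_form \<alpha> \<beta> \<gamma>) (mon3 0 0 1) = \<gamma>"
  by (simp_all add: lin_form_mon3 lookup_add lookup_single)

lemma lin_form_eq_0: "lin_form \<alpha> \<beta> \<gamma> = 0 \<longleftrightarrow> \<alpha> = 0 \<and> \<beta> = 0 \<and> \<gamma> = 0"
proof
  assume "lin_form \<alpha> \<beta> \<gamma> = 0"
  then show "\<alpha> = 0 \<and> \<beta> = 0 \<and> \<gamma> = 0" using lookup_lin_form[of \<alpha> \<beta> \<gamma>] by simp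
qed (simp add: lin_form_def)

lemma forms_1_lin_form:
  assumes "L \<in> forms 1"
  obtains \<alpha> \<beta> \<gamma> where "L = lin_form \<alpha> \<beta> \<gamma>"
proof
  let ?L = "lin_form (lookup L (mon3 1 0 0)) (lookup L (mon3 0 1 0)) (lookup L (mon3 0 0 1))"
  show "L = ?L"
  proof (rule poly_mapping_eqI)
    fix m :: "3 \<Rightarrow>\<^sub>0 nat"
    show "lookup L m = lookup ?L m"
    proof (cases "mdeg m = 1")
      case True
      then have "m = mon3 1 0 0 \<or> m = mon3 0 1 0 \<or> m = mon3 0 0 1"
        unfolding mdeg3 exp3_eq_iff lookup_mon3 by arith
      then show ?thesis by (elim disjE) (simp_all only: lookup_lin_form)
    next
      case False
      moreover have "?L \<in> forms 1" by (rule forms_lin_form)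
      ultimately show ?thesis using assms unfolding forms_iff by metis
    qed
  qed
qed

definition mons :: "nat \<Rightarrow> (3 \<Rightarrow>\<^sub>0 nat) set" where
  "mons n = {m. mdeg m = n}"

lemma finite_mons [simp]: "finite (mons n)"
proof (rule finite_subset)
  show "mons n \<subseteq> (\<lambda>(i, j, k). mon3 i j k) ` ({..n} \<times> {..n} \<times> {..n})"
  proof
    fix m assume "m \<in> mons n"
    then show "m \<in> (\<lambda>(i, j, k). mon3 i j k) ` ({..n} \<times> {..n} \<times> {..n})"
      by (intro image_eqI[of _ _ "(lookup m 0, lookup m 1, lookup m 2)"]) (auto simp: mons_def mdeg3)
  qed
qed simp

text \<open>Monomials divisible by x correspond to those of degree n; the other n + 2 involve only y
  and z. From degree d - 1 to d the increment is d + 1, the bound on the number of generators, and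
  \<open>not_surj\<close> rests on this coincidence.\<close>

lemma card_mons_Suc: "card (mons (Suc n)) = card (mons n) + (n + 2)"
proof -
  let ?A = "(\<lambda>m. m + mon3 1 0 0) ` mons n" and ?B = "(\<lambda>j. mon3 0 j (Suc n - j)) ` {..Suc n}"
  have "mons (Suc n) = ?A \<union> ?B"
  proof (intro equalityI subsetI)
    fix m assume m: "m \<in> mons (Suc n)"
    show "m \<in> ?A \<union> ?B"
    proof (cases "lookup m 0")
      case 0
      then have "m = mon3 0 (lookup m 1) (Suc n - lookup m 1)" "lookup m 1 \<le> Suc n"
        using m by (auto simp: exp3_eq_iff mons_def mdeg3)
      then show ?thesis by auto
    next
      case (Suc i)
      then have "m = mon3 i (lookup m 1) (lookup m 2) + mon3 1 0 0" "mon3 i (lookup m 1) (lookup m 2) \<in> mons n"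
        using m by (auto simp: exp3_eq_iff mons_def mdeg3 lookup_add)
      then show ?thesis by blast
    qed
  qed (auto simp: mons_def mdeg3 lookup_add)
  moreover have "?A \<inter> ?B = {}"
    by (auto simp: exp3_eq_iff lookup_add)
  ultimately have "card (mons (Suc n)) = card ?A + card ?B"
    by (simp only:) (rule card_Un_disjoint, simp_all)
  also have "card ?A = card (mons n)" by (intro card_image) (auto simp: inj_on_def)
  also have "card ?B = n + 2"
    by (subst card_image) (auto simp: inj_on_def exp3_eq_iff)
  finally show ?thesis .
qed

section \<open>Linear algebra over K and monomial ideals\<close>

interpretation kvec: vector_space "\<lambda>(c :: 'k::field) (F :: ('i, 'k) mpol). mconst c * F"
  by unfold_locales
    (simp_all only: mconst_add mconst_mult mconst_1 distrib_left distrib_right mult.assoc mult_1_left)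

declare kvec.scale_scale [simp del]

lemma forms_kspan:
  fixes F :: "('i, 'k::field) mpol"
  assumes "keys F \<subseteq> E"
  shows "F \<in> kvec.span ((\<lambda>m. single m 1) ` E)"
proof -
  have "F = (\<Sum>m\<in>keys F. mconst (lookup F m) * single m 1)"
    by (subst single_eq_mconst_mult[symmetric], rule poly_mapping_eq_sum_single) auto
  also have "\<dots> \<in> kvec.span ((\<lambda>m. single m 1) ` E)"
    using assms by (intro kvec.span_sum kvec.span_scale kvec.span_base) auto
  finally show ?thesis .
qed

lemma independent_monomials: "kvec.independent ((\<lambda>m. single m (1 :: 'k::field)) ` E)"
proof
  assume "kvec.dependent ((\<lambda>m. single m (1 :: 'k)) ` E)"
  then obtain m where m: "m \<in> E"
    "single m 1 \<in> kvec.span ((\<lambda>m. single m (1 :: 'k)) ` E - {single m 1})"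
    unfolding kvec.dependent_def by auto
  have "kvec.span ((\<lambda>m. single m (1 :: 'k)) ` E - {single m 1}) \<subseteq> {F. lookup F m = 0}"
  proof (rule kvec.span_minimal)
    show "kvec.subspace {F :: ('a, 'k) mpol. lookup F m = 0}"
      by (rule kvec.subspaceI) (auto simp: lookup_add)
  qed (auto simp: lookup_single when_def)
  with m(2) show False by (auto simp: lookup_single)
qed

lemma monomial_ideal_keys:
  assumes "F \<in> gen_ideal ((\<lambda>m. single m (1 :: 'k::comm_ring_1)) ` E)" "m \<in> keys F"
  shows "\<exists>n\<in>E. \<exists>u. m = u + n"
  using assms
proof (induction arbitrary: m rule: ring_ideal.span_induct_alt)
  case (step G x H)
  then obtain n where n: "n \<in> E" "x = single n 1" by blast
  have "m \<in> keys (G * x) \<or> m \<in> keys H" using step.prems keys_add[of "G * x" H] by blast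
  then show ?case
  proof
    assume "m \<in> keys (G * x)"
    then have "m \<in> {u + v |u v. u \<in> keys G \<and> v \<in> keys x}" using keys_mult[of G x] by blast
    moreover have "keys x \<subseteq> {n}" using n by simp
    ultimately show ?thesis using n(1) by blast
  qed (rule step.IH)
qed simp

lemma monomial_idealI:
  fixes F :: "('i, 'k::comm_ring_1) mpol"
  assumes "\<And>m. m \<in> keys F \<Longrightarrow> \<exists>n\<in>E. \<exists>u. m = u + n"
  shows "F \<in> gen_ideal ((\<lambda>m. single m 1) ` E)"
proof -
  have "F = (\<Sum>m\<in>keys F. single m (lookup F m))"
    by (rule poly_mapping_eq_sum_single) auto
  also have "\<dots> \<in> gen_ideal ((\<lambda>m. single m 1) ` E)"
  proof (rule ring_ideal.span_sum)
    fix m assume "m \<in> keys F"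
    then obtain n u where n: "n \<in> E" "m = u + n" using assms by blast
    then have "single m (lookup F m) = single u (lookup F m) * single n 1"
      by (simp add: mult_single)
    then show "single m (lookup F m) \<in> gen_ideal ((\<lambda>m. single m 1) ` E)"
      using n by (simp add: ring_ideal.span_scale ring_ideal.span_base)
  qed
  finally show ?thesis .
qed

text \<open>All generators have degree n, so a multiple of one of them in that degree has a constant
  cofactor: the degree n part of the ideal is the K-span of the generators.\<close>

lemma monomial_ideal_forms:
  assumes "\<And>m. m \<in> E \<Longrightarrow> mdeg m = n" "F \<in> forms n"
  shows "F \<in> gen_ideal ((\<lambda>m. single m (1 :: 'k::comm_ring_1)) ` E) \<longleftrightarrow> keys F \<subseteq> E"
proof
  assume F: "F \<in> gen_ideal ((\<lambda>m. single m (1 :: 'k)) ` E)"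
  show "keys F \<subseteq> E"
  proof
    fix m assume m: "m \<in> keys F"
    then obtain n' u where n: "n' \<in> E" "m = u + n'" using monomial_ideal_keys[OF F] by blast
    moreover have "mdeg m = n" using m assms by (simp add: forms_def)
    ultimately have "u = 0" using assms(1)[OF n(1)] by simp
    then show "m \<in> E" using n by simp
  qed
next
  assume "keys F \<subseteq> E"
  then show "F \<in> gen_ideal ((\<lambda>m. single m (1 :: 'k)) ` E)"
    by (intro monomial_idealI) (metis add_0 subsetD)
qed

lemma gen_ideal_is_ideal [simp]: "is_ideal (gen_ideal S)"
  by simp

subsection \<open>Residue classes\<close>

lemma residue_eq_iff:
  assumes "is_ideal I"
  shows "residue I F = residue I G \<longleftrightarrow> F - G \<in> I"
proof
  assume "residue I F = residue I G"
  moreover have "F \<in> residue I F"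
    using ring_ideal.subspace_0[OF assms] by (force simp: residue_def)
  ultimately show "F - G \<in> I" by (auto simp: residue_def)
next
  assume FG: "F - G \<in> I"
  show "residue I F = residue I G"
  proof (intro equalityI subsetI)
    fix x assume "x \<in> residue I F"
    then obtain y where "y \<in> I" "x = F + y" by (auto simp: residue_def)
    then have "x = G + (F - G + y)" "F - G + y \<in> I"
      using FG assms by (simp_all add: ring_ideal.subspace_add)
    then show "x \<in> residue I G" unfolding residue_def by blast
  next
    fix x assume "x \<in> residue I G"
    then obtain y where "y \<in> I" "x = G + y" by (auto simp: residue_def)
    then have "x = F + (y - (F - G))" "y - (F - G) \<in> I"
      using FG assms by (simp_all add: ring_ideal.subspace_diff)
    then show "x \<in> residue I F" unfolding residue_def by blast
  qed
qed

lemma mult_quot_residue: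
  assumes "is_ideal I"
  shows "mult_quot I L (residue I F) = residue I (L * F)"
proof -
  have "residue I (L * G) = residue I (L * F)" if "G \<in> residue I F" for G
  proof -
    from that obtain y where "y \<in> I" "G = F + y" by (auto simp: residue_def)
    then show ?thesis
      using assms by (simp add: residue_eq_iff ring_ideal.subspace_scale algebra_simps)
  qed
  then have "mult_quot I L (residue I F) = (\<Union>G\<in>residue I F. residue I (L * F))"
    unfolding mult_quot_def by (rule SUP_cong[OF refl])
  moreover have "F \<in> residue I F"
    using ring_ideal.subspace_0[OF assms] by (force simp: residue_def)
  ultimately show ?thesis by blast
qed

subsection \<open>Invariant monomials\<close>

lemma is_ideal_GT: "is_ideal (GT_ideal d e a)"
  by (simp add: GT_ideal_def)

locale gt_setup =
  fixes e :: "'k::{alg_closed_field, field_char_0}" and d a :: nat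
  assumes a_ge: "2 \<le> a" and a_less: "a < d" and prim: "primitive_root_of_one d e"
begin

lemma d_pos: "0 < d" using a_less by simp

lemma e_nonzero [simp]: "e \<noteq> 0"
  using prim d_pos by (auto simp: primitive_root_of_one_def power_0_left)

lemma e_power_eq_1: "e ^ n = 1 \<longleftrightarrow> d dvd n"
proof -
  have "e ^ n = (e ^ d) ^ (n div d) * e ^ (n mod d)"
    by (simp flip: power_mult power_add)
  then have "e ^ n = e ^ (n mod d)" using prim by (simp add: primitive_root_of_one_def)
  moreover have "e ^ (n mod d) = 1 \<longleftrightarrow> n mod d = 0"
    using prim d_pos mod_less_divisor[of d n] by (auto simp: primitive_root_of_one_def)
  ultimately show ?thesis by (simp add: dvd_eq_mod_eq_0)
qed

lemma e_power_eq_iff: "e ^ m = e ^ n \<longleftrightarrow> m mod d = n mod d"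
proof -
  have *: "e ^ m = e ^ n \<longleftrightarrow> m mod d = n mod d" if "m \<le> n" for m n
  proof -
    have "e ^ n = e ^ m * e ^ (n - m)" using that by (simp flip: power_add)
    then have "e ^ m = e ^ n \<longleftrightarrow> e ^ (n - m) = 1" by simp
    also have "\<dots> \<longleftrightarrow> m mod d = n mod d"
      unfolding e_power_eq_1 mod_eq_dvd_iff_nat[OF that, symmetric] by (rule eq_commute)
    finally show ?thesis .
  qed
  show ?thesis using *[of m n] *[of n m] by (cases m n rule: le_cases) auto
qed

definition u :: "3 \<Rightarrow> 'k" where
  "u = triple 1 e (e ^ a)"

definition inv_mons :: "(3 \<Rightarrow>\<^sub>0 nat) set" where
  "inv_mons = {m. mdeg m = d \<and> d dvd lookup m 1 + a * lookup m 2}"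

lemma mon_val_u: "mon_val u m = e ^ (lookup m 1 + a * lookup m 2)"
  by (simp add: mon_val3 u_def power_add power_mult)

lemma inv_mons_iff: "m \<in> inv_mons \<longleftrightarrow> mdeg m = d \<and> mon_val u m = 1"
  by (simp add: inv_mons_def mon_val_u e_power_eq_1)

lemma inv_mons_mdeg: "m \<in> inv_mons \<Longrightarrow> mdeg m = d"
  by (simp add: inv_mons_def)

lemma inv_forms_iff: "F \<in> forms d \<and> diag_act u F = F \<longleftrightarrow> keys F \<subseteq> inv_mons"
proof -
  have "diag_act u F = F \<longleftrightarrow> (\<forall>m\<in>keys F. mon_val u m = 1)"
    by (auto simp: poly_mapping_eq_iff fun_eq_iff in_keys_iff)
  then show ?thesis by (auto simp: forms_def inv_mons_iff)
qed

definition I :: "(3, 'k) mpol set" where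
  "I = GT_ideal d e a"

lemma ideal_I [simp]: "is_ideal I"
  unfolding I_def by (rule is_ideal_GT)

lemma I_monomial: "I = gen_ideal ((\<lambda>m. single m 1) ` inv_mons)"
proof -
  have I: "I = gen_ideal {F. keys F \<subseteq> inv_mons}"
    unfolding I_def GT_ideal_def u_def[symmetric] using inv_forms_iff by metis
  have "{F. keys F \<subseteq> inv_mons} \<subseteq> gen_ideal ((\<lambda>m. single m (1 :: 'k)) ` inv_mons)"
    by (auto intro!: monomial_idealI) (metis add_0 subsetD)
  then have "I \<subseteq> gen_ideal ((\<lambda>m. single m 1) ` inv_mons)"
    unfolding I by (rule ring_ideal.span_minimal) simp
  moreover have "gen_ideal ((\<lambda>m. single m 1) ` inv_mons) \<subseteq> I"
    unfolding I by (rule ring_ideal.span_mono) auto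
  ultimately show ?thesis by blast
qed

lemma I_forms_iff: "F \<in> forms d \<Longrightarrow> F \<in> I \<longleftrightarrow> keys F \<subseteq> inv_mons"
  unfolding I_monomial by (rule monomial_ideal_forms) (rule inv_mons_mdeg)

lemma mdeg_keys_I: "F \<in> I \<Longrightarrow> m \<in> keys F \<Longrightarrow> d \<le> mdeg m"
  unfolding I_monomial by (drule (1) monomial_ideal_keys) (auto simp: inv_mons_mdeg)

lemma forms_less_I: "F \<in> forms n \<Longrightarrow> n < d \<Longrightarrow> F \<in> I \<Longrightarrow> F = 0"
  by (rule ccontr) (use mdeg_keys_I in \<open>fastforce simp: forms_def\<close>)

lemma power_mons: "mon3 d 0 0 \<in> inv_mons" "mon3 0 d 0 \<in> inv_mons" "mon3 0 0 d \<in> inv_mons"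
  by (simp_all add: inv_mons_def mdeg3)

lemma finite_inv_mons [simp]: "finite inv_mons"
  by (rule finite_subset[OF _ finite_mons[of d]]) (auto simp: inv_mons_def mons_def)

text \<open>
  Every value of the exponent of \<open>z\<close> occurs at most once among the invariant monomials, except for
  \<open>0\<close>, which occurs in \<open>x\<^sup>d\<close> and \<open>y\<^sup>d\<close>; this is made up for by \<open>d - 1\<close>, which does not occur.
\<close>

lemma card_inv_mons: "card inv_mons \<le> d + 1"
proof -
  define f where "f m = (if lookup m (1 :: 3) = d then d - 1 else lookup m (2 :: 3))" for m
  have deg: "lookup m 0 + lookup m 1 + lookup m 2 = d" and dv: "d dvd lookup m 1 + a * lookup m 2"
    if "m \<in> inv_mons" for m
    using that by (auto simp: inv_mons_def mdeg3)
  \<comment> \<open>For the exponent d - 1 of z, invariance requires the exponent of y to be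
    congruent to a modulo d, whereas it is at most 1 and 2 <= a < d.\<close>
  have z: "lookup m 2 \<noteq> d - 1" if "m \<in> inv_mons" for m
  proof
    assume z: "lookup m 2 = d - 1"
    have y: "lookup m 1 \<le> 1" using deg[OF that] z d_pos by simp
    have "a * (d - 1) + d = a * d + (d - a)" using a_less by (cases d) auto
    then have "lookup m 1 + a * lookup m 2 + d = lookup m 1 + (d - a) + a * d" using z by simp
    then have "d dvd lookup m 1 + (d - a) + a * d"
      using dv[OF that] by (metis dvd_add dvd_refl)
    then have "d dvd lookup m 1 + (d - a)" by (simp add: dvd_add_left_iff)
    then have "d \<le> lookup m 1 + (d - a)" using a_less by (intro dvd_imp_le) auto
    then show False using y a_ge a_less by simp
  qed
  have "inj_on f inv_mons"
  proof (rule inj_onI)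
    fix m n assume mn: "m \<in> inv_mons" "n \<in> inv_mons" and f: "f m = f n"
    have z2: "lookup m 2 = lookup n 2" and cases: "lookup m 1 = d \<longleftrightarrow> lookup n 1 = d"
      using f z[OF mn(1)] z[OF mn(2)] deg[OF mn(1)] deg[OF mn(2)]
      by (auto simp: f_def split: if_splits)
    have eq: "y = y'" if "y \<le> y'" "y' < d" "d dvd y + c" "d dvd y' + c" for y y' c
    proof -
      have "d dvd y' - y" using dvd_diff_nat[OF that(4,3)] by simp
      then show ?thesis using that dvd_imp_le[of d "y' - y"] by (cases "y' - y = 0") auto
    qed
    have le: "lookup m 1 \<le> d" "lookup n 1 \<le> d" using deg[OF mn(1)] deg[OF mn(2)] by auto
    have "lookup m 1 = lookup n 1"
    proof (cases "lookup m 1 = d")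
      case False
      then show ?thesis
        using le cases dv[OF mn(1)] dv[OF mn(2)] z2
          eq[of "lookup m 1" "lookup n 1"] eq[of "lookup n 1" "lookup m 1"]
        by (metis le_neq_implies_less nat_le_linear)
    qed (use cases in simp)
    then show "m = n" using z2 deg[OF mn(1)] deg[OF mn(2)] by (simp add: exp3_eq_iff)
  qed
  moreover have "f ` inv_mons \<subseteq> {..d}"
    using deg by (fastforce simp: f_def)
  ultimately show ?thesis using card_inj_on_le[of f inv_mons "{..d}"] by simp
qed

definition norm_form :: "'k \<Rightarrow> 'k \<Rightarrow> 'k \<Rightarrow> (3, 'k) mpol" where
  "norm_form \<alpha> \<beta> \<gamma> = (\<Prod>j<d. lin_form \<alpha> (\<beta> * e ^ j) (\<gamma> * e ^ (a * j)))"

lemma norm_form_alt: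
  "lin_form \<alpha> \<beta> \<gamma> * (\<Prod>j = 1..d - 1. lin_form \<alpha> (\<beta> * e ^ j) (\<gamma> * e ^ (a * j))) = norm_form \<alpha> \<beta> \<gamma>"
proof -
  have "{..<d} = insert 0 {1..d - 1}" using d_pos by auto
  then show ?thesis by (simp add: norm_form_def)
qed

lemma diag_act_lin_form: "diag_act u (lin_form \<alpha> \<beta> \<gamma>) = lin_form \<alpha> (\<beta> * e) (\<gamma> * e ^ a)"
proof -
  have "diag_act u (lin_form \<alpha> \<beta> \<gamma>) = mconst \<alpha> * (mconst 1 * mvar 0)
      + mconst \<beta> * (mconst e * mvar 1) + mconst \<gamma> * (mconst (e ^ a) * mvar 2)"
    by (simp only: diag_act_def act.msubst_lin_form u_def triple_simps)
  then show ?thesis by (simp only: lin_form_def mconst_mult mconst_1 mult.assoc mult_1_left)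
qed

text \<open>The action sends the factor with index j to the one with index j + 1, and index d gives
  factor 0 again because e^d = 1.\<close>

lemma norm_form_in_I: "norm_form \<alpha> \<beta> \<gamma> \<in> I"
proof -
  let ?L = "\<lambda>j. lin_form \<alpha> (\<beta> * e ^ j) (\<gamma> * e ^ (a * j))"
  have "norm_form \<alpha> \<beta> \<gamma> \<in> forms (\<Sum>j<d. 1)"
    unfolding norm_form_def by (intro forms_prod forms_lin_form)
  then have deg: "norm_form \<alpha> \<beta> \<gamma> \<in> forms d" by simp
  have "?L d = ?L 0"
    using e_power_eq_1[of d] e_power_eq_1[of "a * d"] by simp
  have "diag_act u (norm_form \<alpha> \<beta> \<gamma>) = (\<Prod>j<d. diag_act u (?L j))"
    unfolding norm_form_def diag_act_def by (rule act.msubst_prod)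
  also have "\<dots> = (\<Prod>j<d. ?L (Suc j))"
    by (simp only: diag_act_lin_form power_Suc mult_Suc_right power_add mult_ac)
  also have "\<dots> = norm_form \<alpha> \<beta> \<gamma>"
  proof -
    have "(\<Prod>j<n. f (Suc j)) = (\<Prod>j<n. f j)" if "f n = f 0" for f :: "nat \<Rightarrow> (3, 'k) mpol" and n
    proof (cases n)
      case (Suc k)
      have "(\<Prod>j<n. f (Suc j)) = (\<Prod>j<k. f (Suc j)) * f n" by (simp add: Suc)
      also have "\<dots> = (\<Prod>j<n. f j)"
        by (simp only: that[unfolded Suc] Suc prod.lessThan_Suc_shift mult.commute)
      finally show ?thesis .
    qed simp
    from this[of ?L, OF \<open>?L d = ?L 0\<close>] show ?thesis unfolding norm_form_def .
  qed
  finally have "norm_form \<alpha> \<beta> \<gamma> \<in> {F \<in> forms d. diag_act u F = F}" using deg by simp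
  then show ?thesis unfolding I_def GT_ideal_def u_def by (rule ring_ideal.span_base)
qed

end

subsection \<open>The Togliatti property\<close>

lemma card_Union_image_le:
  assumes "finite A" "finite B"
  shows "card (f ` A \<union> g ` B) \<le> card A + card B"
  by (meson add_mono assms card_Un_le card_image_le le_trans)

lemma single_1_inject: "single m (1 :: 'k::zero_neq_one) = single n 1 \<longleftrightarrow> m = n"
  by (metis keys_single one_neq_zero singleton_inject)

context gt_setup begin

text \<open>
  If \<open>\<times>L\<close> were surjective onto the graded piece of degree \<open>d\<close>, then the products of \<open>L\<close> with the monomials of
  degree \<open>d - 1\<close>, together with the invariant monomials, would span the forms of degree \<open>d\<close>. A
  relation \<open>L Q \<in> I\<close> with \<open>Q \<noteq> 0\<close> makes one of these products redundant, and the remaining ones are too few.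
\<close>

lemma not_surj:
  assumes L: "L \<in> forms 1" and Q: "Q \<in> forms (d - 1)" "Q \<noteq> 0" "L * Q \<in> I"
  shows "\<exists>F\<in>forms d. \<forall>G\<in>forms (d - 1). F - L * G \<notin> I"
proof (rule ccontr)
  assume "\<not> ?thesis"
  then have surj: "\<exists>G\<in>forms (d - 1). F - L * G \<in> I" if "F \<in> forms d" for F
    using that by blast
  have LG: "L * G \<in> forms d" if "G \<in> forms (d - 1)" for G
    using forms_mult[OF L that] d_pos by simp
  from Q(2) obtain m0 where m0: "m0 \<in> keys Q" by (metis ex_in_conv keys_eq_empty)
  let ?f = "\<lambda>m. L * single m (1 :: 'k)" and ?g = "\<lambda>m. single m (1 :: 'k)"
  \<comment> \<open>As m0 occurs in Q, the relation L * Q in I expresses the product of L with m0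
    through the other products and the invariant monomials; it can be left out.\<close>
  define B where "B = ?f ` (mons (d - 1) - {m0}) \<union> ?g ` inv_mons"
  have inv: "F \<in> kvec.span B" if "F \<in> I" "F \<in> forms d" for F
    using forms_kspan[of F inv_mons] I_forms_iff[of F] that
      kvec.span_mono[of "?g ` inv_mons" B] by (auto simp: B_def)
  have L_single: "?f m \<in> kvec.span B" if m: "m \<in> mons (d - 1)" for m
  proof (cases "m = m0")
    case False
    then show ?thesis using m by (intro kvec.span_base) (auto simp: B_def)
  next
    case True
    have "L * Q = L * (\<Sum>m\<in>keys Q. single m (lookup Q m))"
      by (rule arg_cong[OF poly_mapping_eq_sum_single]) auto
    also have "\<dots> = (\<Sum>m\<in>keys Q. mconst (lookup Q m) * ?f m)"
      by (subst single_eq_mconst_mult) (simp only: sum_distrib_left mult.left_commute)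
    also have "\<dots> = mconst (lookup Q m0) * ?f m0 + (\<Sum>m\<in>keys Q - {m0}. mconst (lookup Q m) * ?f m)"
      by (rule sum.remove) (use m0 in auto)
    finally have "mconst (lookup Q m0) * ?f m0 =
        L * Q - (\<Sum>m\<in>keys Q - {m0}. mconst (lookup Q m) * ?f m)" by (simp only: eq_diff_eq)
    also have "\<dots> \<in> kvec.span B"
    proof (rule kvec.span_diff)
      show "L * Q \<in> kvec.span B" using Q LG inv by blast
      show "(\<Sum>m\<in>keys Q - {m0}. mconst (lookup Q m) * ?f m) \<in> kvec.span B"
        using Q(1) by (intro kvec.span_sum kvec.span_scale kvec.span_base) (auto simp: B_def mons_def forms_def)
    qed
    finally have "mconst (inverse (lookup Q m0)) * (mconst (lookup Q m0) * ?f m0) \<in> kvec.span B"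
      by (rule kvec.span_scale)
    then show ?thesis
      using m0 True by (simp add: in_keys_iff flip: mult.assoc mconst_mult)
  qed
  have "?g ` mons d \<subseteq> kvec.span B"
  proof
    fix F assume "F \<in> ?g ` mons d"
    then have F: "F \<in> forms d" by (auto simp: mons_def)
    then obtain G where G: "G \<in> forms (d - 1)" "F - L * G \<in> I" using surj by blast
    have "F - L * G \<in> forms d"
      using forms_add[OF F forms_const_mult[OF LG[OF G(1)], of "- 1"]] by (simp add: mconst_uminus)
    then have 1: "F - L * G \<in> kvec.span B" using inv G by blast
    have "L * G = L * (\<Sum>m\<in>keys G. single m (lookup G m))"
      by (rule arg_cong[OF poly_mapping_eq_sum_single]) auto
    also have "\<dots> = (\<Sum>m\<in>keys G. mconst (lookup G m) * ?f m)"
      by (subst single_eq_mconst_mult) (simp only: sum_distrib_left mult.left_commute)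
    also have "\<dots> \<in> kvec.span B"
      using G(1) by (intro kvec.span_sum kvec.span_scale L_single) (auto simp: mons_def forms_def)
    finally have "F - L * G + L * G \<in> kvec.span B" using 1 by (rule kvec.span_add[rotated])
    then show "F \<in> kvec.span B" by simp
  qed
  moreover have "finite B" by (simp add: B_def)
  ultimately have "card (?g ` mons d) \<le> card B"
    using kvec.independent_span_bound[OF _ independent_monomials] by blast
  moreover have "card (?g ` mons d) = card (mons d)"
    by (rule card_image) (simp add: inj_on_def single_1_inject)
  moreover have "card B \<le> card (mons (d - 1) - {m0}) + card inv_mons"
    unfolding B_def by (rule card_Union_image_le) auto
  moreover have "m0 \<in> mons (d - 1)" using m0 Q(1) by (auto simp: mons_def forms_def)
  then have "card (mons (d - 1) - {m0}) < card (mons (d - 1))" by (intro card_Diff1_less) auto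
  \<comment> \<open>The contradiction: B has at most (dim R_(d-1) - 1) + (d + 1) elements, one less
    than dim R_d.\<close>
  moreover have "card (mons d) = card (mons (d - 1)) + (d + 1)"
    using card_mons_Suc[of "d - 1"] d_pos by simp
  ultimately show False using card_inv_mons by linarith
qed

lemma not_max_rank:
  assumes L: "L \<in> forms 1"
  shows "\<not> max_rank I L (d - 1)"
proof -
  obtain \<alpha> \<beta> \<gamma> where L_eq: "L = lin_form \<alpha> \<beta> \<gamma>" using forms_1_lin_form[OF L] .
  have "\<exists>Q\<in>forms (d - 1). Q \<noteq> 0 \<and> L * Q \<in> I"
  proof (cases "L = 0")
    case True
    \<comment> \<open>For L = 0 the product of the conjugates may vanish, but every form of degree d
      - 1 is annihilated; x^(d-1) is a nonzero one.\<close>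
    have "single (mon3 (d - 1) 0 0) (1 :: 'k) \<in> forms (d - 1)" by (simp add: mdeg3)
    moreover have "single (mon3 (d - 1) 0 0) (1 :: 'k) \<noteq> 0" by (metis keys_single keys_zero insert_not_empty one_neq_zero)
    moreover have "0 \<in> I" using ideal_I by (rule ring_ideal.subspace_0)
    ultimately show ?thesis unfolding True mult_zero_left by blast
  next
    case False
    let ?Q = "\<Prod>j = 1..d - 1. lin_form \<alpha> (\<beta> * e ^ j) (\<gamma> * e ^ (a * j))"
    have "?Q \<in> forms (\<Sum>j = 1..d - 1. 1)" by (intro forms_prod forms_lin_form)
    also have "(\<Sum>j = 1..d - 1. 1) = d - 1" by simp
    finally have "?Q \<in> forms (d - 1)" .
    moreover have "?Q \<noteq> 0"
      using False by (simp add: prod_zero_iff lin_form_eq_0 L_eq)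
    moreover have "L * ?Q \<in> I" unfolding L_eq norm_form_alt by (rule norm_form_in_I)
    ultimately show ?thesis by blast
  qed
  then obtain Q where Q: "Q \<in> forms (d - 1)" "Q \<noteq> 0" "L * Q \<in> I" by blast
  have "\<not> inj_on (mult_quot I L) (graded_quot I (d - 1))"
  proof
    assume inj: "inj_on (mult_quot I L) (graded_quot I (d - 1))"
    have "mult_quot I L (residue I Q) = mult_quot I L (residue I 0)"
      using Q by (simp add: mult_quot_residue residue_eq_iff)
    then have "residue I Q = residue I 0"
      by (rule inj_onD[OF inj]) (use Q in \<open>auto simp: graded_quot_def\<close>)
    then have "Q \<in> I" by (simp add: residue_eq_iff)
    then show False using forms_less_I[OF Q(1)] Q(2) d_pos by simp
  qed
  moreover have "mult_quot I L ` graded_quot I (d - 1) \<noteq> graded_quot I (Suc (d - 1))"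
  proof
    assume eq: "mult_quot I L ` graded_quot I (d - 1) = graded_quot I (Suc (d - 1))"
    obtain F where F: "F \<in> forms d" "\<And>G. G \<in> forms (d - 1) \<Longrightarrow> F - L * G \<notin> I"
      using not_surj[OF L Q] by blast
    have "residue I F \<in> mult_quot I L ` graded_quot I (d - 1)"
      unfolding eq using F(1) d_pos by (simp add: graded_quot_def)
    then obtain G where "G \<in> forms (d - 1)" "residue I F = residue I (L * G)"
      by (auto simp: graded_quot_def mult_quot_residue)
    then show False using F(2) by (simp add: residue_eq_iff)
  qed
  ultimately show ?thesis by (simp add: max_rank_def)
qed

end

section \<open>Invariant multiples of x + y + z\<close>

interpretation pconst: coeff_hom "\<lambda>c :: 'k::comm_ring_1. [:c:]"
  by unfold_locales simp_all

context gt_setup begin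

text \<open>The Sylvester determinant at the variables, that is, the product of the conjugates of x
  + y + z. It is given by its expansion so that coefficients can be read off.\<close>

definition det_form :: "(3, 'k) mpol" where
  "det_form = (\<Sum>(j, k)\<in>inv_pairs d a. single (mon3 (d - j - k) j k) (of_int (norm_coeff d a j k)))"

lemma lookup_det_form:
  "lookup det_form m = (if m \<in> inv_mons then of_int (norm_coeff d a (lookup m 1) (lookup m 2)) else 0)"
proof -
  have "lookup det_form m = (\<Sum>w\<in>inv_pairs d a.
      if w = (lookup m 1, lookup m 2) then
        (if mdeg m = d then of_int (norm_coeff d a (lookup m 1) (lookup m 2)) else 0) else 0)"
    unfolding det_form_def lookup_sum
  proof (rule sum.cong[OF refl], clarify)
    fix j k assume "(j, k) \<in> inv_pairs d a"
    then have "j + k \<le> d" by (simp add: inv_pairs_def)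
    then show "lookup (single (mon3 (d - j - k) j k) (of_int (norm_coeff d a j k))) m =
      (if (j, k) = (lookup m 1, lookup m 2) then
        (if mdeg m = d then of_int (norm_coeff d a (lookup m 1) (lookup m 2)) else 0) else (0 :: 'k))"
      by (auto simp: lookup_single when_def exp3_eq_iff mdeg3)
  qed
  also have "\<dots> = (if (lookup m 1, lookup m 2) \<in> inv_pairs d a then
        (if mdeg m = d then of_int (norm_coeff d a (lookup m 1) (lookup m 2)) else 0) else 0)"
    by (rule sum.delta) simp
  also have "\<dots> = (if m \<in> inv_mons then of_int (norm_coeff d a (lookup m 1) (lookup m 2)) else 0)"
    by (auto simp: inv_pairs_def inv_mons_def mdeg3)
  finally show ?thesis .
qed

lemma det_form_vanishes:
  fixes \<sigma> :: "3 \<Rightarrow> 'k poly"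
  assumes "\<sigma> 0 + \<sigma> 1 + \<sigma> 2 = 0"
  shows "msubst (\<lambda>c. [:c:]) \<sigma> det_form = 0"
proof -
  have "msubst (\<lambda>c. [:c:]) \<sigma> det_form = (\<Sum>(j, k)\<in>inv_pairs d a.
      of_int (norm_coeff d a j k) * (\<sigma> 0 ^ (d - j - k) * \<sigma> 1 ^ j * \<sigma> 2 ^ k))"
    unfolding det_form_def pconst.msubst_sum
    by (rule sum.cong) (auto simp: mon_val3 of_int_poly)
  also have "\<dots> = det (sylv d a (\<sigma> 0) (\<sigma> 1) (\<sigma> 2))"
    by (rule det_sylv[symmetric]) (use a_ge d_pos in auto)
  also have "\<dots> = 0" by (rule det_sylv_zero) (use a_ge d_pos assms in auto)
  finally show ?thesis .
qed

text \<open>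
  Dehomogenise by \<open>y = 1\<close> and regard an invariant form as a polynomial in \<open>x\<close> over \<open>K[z]\<close>. If it
  vanishes on \<open>x + y + z = 0\<close>, then by invariance it has the \<open>d\<close> distinct roots \<open>-(e\<^sup>n + e\<^sup>a\<^sup>n z)\<close>.
\<close>

lemma inv_form_eq_0:
  assumes D: "keys D \<subseteq> inv_mons" and top: "lookup D (mon3 d 0 0) = 0"
    and van: "\<And>\<sigma> :: 3 \<Rightarrow> 'k poly. \<sigma> 0 + \<sigma> 1 + \<sigma> 2 = 0 \<Longrightarrow> msubst (\<lambda>c. [:c:]) \<sigma> D = 0"
  shows "D = 0"
proof -
  define Z :: "'k poly" where "Z = [:0, 1:]"
  define r where "r n = - ([:e ^ n:] + [:e ^ (a * n):] * Z)" for n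
  have deg: "lookup m 0 + lookup m 1 + lookup m 2 = d" if "m \<in> keys D" for m
    using that D by (auto simp: inv_mons_def mdeg3)
  define p :: "'k poly poly" where
    "p = (\<Sum>m\<in>keys D. monom (monom (lookup D m) (lookup m 2)) (lookup m 0))"
  have root: "poly p (r n) = 0" for n
  proof -
    have "poly p (r n) = (\<Sum>m\<in>keys D. [:lookup D m:] * (Z ^ lookup m 2 * r n ^ lookup m 0))"
      unfolding p_def poly_sum by (simp add: poly_monom monom_altdef Z_def)
    \<comment> \<open>Acting by the n-th power of the matrix turns (r n, 1, Z) into (r n, e^n, e^(a
      n) Z). This does not change the value of an invariant form, and the new point lies on x + y +
      z = 0.\<close>
    also have "\<dots> = (\<Sum>m\<in>keys D. [:lookup D m:] *
        mon_val (triple (r n) [:e ^ n:] ([:e ^ (a * n):] * Z)) m)"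
    proof (rule sum.cong[OF refl])
      fix m assume "m \<in> keys D"
      then have "d dvd lookup m 1 + a * lookup m 2" using D by (auto simp: inv_mons_def)
      then have "e ^ (n * (lookup m 1 + a * lookup m 2)) = 1" by (simp add: e_power_eq_1)
      moreover have "[:e ^ n:] ^ lookup m 1 * [:e ^ (a * n):] ^ lookup m 2 =
          [:e ^ (n * (lookup m 1 + a * lookup m 2)):]"
        by (simp add: poly_const_pow power_add algebra_simps flip: power_mult)
      ultimately have "[:e ^ n:] ^ lookup m 1 * [:e ^ (a * n):] ^ lookup m 2 = 1" by (simp add: one_pCons)
      moreover have "mon_val (triple (r n) [:e ^ n:] ([:e ^ (a * n):] * Z)) m =
          ([:e ^ n:] ^ lookup m 1 * [:e ^ (a * n):] ^ lookup m 2) * (Z ^ lookup m 2 * r n ^ lookup m 0)"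
        by (simp only: mon_val3 triple_simps power_mult_distrib mult_ac)
      ultimately show "[:lookup D m:] * (Z ^ lookup m 2 * r n ^ lookup m 0) =
          [:lookup D m:] * mon_val (triple (r n) [:e ^ n:] ([:e ^ (a * n):] * Z)) m"
        by (simp only: mult_1_left)
    qed
    also have "\<dots> = msubst (\<lambda>c. [:c:]) (triple (r n) [:e ^ n:] ([:e ^ (a * n):] * Z)) D"
      by (rule pconst.msubst_superset[symmetric]) auto
    also have "\<dots> = 0"
    proof (rule van)
      show "triple (r n) [:e ^ n:] ([:e ^ (a * n):] * Z) 0 + triple (r n) [:e ^ n:] ([:e ^ (a * n):] * Z) 1
        + triple (r n) [:e ^ n:] ([:e ^ (a * n):] * Z) 2 = 0"
        unfolding triple_simps r_def by simp
    qed
    finally show ?thesis .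
  qed
  have "p = 0"
  proof (rule ccontr)
    assume p: "p \<noteq> 0"
    have inj: "inj_on r {..<d}"
    proof (rule inj_onI)
      fix m n assume "m \<in> {..<d}" "n \<in> {..<d}" "r m = r n"
      moreover from \<open>r m = r n\<close> have "coeff (r m) 0 = coeff (r n) 0" by simp
      ultimately show "m = n" by (simp add: r_def Z_def e_power_eq_iff)
    qed
    \<comment> \<open>By \<open>top\<close> there is no term x^d, so the degree in x is too small
      for d distinct roots.\<close>
    have "degree p < d"
      unfolding p_def
    proof (rule degree_sum_less[OF _ d_pos])
      fix m assume m: "m \<in> keys D"
      have "lookup m 0 \<noteq> d"
      proof
        assume "lookup m 0 = d"
        then have "m = mon3 d 0 0" using deg[OF m] by (simp add: exp3_eq_iff)
        then show False using m top by (simp add: in_keys_iff)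
      qed
      then have "lookup m 0 < d" using deg[OF m] by simp
      then show "degree (monom (monom (lookup D m) (lookup m 2)) (lookup m 0)) < d"
        using degree_monom_le le_less_trans by blast
    qed
    moreover have "card (r ` {..<d}) \<le> card {x. poly p x = 0}"
      using root poly_roots_finite[OF p] by (intro card_mono) auto
    moreover have "card {x. poly p x = 0} \<le> degree p" by (rule card_poly_roots_bound[OF p])
    ultimately show False using inj by (simp add: card_image)
  qed
  show "D = 0"
  proof (rule ccontr)
    assume "D \<noteq> 0"
    then obtain m where m: "m \<in> keys D" by (metis ex_in_conv keys_eq_empty)
    \<comment> \<open>In degree d the exponents of x and z determine the monomial, so no
      coefficients merge when y is set to 1.\<close>
    have "coeff (coeff p (lookup m 0)) (lookup m 2) =
        (\<Sum>n\<in>keys D. if n = m then lookup D n else 0)"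
      unfolding p_def coeff_sum
    proof (rule sum.cong[OF refl])
      fix n assume n: "n \<in> keys D"
      show "coeff (coeff (monom (monom (lookup D n) (lookup n 2)) (lookup n 0)) (lookup m 0)) (lookup m 2) =
          (if n = m then lookup D n else 0)"
        using deg[OF m] deg[OF n] by (auto simp: coeff_monom exp3_eq_iff)
    qed
    also have "\<dots> = lookup D m" using m by simp
    finally show False using m \<open>p = 0\<close> by (simp add: in_keys_iff)
  qed
qed

text \<open>Let c be the coefficient of x^d in the product. The product minus c times
  \<open>det_form\<close> is invariant, vanishes on x + y + z = 0 and has no term x^d, so it is
  zero. Since every invariant monomial occurs in \<open>det_form\<close>, a single missing one
  forces c = 0.\<close>

lemma mult_sum_vars_eq_0:
  fixes G :: "(3, 'k) mpol"
  assumes G: "keys (lin_form 1 1 1 * G) \<subseteq> inv_mons" and m: "m \<in> inv_mons" "lookup (lin_form 1 1 1 * G) m = 0"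
  shows "G = 0"
proof -
  let ?H = "lin_form 1 1 1 * G"
  define c where "c = lookup ?H (mon3 d 0 0)"
  have "?H - mconst c * det_form = 0"
  proof (rule inv_form_eq_0)
    show "keys (?H - mconst c * det_form) \<subseteq> inv_mons"
      using G by (auto simp: in_keys_iff lookup_minus lookup_det_form split: if_splits)
    show "lookup (?H - mconst c * det_form) (mon3 d 0 0) = 0"
      using power_mons norm_coeff_0_0[OF a_ge a_less]
      by (simp add: lookup_minus lookup_det_form c_def)
    fix \<sigma> :: "3 \<Rightarrow> 'k poly" assume s: "\<sigma> 0 + \<sigma> 1 + \<sigma> 2 = 0"
    have "msubst (\<lambda>c. [:c:]) \<sigma> ?H = 0"
      unfolding pconst.msubst_mult pconst.msubst_lin_form using s by (simp flip: one_pCons)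
    moreover have "msubst (\<lambda>c. [:c:]) \<sigma> (mconst (- c) * det_form) = 0"
      unfolding pconst.msubst_mult det_form_vanishes[OF s] by simp
    moreover have "?H - mconst c * det_form = ?H + mconst (- c) * det_form"
      by (simp add: mconst_uminus)
    ultimately show "msubst (\<lambda>c. [:c:]) \<sigma> (?H - mconst c * det_form) = 0"
      by (simp only: pconst.msubst_add add_0_left)
  qed
  then have H: "?H = mconst c * det_form" by simp
  have "(lookup m 1, lookup m 2) \<in> inv_pairs d a" using m(1) by (auto simp: inv_mons_def inv_pairs_def mdeg3)
  then have "norm_coeff d a (lookup m 1) (lookup m 2) \<noteq> 0" by (rule norm_coeff_neq_0[OF a_ge a_less])
  moreover have "c * of_int (norm_coeff d a (lookup m 1) (lookup m 2)) = 0"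
    using m unfolding H lookup_mconst_mult lookup_det_form by simp
  ultimately have "?H = 0" unfolding H by simp
  moreover have "lin_form 1 1 1 \<noteq> (0 :: (3, 'k) mpol)" by (simp add: lin_form_eq_0)
  ultimately show ?thesis by simp
qed

end

subsection \<open>Artinian ideals and minimality\<close>

lemma kspan_dim_less:
  fixes A B :: "('i, 'k::field) mpol set"
  assumes T: "finite T" "B \<subseteq> kvec.span T" and A: "kvec.subspace A" "A \<subseteq> B" "A \<noteq> B"
  shows "kvec.dim A < kvec.dim B"
proof -
  obtain S where S: "S \<subseteq> A" "kvec.independent S" "A \<subseteq> kvec.span S" "card S = kvec.dim A"
    using kvec.basis_exists by blast
  obtain b where b: "b \<in> B" "b \<notin> A" using A by blast
  have "kvec.span S \<subseteq> A" using S(1) A(1) by (rule kvec.span_minimal)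
  then have "b \<notin> kvec.span S" using b by blast
  then have "kvec.independent (insert b S)" using S(2) by (rule kvec.independent_insertI)
  moreover have "insert b S \<subseteq> B" using b S(1) A(2) by blast
  ultimately obtain C where C: "insert b S \<subseteq> C" "C \<subseteq> B" "kvec.independent C" "B \<subseteq> kvec.span C"
    using kvec.maximal_independent_subset_extend by metis
  have "finite C" using kvec.independent_span_bound[OF T(1) C(3)] C(2) T(2) by blast
  have "b \<notin> S" using b S(1) by blast
  then have "Suc (card S) = card (insert b S)"
    using finite_subset[OF C(1) \<open>finite C\<close>] by simp
  also have "\<dots> \<le> card C" using C(1) \<open>finite C\<close> by (intro card_mono)
  also have "\<dots> = kvec.dim B" using C by (intro kvec.basis_card_eq_dim)
  finally show ?thesis using S(4) by simp
qed

text \<open>An ideal J containing I is determined by its intersection with the span of T, since each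
  F in J is G + (F - G) with G in I. A descending chain of such intersections is constant from a
  member of least dimension on.\<close>

lemma artinian_if_finite_codim:
  fixes I :: "('i, 'k::field) mpol set"
  assumes I: "is_ideal I" and T: "finite T" and codim: "\<And>F. \<exists>G\<in>I. F - G \<in> kvec.span T"
  shows "artinian_ideal I"
  unfolding artinian_ideal_def
proof (intro conjI allI impI I)
  fix J :: "nat \<Rightarrow> ('i, 'k) mpol set"
  assume J: "\<forall>n. is_ideal (J n) \<and> I \<subseteq> J n \<and> J (Suc n) \<subseteq> J n"
  define A where "A n = J n \<inter> kvec.span T" for n
  have J_ideal: "is_ideal (J n)" and J_I: "I \<subseteq> J n" for n using J by blast+
  have sub: "kvec.subspace (A n)" for n
  proof -
    note ideal = ring_ideal.subspace_0[OF J_ideal] ring_ideal.subspace_add[OF J_ideal]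
      ring_ideal.subspace_scale[OF J_ideal]
    have "kvec.subspace (J n)" using ideal by (intro kvec.subspaceI)
    then show ?thesis unfolding A_def by (rule kvec.subspace_inter[OF _ kvec.subspace_span])
  qed
  have J_le: "J n \<subseteq> J m" if "m \<le> n" for m n
    by (rule lift_Suc_antimono_le[OF _ that]) (use J in blast)
  define N where "N = (ARG_MIN (\<lambda>n. kvec.dim (A n)) n. True)"
  have N: "kvec.dim (A N) \<le> kvec.dim (A n)" for n
    unfolding N_def by (rule arg_min_nat_le) simp
  have "J n = J N" if n: "n \<ge> N" for n
  proof
    have "A n = A N"
    proof (rule ccontr)
      assume "A n \<noteq> A N"
      moreover have "A n \<subseteq> A N" using J_le[OF n] by (auto simp: A_def)
      ultimately have "kvec.dim (A n) < kvec.dim (A N)"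
        by (intro kspan_dim_less[OF T] sub) (auto simp: A_def)
      then show False using N[of n] by simp
    qed
    show "J N \<subseteq> J n"
    proof
      fix F assume F: "F \<in> J N"
      obtain G where G: "G \<in> I" "F - G \<in> kvec.span T" using codim by blast
      have "F - G \<in> J N" by (rule ring_ideal.subspace_diff[OF J_ideal F]) (use G J_I in blast)
      then have "F - G \<in> A N" using G by (simp add: A_def)
      then have "F - G \<in> J n" using \<open>A n = A N\<close> by (auto simp: A_def)
      moreover have "G \<in> J n" using G J_I by blast
      ultimately have "F - G + G \<in> J n" by (rule ring_ideal.subspace_add[OF J_ideal])
      then show "F \<in> J n" by simp
    qed
  qed (rule J_le[OF n])
  then show "\<exists>N. \<forall>n\<ge>N. J n = J N" by blast
qed

context gt_setup begin

lemma single_in_I: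
  assumes "d \<le> lookup m 0 \<or> d \<le> lookup m 1 \<or> d \<le> lookup m 2"
  shows "single m c \<in> I"
  unfolding I_monomial
proof (rule monomial_idealI)
  fix k assume "k \<in> keys (single m c)"
  then have k: "k = m" by (auto split: if_splits)
  have "m = (m - n) + n" if "\<And>i. lookup n i \<le> lookup m i" for n
    using that by (intro poly_mapping_eqI) (simp add: lookup_add lookup_minus)
  moreover have "lookup (mon3 d 0 0) i \<le> lookup m i" if "d \<le> lookup m 0" for i
    using that three_cases[of i] by auto
  moreover have "lookup (mon3 0 d 0) i \<le> lookup m i" if "d \<le> lookup m 1" for i
    using that three_cases[of i] by auto
  moreover have "lookup (mon3 0 0 d) i \<le> lookup m i" if "d \<le> lookup m 2" for i
    using that three_cases[of i] by auto
  ultimately show "\<exists>n\<in>inv_mons. \<exists>v. k = v + n"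
    unfolding k using assms power_mons by metis
qed

text \<open>Modulo x^d, y^d and z^d every polynomial is a combination of the finitely many monomials
  with all exponents below d.\<close>

lemma artinian_I: "artinian_ideal I"
proof (rule artinian_if_finite_codim[OF ideal_I])
  let ?box = "(\<lambda>(i, j, k). mon3 i j k) ` ({..<d} \<times> {..<d} \<times> {..<d})"
  let ?T = "(\<lambda>m. single m (1 :: 'k)) ` ?box"
  show "finite ?T" by simp
  fix F :: "(3, 'k) mpol"
  define G where "G = (\<Sum>m\<in>keys F - ?box. single m (lookup F m))"
  have "G \<in> I"
    unfolding G_def
  proof (rule ring_ideal.subspace_sum[OF ideal_I])
    fix m assume "m \<in> keys F - ?box"
    then have "(lookup m 0, lookup m 1, lookup m 2) \<notin> {..<d} \<times> {..<d} \<times> {..<d}"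
      by (metis (mono_tags, lifting) DiffD2 case_prod_conv mon3_eta rev_image_eqI)
    then show "single m (lookup F m) \<in> I" by (intro single_in_I) auto
  qed
  moreover have "F - G \<in> kvec.span ?T"
  proof (rule forms_kspan)
    have "F = (\<Sum>m\<in>keys F. single m (lookup F m))"
      by (rule poly_mapping_eq_sum_single) auto
    also have "\<dots> = (\<Sum>m\<in>keys F \<inter> ?box. single m (lookup F m)) + G"
      unfolding G_def by (rule sum.Int_Diff) simp
    finally have FG: "F - G = (\<Sum>m\<in>keys F \<inter> ?box. single m (lookup F m))" by (simp only: diff_eq_eq)
    have "lookup (F - G) m = 0" if "m \<notin> ?box" for m
      unfolding FG lookup_sum using that by (intro sum.neutral) (auto simp: lookup_single when_def)
    then show "keys (F - G) \<subseteq> ?box" unfolding in_keys_iff[abs_def] subset_iff by (metis in_keys_iff)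
  qed
  ultimately show "\<exists>G\<in>I. F - G \<in> kvec.span ?T" by blast
qed

lemma togliatti_I: "togliatti_system d I"
  unfolding togliatti_system_def
proof (intro conjI exI ballI)
  let ?S = "(\<lambda>m. single m (1 :: 'k)) ` inv_mons"
  show "card ?S \<le> d + 1"
    using card_image_le[OF finite_inv_mons, of "\<lambda>m. single m (1 :: 'k)"] card_inv_mons by simp
  show "?S \<subseteq> forms d" using inv_mons_mdeg by auto
  show "\<not> max_rank I L (d - 1)" if "L \<in> forms 1" for L using that by (rule not_max_rank)
qed (simp_all add: d_pos artinian_I I_monomial[symmetric])

lemma monomial_togliatti_I: "monomial_togliatti_system d I"
  unfolding monomial_togliatti_system_def
  by (intro conjI togliatti_I exI[of _ "(\<lambda>m. single m 1) ` inv_mons"] I_monomial)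
    (auto simp: monomials_def)

lemma min_monomial_gens_I: "min_monomial_gens I \<subseteq> (\<lambda>m. single m 1) ` inv_mons"
proof
  fix x assume x: "x \<in> min_monomial_gens I"
  then obtain m where m: "x = single m 1" "x \<in> I"
    by (auto simp: min_monomial_gens_def monomials_def)
  then obtain n v where n: "n \<in> inv_mons" "m = v + n"
    using monomial_ideal_keys[of x inv_mons m] unfolding I_monomial by auto
  have "single n 1 \<in> monomials \<inter> I"
    unfolding I_monomial monomials_def using n(1) by (auto intro: ring_ideal.span_base)
  moreover have "single n 1 dvd x"
    by (rule dvdI[of _ _ "single v 1"]) (simp add: m n mult_single add.commute)
  ultimately have "single n 1 = x" using x by (auto simp: min_monomial_gens_def)
  then show "x \<in> (\<lambda>m. single m 1) ` inv_mons" using n(1) by blast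
qed

text \<open>A Togliatti system fails maximal rank for every linear form, so it is enough that
  multiplication by x + y + z is injective modulo the smaller ideal. A product in that ideal is an
  invariant form lacking an omitted monomial m, and \<open>mult_sum_vars_eq_0\<close>
  applies.\<close>

lemma minimal_I: "minimal_monomial_togliatti_system d I"
  unfolding minimal_monomial_togliatti_system_def
proof (intro conjI monomial_togliatti_I allI impI notI)
  fix S assume S: "S \<subset> min_monomial_gens I" and tog: "monomial_togliatti_system d (gen_ideal S)"
  define E where "E = {m \<in> inv_mons. single m 1 \<in> S}"
  have S_E: "S = (\<lambda>m. single m 1) ` E" using S min_monomial_gens_I by (auto simp: E_def)
  obtain m where m: "m \<in> inv_mons" "m \<notin> E" using S min_monomial_gens_I by (auto simp: E_def)
  let ?L = "lin_form 1 1 1 :: (3, 'k) mpol"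
  have "inj_on (mult_quot (gen_ideal S) ?L) (graded_quot (gen_ideal S) (d - 1))"
  proof (rule inj_onI)
    fix X Y assume XY: "X \<in> graded_quot (gen_ideal S) (d - 1)" "Y \<in> graded_quot (gen_ideal S) (d - 1)"
      and eq: "mult_quot (gen_ideal S) ?L X = mult_quot (gen_ideal S) ?L Y"
    obtain F G where F: "F \<in> forms (d - 1)" "X = residue (gen_ideal S) F"
      and G: "G \<in> forms (d - 1)" "Y = residue (gen_ideal S) G"
      using XY by (auto simp: graded_quot_def)
    have "F - G \<in> forms (d - 1)"
      using forms_add[OF F(1) forms_const_mult[OF G(1), of "- 1"]] by (simp add: mconst_uminus)
    then have LFG: "?L * (F - G) \<in> forms d"
      using forms_mult[OF forms_lin_form[of 1 1 1]] d_pos by (metis Suc_pred' plus_1_eq_Suc)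
    have "residue (gen_ideal S) (?L * F) = residue (gen_ideal S) (?L * G)"
      using eq unfolding F(2) G(2) by (simp only: mult_quot_residue gen_ideal_is_ideal)
    then have "?L * F - ?L * G \<in> gen_ideal S"
      by (simp only: residue_eq_iff gen_ideal_is_ideal)
    then have "?L * (F - G) \<in> gen_ideal S" by (simp only: right_diff_distrib)
    then have keys: "keys (?L * (F - G)) \<subseteq> E"
      using monomial_ideal_forms[of E d, OF _ LFG] inv_mons_mdeg unfolding S_E by (auto simp: E_def)
    have "F - G = 0"
    proof (rule mult_sum_vars_eq_0)
      show "keys (?L * (F - G)) \<subseteq> inv_mons" using keys by (auto simp: E_def)
      show "lookup (?L * (F - G)) m = 0" using keys m(2) by (meson in_keys_iff subsetD)
    qed (rule m(1))
    then show "X = Y" using F G by simp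
  qed
  then have "max_rank (gen_ideal S) ?L (d - 1)" by (simp add: max_rank_def)
  moreover have "?L \<in> forms 1" by (rule forms_lin_form)
  ultimately show False
    using tog unfolding monomial_togliatti_system_def togliatti_system_def by blast
qed

definition rep :: "int \<Rightarrow> 3 \<Rightarrow> 'k" where
  "rep g = (\<lambda>i. u i ^ nat g)"

lemma u_power_d: "u i ^ d = 1"
  using three_cases[of i] e_power_eq_1[of d] e_power_eq_1[of "a * d"]
  by (auto simp: u_def power_mult)

lemma u_nonzero [simp]: "u i \<noteq> 0"
  using three_cases[of i] by (auto simp: u_def)

lemma u_power_mod: "u i ^ (n mod d) = u i ^ n"
proof -
  have "u i ^ n = (u i ^ d) ^ (n div d) * u i ^ (n mod d)" by (simp flip: power_mult power_add)
  then show ?thesis by (simp add: u_power_d)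
qed

lemma carrier_Zd: "carrier (integer_mod_group d) = {0..<int d}"
  using d_pos by (simp add: carrier_integer_mod_group)

lemma diag_rep_rep: "diag_rep d rep"
  unfolding diag_rep_def
proof (intro conjI ballI allI)
  fix g h :: int and i :: 3
  assume "g \<in> carrier (integer_mod_group d)" "h \<in> carrier (integer_mod_group d)"
  then have "nat ((g + h) mod int d) = (nat g + nat h) mod d"
    by (simp add: carrier_Zd nat_mod_distrib nat_add_distrib)
  then show "rep (g \<otimes>\<^bsub>integer_mod_group d\<^esub> h) i = rep g i * rep h i"
    by (simp add: rep_def u_power_mod power_add)
qed (simp add: rep_def)

lemma I_invariants:
  "I = gen_ideal {F \<in> forms d. \<forall>g\<in>carrier (integer_mod_group d). diag_act (rep g) F = F}"
proof -
  have "(\<forall>g\<in>carrier (integer_mod_group d). diag_act (rep g) F = F) \<longleftrightarrow> diag_act u F = F"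
    if "F \<in> forms d" for F
  proof
    assume *: "\<forall>g\<in>carrier (integer_mod_group d). diag_act (rep g) F = F"
    have "(1 :: int) \<in> carrier (integer_mod_group d)" using a_ge a_less by (simp add: carrier_Zd)
    with * have "diag_act (rep 1) F = F" by blast
    then show "diag_act u F = F" by (simp add: rep_def)
  next
    assume "diag_act u F = F"
    then have "keys F \<subseteq> inv_mons" using that inv_forms_iff by blast
    then have "lookup F m * mon_val u m ^ n = lookup F m" for m n
      by (cases "m \<in> keys F") (auto simp: inv_mons_iff in_keys_iff)
    then show "\<forall>g\<in>carrier (integer_mod_group d). diag_act (rep g) F = F"
      by (auto intro!: poly_mapping_eqI simp: rep_def mon_val_power)
  qed
  then show ?thesis unfolding I_def GT_ideal_def u_def[symmetric] by (metis (lifting))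
qed

end

subsection \<open>Points of the projective plane\<close>

lemma ppoint_eq_iff: "ppoint v = ppoint w \<longleftrightarrow> (\<exists>c. c \<noteq> 0 \<and> v = (\<lambda>i. c * w i))"
proof
  assume "ppoint v = ppoint w"
  moreover have "v \<in> ppoint v" unfolding ppoint_def by (rule CollectI) (rule exI[of _ 1], simp)
  ultimately show "\<exists>c. c \<noteq> 0 \<and> v = (\<lambda>i. c * w i)" by (auto simp: ppoint_def)
next
  assume "\<exists>c. c \<noteq> 0 \<and> v = (\<lambda>i. c * w i)"
  then obtain c where c: "c \<noteq> 0" "v = (\<lambda>i. c * w i)" by blast
  show "ppoint v = ppoint w"
  proof (intro equalityI subsetI)
    fix x assume "x \<in> ppoint v"
    then obtain b where b: "b \<noteq> 0" "x = (\<lambda>i. b * v i)" by (auto simp: ppoint_def)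
    have "x = (\<lambda>i. (b * c) * w i)" unfolding b(2) c(2) by (simp only: mult.assoc)
    moreover have "b * c \<noteq> 0" using b(1) c(1) by simp
    ultimately show "x \<in> ppoint w" unfolding ppoint_def by blast
  next
    fix x assume "x \<in> ppoint w"
    then obtain b where b: "b \<noteq> 0" "x = (\<lambda>i. b * w i)" by (auto simp: ppoint_def)
    have "x = (\<lambda>i. (b / c) * v i)" unfolding b(2) c(2) using c(1) by simp
    moreover have "b / c \<noteq> 0" using b(1) c(1) by simp
    ultimately show "x \<in> ppoint v" unfolding ppoint_def by blast
  qed
qed

lemma ppoint_scale [simp]: "c \<noteq> 0 \<Longrightarrow> ppoint (\<lambda>i. c * v i) = ppoint v"
  by (auto simp: ppoint_eq_iff)

lemma ppoint_in_P2: "v \<noteq> (\<lambda>_. 0) \<Longrightarrow> ppoint v \<in> P2"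
  by (auto simp: P2_def)

lemma P2E:
  assumes "p \<in> P2"
  obtains v where "v \<noteq> (\<lambda>_. 0)" "p = ppoint v"
  using assms by (auto simp: P2_def)

lemma ppoint_eq_minors:
  fixes v w :: "'i \<Rightarrow> 'k::field"
  assumes "v \<noteq> (\<lambda>_. 0)" "w \<noteq> (\<lambda>_. 0)" and minors: "\<And>i j. v i * w j = v j * w i"
  shows "ppoint v = ppoint w"
proof -
  obtain j where j: "w j \<noteq> 0" using assms(2) by auto
  have v: "v = (\<lambda>i. v j / w j * w i)"
    using minors[of _ j] j by (auto simp: field_simps)
  then have "v j \<noteq> 0" using assms(1) by auto
  then show ?thesis using v j unfolding ppoint_eq_iff by (intro exI[of _ "v j / w j"]) auto
qed

lemma ppoint_eq_imp_minors: "ppoint v = ppoint w \<Longrightarrow> v i * w j = v j * w i"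
  by (auto simp: ppoint_eq_iff)

lemma form_coords_scale:
  assumes "S \<subseteq> forms n"
  shows "form_coords S (\<lambda>i. c * v i) = (\<lambda>f. c ^ n * form_coords S v f)"
  using assms by (auto simp: form_coords_def mval_scale subset_iff)

lemma form_map_ppoint:
  assumes S: "S \<subseteq> forms n"
  shows "form_map S (ppoint v) = ppoint (form_coords S v)"
proof -
  have "ppoint (form_coords S w) = ppoint (form_coords S v)" if "w \<in> ppoint v" for w
    using that form_coords_scale[OF S] by (auto simp: ppoint_def[of v])
  moreover have "v \<in> ppoint v" unfolding ppoint_def by (rule CollectI) (rule exI[of _ 1], simp)
  ultimately show ?thesis unfolding form_map_def by blast
qed

subsection \<open>Generators of the degree \<open>n\<close> part\<close>

text \<open>In the degree n component of a combination of generators, only the constant terms of the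
  cofactors survive. Hence every generating set of degree d spans the same forms as the invariant
  monomials, and facts about these transfer to it.\<close>

lemma forms_in_kspan_gens:
  fixes S :: "('i, 'k::field) mpol set"
  assumes S: "S \<subseteq> forms n" and F: "F \<in> gen_ideal S" "F \<in> forms n"
  shows "F \<in> kvec.span S"
proof -
  have "hcomp n F \<in> kvec.span S"
    using F(1)
  proof (induction rule: ring_ideal.span_induct_alt)
    case base
    have "hcomp n (0 :: ('i, 'k) mpol) = 0" by (rule hcomp_forms) simp
    then show ?case using kvec.span_zero by metis
  next
    case (step q s F)
    have "hcomp n (q * s) = mconst (lookup q 0) * s" using S step.hyps by (intro hcomp_mult_form) auto
    moreover have "mconst (lookup q 0) * s \<in> kvec.span S"
      using step.hyps by (intro kvec.span_scale kvec.span_base)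
    ultimately show ?case unfolding hcomp_add using step.IH by (simp only: kvec.span_add)
  qed
  then show ?thesis using F(2) by simp
qed

lemma bezout_solve:
  fixes b d :: nat and t :: int
  assumes "int (gcd b d) dvd t"
  shows "\<exists>n. int d dvd n * int b - t"
proof -
  obtain x y where xy: "x * int b + y * int d = gcd (int b) (int d)" using bezout_int by blast
  obtain s where s: "t = gcd (int b) (int d) * s" using assms by (metis dvd_def gcd_int_int_eq)
  have "s * x * int b - t = s * x * int b - (x * int b + y * int d) * s" by (simp only: s xy)
  also have "\<dots> = int d * (- s * y)" by (simp add: algebra_simps)
  finally show ?thesis by (metis dvd_triv_left)
qed

section \<open>The fibres of the morphism are the orbits of the group\<close>

context gt_setup begin

text \<open>The powers of e already supply d distinct roots of X^d - 1, and there are no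
  more.\<close>

lemma root_of_unity:
  assumes "x ^ d = 1"
  shows "\<exists>n<d. x = e ^ n"
proof -
  let ?p = "monom 1 d - 1 :: 'k poly"
  have deg: "degree ?p \<le> d"
    by (intro degree_diff_le degree_monom_le) simp
  have "coeff ?p d = 1" using d_pos by simp
  then have p: "?p \<noteq> 0" by (metis coeff_0 zero_neq_one)
  have roots: "{x. poly ?p x = 0} = {x. x ^ d = 1}" by (simp add: poly_monom)
  have inj: "inj_on (\<lambda>n. e ^ n) {..<d}" by (auto simp: inj_on_def e_power_eq_iff)
  have sub: "(\<lambda>n. e ^ n) ` {..<d} \<subseteq> {x. x ^ d = 1}"
    by (auto simp: e_power_eq_1 simp flip: power_mult)
  have "finite {x :: 'k. x ^ d = 1}" using poly_roots_finite[OF p] roots by simp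
  moreover have "card {x :: 'k. x ^ d = 1} \<le> card ((\<lambda>n. e ^ n) ` {..<d})"
    using card_poly_roots_bound[OF p] roots deg inj by (simp add: card_image)
  ultimately have "(\<lambda>n. e ^ n) ` {..<d} = {x. x ^ d = 1}"
    using sub by (intro card_seteq)
  then show ?thesis using assms by auto
qed

definition wt :: "3 \<Rightarrow> nat" where
  "wt = triple 0 1 a"

lemma u_eq: "u i = e ^ wt i"
  using three_cases[of i] by (auto simp: u_def wt_def)

text \<open>
  The invariant monomials of degree \<open>d\<close> separate the orbits: on the points with full support this
  is achieved by \<open>x\<^sup>a\<^sup>-\<^sup>1 y\<^sup>d\<^sup>-\<^sup>a z\<close> together with the \<open>d\<close>-th powers; on the coordinate line \<open>x = 0\<close> the group acts on
  \<open>z / y\<close> through \<open>e\<^sup>a\<^sup>-\<^sup>1\<close> and on \<open>y = 0\<close> it acts on \<open>z / x\<close> through \<open>e\<^sup>a\<close>.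
\<close>

lemma exponents_solvable:
  fixes p :: "3 \<Rightarrow> nat" and A :: "3 set"
  assumes inv: "\<And>m. m \<in> inv_mons \<Longrightarrow> keys m \<subseteq> A \<Longrightarrow>
      d dvd p 0 * lookup m 0 + p 1 * lookup m 1 + p 2 * lookup m 2"
  shows "\<exists>q n. \<forall>i\<in>A. int d dvd q + n * int (wt i) - int (p i)"
proof -
  have keys_mon3: "keys (mon3 i j k) \<subseteq> A \<longleftrightarrow> (i \<noteq> 0 \<longrightarrow> 0 \<in> A) \<and> (j \<noteq> 0 \<longrightarrow> 1 \<in> A) \<and> (k \<noteq> 0 \<longrightarrow> 2 \<in> A)" for i j k
    using all_3[of "\<lambda>l. l \<in> keys (mon3 i j k) \<longrightarrow> l \<in> A"] unfolding in_keys_iff subset_iff by simp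
  have mon: "int d dvd int (p 0) * int i + int (p 1) * int j + int (p 2) * int k"
    if "i + j + k = d" "d dvd j + a * k" "i \<noteq> 0 \<longrightarrow> 0 \<in> A" "j \<noteq> 0 \<longrightarrow> 1 \<in> A" "k \<noteq> 0 \<longrightarrow> 2 \<in> A" for i j k
  proof -
    have "d dvd p 0 * i + p 1 * j + p 2 * k"
      using inv[of "mon3 i j k"] that keys_mon3 by (simp add: inv_mons_def mdeg3)
    then show ?thesis by (simp flip: of_nat_mult of_nat_add)
  qed
  have gcd_step: "int (gcd b d) dvd t"
    if dv: "int d dvd int (d div gcd b d) * t" for b t
  proof -
    have g: "0 < gcd b d" using d_pos by simp
    obtain s where "int (d div gcd b d) * t = int d * s"
      using dv by (elim dvdE)
    moreover have dg: "int d = int (d div gcd b d) * int (gcd b d)"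
      by (simp flip: of_nat_mult)
    ultimately have "int (d div gcd b d) * t = int (d div gcd b d) * (int (gcd b d) * s)" by (simp only: mult.assoc)
    moreover have "int (d div gcd b d) \<noteq> 0" using dg d_pos by (metis mult_zero_left of_nat_0_less_iff less_irrefl)
    ultimately show ?thesis by simp
  qed
  consider (xyz) "0 \<in> A" "1 \<in> A" "2 \<in> A" | (yz) "0 \<notin> A" "1 \<in> A" "2 \<in> A" | (xz) "0 \<in> A" "1 \<notin> A" "2 \<in> A"
    | (xy) "2 \<notin> A" "0 \<in> A" "1 \<in> A" | (one) "\<exists>i. A \<subseteq> {i}"
  proof -
    have sub: "A \<subseteq> {0, 1, 2}" using three_cases by blast
    consider "0 \<in> A" "1 \<in> A" "2 \<in> A" | "0 \<notin> A" "1 \<in> A" "2 \<in> A" | "0 \<in> A" "1 \<notin> A" "2 \<in> A"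
      | "2 \<notin> A" "0 \<in> A" "1 \<in> A" | "A \<subseteq> {0}" | "A \<subseteq> {1}" | "A \<subseteq> {2}"
      using sub by fast
    then show thesis by cases (use that in blast)+
  qed
  then show ?thesis
  proof cases
    case xyz
    \<comment> \<open>The monomial x^(a-1) y^(d-a) z gives p 2 = p 0 + (p 1 - p 0) a modulo d, so q
      = p 0 and n = p 1 - p 0 solve all three congruences.\<close>
    have "int d dvd int (p 0) * int (a - 1) + int (p 1) * int (d - a) + int (p 2) * int 1"
      by (rule mon) (use a_ge a_less xyz in auto)
    then obtain s where s: "int (p 0) * (int a - 1) + int (p 1) * (int d - int a) + int (p 2) = int d * s"
      using a_ge a_less by (auto simp: of_nat_diff)
    have "int (p 0) + (int (p 1) - int (p 0)) * int a - int (p 2) = int d * (int (p 1) - s)"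
      using s by (simp add: algebra_simps)
    then have "int d dvd int (p 0) + (int (p 1) - int (p 0)) * int a - int (p 2)" by (metis dvd_triv_left)
    then have "\<forall>i. int d dvd int (p 0) + (int (p 1) - int (p 0)) * int (wt i) - int (p i)"
      unfolding all_3 by (simp add: wt_def)
    then show ?thesis by blast
  next
    case yz
    \<comment> \<open>Here k is the least positive exponent with (a - 1) k divisible by d, which
      makes y^(d-k) z^k invariant. It shows that g divides p 2 - p 1, exactly the solvability
      condition for n (a - 1) = p 2 - p 1 modulo d; then q = p 1 - n.\<close>
    define g where "g = gcd (a - 1) d"
    define k where "k = d div g"
    have kd: "k * g = d" "k \<le> d" by (simp_all add: k_def g_def)
    have "int d dvd int (p 0) * int 0 + int (p 1) * int (d - k) + int (p 2) * int k"
    proof (rule mon)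
      have "g dvd a - 1" by (simp add: g_def)
      then obtain s where "a - 1 = g * s" by (elim dvdE)
      then have "(a - 1) * k = s * d" unfolding kd(1)[symmetric] by (simp only: mult_ac)
      moreover have "d - k + a * k = d + (a - 1) * k" using kd(2) a_ge by (cases a) simp_all
      ultimately show "d dvd d - k + a * k" by simp
    qed (use yz kd in auto)
    then have "int d dvd int d * int (p 1) + int k * (int (p 2) - int (p 1))"
      using kd by (simp add: of_nat_diff algebra_simps)
    then have "int d dvd int k * (int (p 2) - int (p 1))" by (simp add: dvd_add_right_iff)
    then have "int g dvd int (p 2) - int (p 1)" unfolding k_def g_def by (rule gcd_step)
    then obtain n where n: "int d dvd n * int (a - 1) - (int (p 2) - int (p 1))"
      unfolding g_def using bezout_solve by blast
    have "(int (p 1) - n) + n * int a - int (p 2) = n * int (a - 1) - (int (p 2) - int (p 1))"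
      using a_ge by (simp add: of_nat_diff algebra_simps)
    then have "int d dvd (int (p 1) - n) + n * int a - int (p 2)" using n by (simp only:)
    moreover have "A \<subseteq> {1, 2}"
    proof
      fix i assume "i \<in> A"
      then show "i \<in> {1, 2}" using yz three_cases[of i] by (elim disjE) simp_all
    qed
    ultimately show ?thesis
      by (intro exI[of _ "int (p 1) - n"] exI[of _ n]) (auto simp: wt_def)
  next
    case xz
    \<comment> \<open>The same argument with x^(d-k) z^k, where a k must be divisible by d; here q =
      p 0.\<close>
    define g where "g = gcd a d"
    define k where "k = d div g"
    have kd: "k * g = d" "k \<le> d" by (simp_all add: k_def g_def)
    have "int d dvd int (p 0) * int (d - k) + int (p 1) * int 0 + int (p 2) * int k"
    proof (rule mon)
      have "g dvd a" by (simp add: g_def)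
      then obtain s where "a = g * s" by (elim dvdE)
      then have "a * k = s * d" unfolding kd(1)[symmetric] by (simp only: mult_ac)
      then show "d dvd 0 + a * k" by simp
    qed (use xz kd in auto)
    then have "int d dvd int d * int (p 0) + int k * (int (p 2) - int (p 0))"
      using kd by (simp add: of_nat_diff algebra_simps)
    then have "int d dvd int k * (int (p 2) - int (p 0))" by (simp add: dvd_add_right_iff)
    then have "int g dvd int (p 2) - int (p 0)" unfolding k_def g_def by (rule gcd_step)
    then obtain n where n: "int d dvd n * int a - (int (p 2) - int (p 0))"
      unfolding g_def using bezout_solve by blast
    have "int (p 0) + n * int a - int (p 2) = n * int a - (int (p 2) - int (p 0))" by simp
    then have "int d dvd int (p 0) + n * int a - int (p 2)" using n by (simp only:)
    moreover have "A \<subseteq> {0, 2}"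
    proof
      fix i assume "i \<in> A"
      then show "i \<in> {0, 2}" using xz three_cases[of i] by (elim disjE) simp_all
    qed
    ultimately show ?thesis
      by (intro exI[of _ "int (p 0)"] exI[of _ n]) (auto simp: wt_def)
  next
    case xy
    have "A \<subseteq> {0, 1}"
    proof
      fix i assume "i \<in> A"
      then show "i \<in> {0, 1}" using xy three_cases[of i] by (elim disjE) simp_all
    qed
    then show ?thesis
      by (intro exI[of _ "int (p 0)"] exI[of _ "int (p 1) - int (p 0)"]) (auto simp: wt_def)
  next
    case one
    then obtain i where "A \<subseteq> {i}" by blast
    then show ?thesis by (intro exI[of _ "int (p i)"] exI[of _ 0]) auto
  qed
qed

lemma e_power_int_eq:
  assumes "int d dvd q + n * int k - int r"
  shows "e ^ nat (q mod int d) * (e ^ k) ^ nat (n mod int d) = e ^ r"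
proof -
  have "(q mod int d + int k * (n mod int d)) mod int d = (q + int k * n) mod int d"
    by (metis mod_add_right_eq mod_add_left_eq mod_mult_right_eq)
  also have "\<dots> = int r mod int d"
    using assms by (simp add: mod_eq_dvd_iff mult.commute)
  finally have "int ((nat (q mod int d) + k * nat (n mod int d)) mod d) = int (r mod d)"
    using d_pos by (simp add: zmod_int)
  then have "(nat (q mod int d) + k * nat (n mod int d)) mod d = r mod d" by (simp only: of_nat_eq_iff)
  then show ?thesis unfolding e_power_eq_iff[symmetric] by (simp add: power_add power_mult)
qed

text \<open>The d-th powers give v i = e^(p i) w i. Comparing the invariant monomials supported
  where w is nonzero gives congruences for p, and \<open>exponents_solvable\<close> decomposes p
  into a common scalar e^q and a group element; vanishing coordinates impose nothing.\<close>

lemma inv_mons_separate_orbits: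
  assumes eq: "\<And>m. m \<in> inv_mons \<Longrightarrow> mon_val v m = mon_val w m"
  shows "\<exists>c n. c \<noteq> 0 \<and> n < d \<and> v = (\<lambda>i. c * (u i ^ n * w i))"
proof -
  have pow: "v i ^ d = w i ^ d" for i
    using eq[OF power_mons(1)] eq[OF power_mons(2)] eq[OF power_mons(3)] three_cases[of i]
    by (auto simp: mon_val3)
  have "\<exists>n. v i = e ^ n * w i" for i
  proof (cases "w i = 0")
    case True
    then show ?thesis using pow[of i] d_pos by (simp add: power_0_left)
  next
    case False
    then have "(v i / w i) ^ d = 1" using pow[of i] by (simp add: power_divide)
    then obtain n where "v i / w i = e ^ n" using root_of_unity by blast
    then show ?thesis using False by (metis nonzero_eq_divide_eq)
  qed
  then obtain p where p: "\<And>i. v i = e ^ p i * w i" by metis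
  define A where "A = {i. w i \<noteq> 0}"
  have "\<exists>q n. \<forall>i\<in>A. int d dvd q + n * int (wt i) - int (p i)"
  proof (rule exponents_solvable)
    fix m assume m: "m \<in> inv_mons" "keys m \<subseteq> A"
    have "mon_val w m \<noteq> 0" using m(2) by (auto simp: mon_val_def A_def)
    moreover have "mon_val v m = mon_val (\<lambda>i. e ^ p i) m * mon_val w m"
    proof -
      have "v = (\<lambda>i. e ^ p i * w i)" using p by auto
      then show ?thesis by (simp only: mon_val_mult)
    qed
    ultimately have "mon_val (\<lambda>i. e ^ p i) m = 1" using eq[OF m(1)] by simp
    then show "d dvd p 0 * lookup m 0 + p 1 * lookup m 1 + p 2 * lookup m 2"
      by (simp add: mon_val3 e_power_eq_1 flip: power_mult power_add)
  qed
  then obtain q n where qn: "\<And>i. i \<in> A \<Longrightarrow> int d dvd q + n * int (wt i) - int (p i)" by blast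
  let ?c = "e ^ nat (q mod int d)" and ?n = "nat (n mod int d)"
  have "v i = ?c * (u i ^ ?n * w i)" for i
  proof (cases "i \<in> A")
    case True
    show ?thesis using e_power_int_eq[OF qn[OF True]] p by (simp add: u_eq mult.assoc[symmetric])
  qed (simp add: p A_def)
  moreover have "?n < d" using d_pos by (simp add: nat_less_iff)
  ultimately show ?thesis by (intro exI[of _ ?c] exI[of _ ?n]) auto
qed

text \<open>The covering property is proved for every finite generating set of forms of degree d, in
  particular for each minimal one.\<close>

definition gens :: "(3, 'k) mpol set \<Rightarrow> bool" where
  "gens S \<longleftrightarrow> finite S \<and> S \<subseteq> forms d \<and> gen_ideal S = I"

lemma gens_keys: "gens S \<Longrightarrow> f \<in> S \<Longrightarrow> keys f \<subseteq> inv_mons"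
  by (metis I_forms_iff gens_def ring_ideal.span_base subsetD)

lemma gens_span:
  assumes "gens S" "m \<in> inv_mons"
  shows "single m 1 \<in> kvec.span S"
proof (rule forms_in_kspan_gens[of S d])
  have "single m (1 :: 'k) \<in> forms d" using assms(2) by (simp add: inv_mons_mdeg)
  then show "single m (1 :: 'k) \<in> forms d" "single m 1 \<in> gen_ideal S"
    using assms I_forms_iff by (auto simp: gens_def)
qed (use assms in \<open>simp add: gens_def\<close>)

text \<open>The condition on f is linear in f, so it passes from S to its span, which contains the
  invariant monomials.\<close>

lemma gens_mval_eq:
  assumes S: "gens S" and eq: "\<And>f. f \<in> S \<Longrightarrow> mval f v = c * mval f w" and m: "m \<in> inv_mons"
  shows "mon_val v m = c * mon_val w m"
proof -
  have "kvec.span S \<subseteq> {F. mval F v = c * mval F w}"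
  proof (rule kvec.span_minimal)
    show "kvec.subspace {F :: (3, 'k) mpol. mval F v = c * mval F w}"
      by (rule kvec.subspaceI) (simp_all add: mval_hom distrib_left mult.left_commute)
  qed (use eq in auto)
  then have "mval (single m 1) v = c * mval (single m 1) w" using gens_span[OF S m] by blast
  then show ?thesis by simp
qed

text \<open>Equal image points make all invariant monomials proportional with one factor c. These
  have degree d, so rescaling w by a d-th root of c turns proportionality into equality.\<close>

lemma fibre_eq_orbit:
  assumes S: "gens S" and eq: "form_map S (ppoint v) = form_map S (ppoint w)"
  shows "\<exists>n<d. ppoint v = ppoint (\<lambda>i. u i ^ n * w i)"
proof -
  have "ppoint (form_coords S v) = ppoint (form_coords S w)"
    using eq form_map_ppoint[of S d] S by (simp add: gens_def)
  then obtain c where c: "c \<noteq> 0" "form_coords S v = (\<lambda>f. c * form_coords S w f)"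
    unfolding ppoint_eq_iff by blast
  then have "mval f v = c * mval f w" if "f \<in> S" for f
    using that by (auto simp: form_coords_def fun_eq_iff split: if_splits)
  then have mons: "mon_val v m = c * mon_val w m" if "m \<in> inv_mons" for m
    using gens_mval_eq[OF S] that by blast
  obtain b where b: "b ^ d = c" using nth_root_exists[OF d_pos] by blast
  have "b \<noteq> 0" using b c(1) d_pos by auto
  have "mon_val v m = mon_val (\<lambda>i. b * w i) m" if "m \<in> inv_mons" for m
    using mons[OF that] that b by (simp add: mon_val_const_mult inv_mons_mdeg)
  then obtain c' n where n: "c' \<noteq> 0" "n < d" "v = (\<lambda>i. c' * (u i ^ n * (b * w i)))"
    using inv_mons_separate_orbits by blast
  then have "v = (\<lambda>i. (c' * b) * (u i ^ n * w i))" by (simp add: mult_ac)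
  then have "ppoint v = ppoint (\<lambda>i. u i ^ n * w i)"
    using n(1) \<open>b \<noteq> 0\<close> by (metis mult_eq_0_iff ppoint_scale)
  then show ?thesis using n(2) by blast
qed

lemma form_map_orbit:
  assumes S: "gens S"
  shows "form_map S (ppoint (\<lambda>i. u i ^ n * v i)) = form_map S (ppoint v)"
proof -
  have "mval f (\<lambda>i. u i ^ n * v i) = mval f v" if "f \<in> S" for f
    unfolding mval_superset[OF finite_keys order_refl]
  proof (rule sum.cong[OF refl])
    fix m assume "m \<in> keys f"
    then have "mon_val u m = 1" using gens_keys[OF S that] by (auto simp: inv_mons_iff)
    then show "lookup f m * mon_val (\<lambda>i. u i ^ n * v i) m = lookup f m * mon_val v m"
      by (simp add: mon_val_mult mon_val_power)
  qed
  then have "form_coords S (\<lambda>i. u i ^ n * v i) = form_coords S v"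
    by (auto simp: form_coords_def)
  then show ?thesis using form_map_ppoint[of S d] S by (simp add: gens_def)
qed

end

text \<open>Kronecker substitution: with N above all exponents, x = t^(N N), y = t^N, z = t sends
  distinct monomials of F to distinct powers of t, which leaves a nonzero polynomial in one variable
  over an infinite field.\<close>

lemma mpol3_nonzero_value:
  fixes F :: "(3, 'k::field_char_0) mpol"
  assumes "F \<noteq> 0"
  shows "\<exists>v. mval F v \<noteq> 0"
proof -
  define N where "N = Suc (Max (mdeg ` keys F))"
  have small: "lookup m i < N" if "m \<in> keys F" for m i
  proof -
    have "mdeg m \<le> Max (mdeg ` keys F)" using that by (intro Max_ge) auto
    moreover have "lookup m i \<le> mdeg m" using three_cases[of i] by (auto simp: mdeg3)
    ultimately show ?thesis by (simp add: N_def)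
  qed
  define h where "h m = (lookup m 0 * N + lookup m 1) * N + lookup m 2" for m :: "3 \<Rightarrow>\<^sub>0 nat"
  have h_inj: "m = n" if "m \<in> keys F" "n \<in> keys F" "h m = h n" for m n
  proof -
    have z: "lookup k 2 = h k mod N" "lookup k 0 * N + lookup k 1 = h k div N" if "k \<in> keys F" for k
      using small[OF that, of 2] by (auto simp: h_def)
    have "lookup k 1 = h k div N mod N" "lookup k 0 = h k div N div N" if "k \<in> keys F" for k
      using small[OF that, of 1] by (auto simp: z(2)[OF that, symmetric])
    then show ?thesis using that z(1) by (simp add: exp3_eq_iff)
  qed
  define p where "p = (\<Sum>m\<in>keys F. monom (lookup F m) (h m))"
  obtain m where m: "m \<in> keys F" using assms by (metis ex_in_conv keys_eq_empty)
  have "coeff p (h m) = (\<Sum>n\<in>keys F. if n = m then lookup F n else 0)"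
    unfolding p_def coeff_sum using m h_inj by (intro sum.cong) (auto simp: coeff_monom)
  then have "coeff p (h m) \<noteq> 0" using m by (simp add: in_keys_iff)
  then have "p \<noteq> 0" by auto
  then have "{x. poly p x = 0} \<noteq> UNIV"
    using poly_roots_finite infinite_UNIV_char_0 by metis
  then obtain x where x: "poly p x \<noteq> 0" by auto
  have "poly p x = mval F (triple (x ^ (N * N)) (x ^ N) x)"
    unfolding p_def poly_sum mval_superset[OF finite_keys order_refl]
    by (rule sum.cong)
      (simp_all add: poly_monom mon_val3 h_def power_add power_mult[symmetric] algebra_simps)
  then show ?thesis using x by metis
qed

section \<open>Deck transformations\<close>

context gt_setup begin

text \<open>Restriction makes the map extensional, as membership in \<open>Bij P2\<close>
  demands.\<close>

definition act :: "nat \<Rightarrow> (3 \<Rightarrow> 'k) set \<Rightarrow> (3 \<Rightarrow> 'k) set" where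
  "act n = restrict (\<lambda>p. (\<lambda>v i. u i ^ n * v i) ` p) P2"

lemma u_scaled_nonzero: "v \<noteq> (\<lambda>_. 0) \<Longrightarrow> (\<lambda>i. u i ^ n * v i) \<noteq> (\<lambda>_. 0)"
  by (auto simp: fun_eq_iff)

lemma act_ppoint: "v \<noteq> (\<lambda>_. 0) \<Longrightarrow> act n (ppoint v) = ppoint (\<lambda>i. u i ^ n * v i)"
proof -
  assume v: "v \<noteq> (\<lambda>_. 0)"
  have "(\<lambda>v i. u i ^ n * v i) ` ppoint v = ppoint (\<lambda>i. u i ^ n * v i)"
  proof (intro equalityI subsetI)
    fix x assume "x \<in> (\<lambda>v i. u i ^ n * v i) ` ppoint v"
    then obtain c where "c \<noteq> 0" "x = (\<lambda>i. u i ^ n * (c * v i))" by (auto simp: ppoint_def)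
    then show "x \<in> ppoint (\<lambda>i. u i ^ n * v i)"
      unfolding ppoint_def by (intro CollectI exI[of _ c]) (simp add: mult.left_commute)
  next
    fix x assume "x \<in> ppoint (\<lambda>i. u i ^ n * v i)"
    then obtain c where "c \<noteq> 0" "x = (\<lambda>i. u i ^ n * (c * v i))"
      by (auto simp: ppoint_def mult.left_commute)
    then show "x \<in> (\<lambda>v i. u i ^ n * v i) ` ppoint v"
      unfolding ppoint_def by (intro image_eqI[of _ _ "\<lambda>i. c * v i"]) auto
  qed
  then show ?thesis using v by (simp add: act_def ppoint_in_P2)
qed

lemma act_in_P2: "p \<in> P2 \<Longrightarrow> act n p \<in> P2"
  by (elim P2E) (simp add: act_ppoint ppoint_in_P2 u_scaled_nonzero)

lemma act_act:
  assumes "p \<in> P2"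
  shows "act m (act n p) = act (m + n) p"
proof -
  obtain v where v: "v \<noteq> (\<lambda>_. 0)" "p = ppoint v" using assms by (rule P2E)
  show ?thesis
    unfolding v(2) by (simp add: act_ppoint v(1) u_scaled_nonzero power_add mult.assoc)
qed

lemma act_mod: "act (n mod d) = act n"
  by (simp add: act_def u_power_mod)

lemma act_multiple: "p \<in> P2 \<Longrightarrow> act (d * n) p = p"
  by (elim P2E) (simp add: act_ppoint power_mult u_power_d)

lemma act_inverse: "p \<in> P2 \<Longrightarrow> act n (act ((d - Suc 0) * n) p) = p" "p \<in> P2 \<Longrightarrow> act ((d - Suc 0) * n) (act n p) = p"
proof -
  have "n + (d - Suc 0) * n = d * n" using d_pos by (cases d) auto
  then show "p \<in> P2 \<Longrightarrow> act n (act ((d - Suc 0) * n) p) = p" "p \<in> P2 \<Longrightarrow> act ((d - Suc 0) * n) (act n p) = p"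
    by (simp_all add: act_act act_multiple add.commute)
qed

lemma bij_act: "bij_betw (act n) P2 P2"
  by (rule bij_betw_byWitness[of _ "act ((d - Suc 0) * n)"]) (auto simp: act_inverse act_in_P2)

lemma act_Bij: "act n \<in> Bij P2"
  using bij_act by (simp add: Bij_def act_def)

lemma inv_into_act: "p \<in> P2 \<Longrightarrow> inv_into P2 (act n) p = act ((d - Suc 0) * n) p"
  by (intro inv_into_f_eq) (auto intro: bij_betw_imp_inj_on[OF bij_act] simp: act_inverse act_in_P2)

lemma zariski_open_P2: "zariski_open (P2 :: (3 \<Rightarrow> 'k) set set)"
  unfolding zariski_open_def P2_def
  by (rule exI[of _ "{1}"]) (auto intro: exI[of _ 0] simp: forms_const[of 1, simplified])

text \<open>Agreement is required on \<open>P2\<close> alone, so that the lemma also covers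
  \<open>inv_into P2 (act n)\<close>, whose values elsewhere are unspecified.\<close>

lemma regular_act:
  assumes "\<And>p. p \<in> P2 \<Longrightarrow> \<phi> p = act n p"
  shows "regular_self_map \<phi>"
  unfolding regular_self_map_def
proof (intro conjI ballI exI)
  show "\<phi> ` P2 \<subseteq> P2" using assms act_in_P2 by auto
  show "zariski_open (P2 :: (3 \<Rightarrow> 'k) set set)" by (rule zariski_open_P2)
  show "\<forall>i. mconst (u i ^ n) * mvar i \<in> forms 1"
    by (intro allI forms_const_mult forms_var)
  show "\<forall>v. v \<noteq> (\<lambda>_. 0) \<and> ppoint v \<in> P2 \<longrightarrow>
      (\<exists>i. mval (mconst (u i ^ n) * mvar i) v \<noteq> 0) \<and>
      \<phi> (ppoint v) = ppoint (\<lambda>i. mval (mconst (u i ^ n) * mvar i) v)"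
  proof (intro allI impI, elim conjE)
    fix v :: "3 \<Rightarrow> 'k" assume v: "v \<noteq> (\<lambda>_. 0)" "ppoint v \<in> P2"
    then obtain i where "v i \<noteq> 0" by auto
    then show "(\<exists>i. mval (mconst (u i ^ n) * mvar i) v \<noteq> 0) \<and>
        \<phi> (ppoint v) = ppoint (\<lambda>i. mval (mconst (u i ^ n) * mvar i) v)"
      using v assms by (auto simp: mval_hom act_ppoint)
  qed
qed

lemma carrier_deck:
  "carrier (deck_group f) = {\<phi> \<in> Bij P2. regular_self_map \<phi> \<and> regular_self_map (inv_into P2 \<phi>) \<and>
    (\<forall>p\<in>P2. f (\<phi> p) = f p)}"
  by (simp add: deck_group_def)

lemma act_in_deck:
  assumes S: "gens S"
  shows "act n \<in> carrier (deck_group (form_map S))"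
  unfolding carrier_deck
proof (intro CollectI conjI ballI)
  show "regular_self_map (act n)" by (rule regular_act) (rule refl)
  show "regular_self_map (inv_into P2 (act n))" by (rule regular_act) (rule inv_into_act)
  fix p :: "(3 \<Rightarrow> 'k) set" assume "p \<in> P2"
  then obtain v where "v \<noteq> (\<lambda>_. 0)" "p = ppoint v" by (rule P2E)
  then show "form_map S (act n p) = form_map S p" by (simp add: act_ppoint form_map_orbit[OF S])
qed (rule act_Bij)

text \<open>Near v0 the map is given by forms F i on an open set, and some t with t(v0) nonzero cuts
  out a part of it. H is t times a 2 x 2 minor of the vectors F(v) and u^n v that is nonzero at v0;
  wherever H is nonzero, the two image points differ.\<close>

lemma differs_on_open:
  assumes reg: "regular_self_map \<phi>" and v0: "v0 \<noteq> (\<lambda>_. 0)" "\<phi> (ppoint v0) \<noteq> act n (ppoint v0)"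
  shows "\<exists>H. H \<noteq> 0 \<and> (\<forall>v. v \<noteq> (\<lambda>_. 0) \<longrightarrow> mval H v \<noteq> 0 \<longrightarrow> \<phi> (ppoint v) \<noteq> act n (ppoint v))"
proof -
  have "\<forall>p\<in>P2. \<exists>U k F. zariski_open U \<and> p \<in> U \<and> (\<forall>i. F i \<in> forms k) \<and>
      (\<forall>v. v \<noteq> (\<lambda>_. 0) \<and> ppoint v \<in> U \<longrightarrow>
        (\<exists>i. mval (F i) v \<noteq> 0) \<and> \<phi> (ppoint v) = ppoint (\<lambda>i. mval (F i) v))"
    using reg unfolding regular_self_map_def by (rule conjunct2)
  from bspec[OF this ppoint_in_P2[OF v0(1)]]
  obtain U k F where U: "zariski_open U" "ppoint v0 \<in> U" and F: "\<forall>i. F i \<in> forms k"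
    and \<phi>': "\<forall>v. v \<noteq> (\<lambda>_. 0) \<and> ppoint v \<in> U \<longrightarrow>
      (\<exists>i. mval (F i) v \<noteq> 0) \<and> \<phi> (ppoint v) = ppoint (\<lambda>i. mval (F i) v)"
    by (elim exE conjE)
  have \<phi>: "(\<exists>i. mval (F i) v \<noteq> 0) \<and> \<phi> (ppoint v) = ppoint (\<lambda>i. mval (F i) v)"
    if "v \<noteq> (\<lambda>_. 0)" "ppoint v \<in> U" for v
    using \<phi>' that by blast
  obtain T where T: "\<And>t. t \<in> T \<Longrightarrow> \<exists>n. t \<in> forms n"
    and U_eq: "U = {ppoint v | v. v \<noteq> (\<lambda>_. 0) \<and> (\<exists>t\<in>T. mval t v \<noteq> 0)}"
    using U(1) unfolding zariski_open_def by blast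
  obtain w t where w: "ppoint v0 = ppoint w" and t: "t \<in> T" "mval t w \<noteq> 0"
    using U(2) unfolding U_eq by blast
  obtain c where c: "c \<noteq> 0" "v0 = (\<lambda>i. c * w i)" using w unfolding ppoint_eq_iff by blast
  obtain l where "t \<in> forms l" using T t by blast
  then have t0: "mval t v0 \<noteq> 0" unfolding c(2) using t c(1) by (simp add: mval_scale)
  have nz: "(\<lambda>i. mval (F i) v0) \<noteq> (\<lambda>_. 0)" using \<phi>[OF v0(1) U(2)] by metis
  have ne: "ppoint (\<lambda>i. mval (F i) v0) \<noteq> ppoint (\<lambda>i. u i ^ n * v0 i)"
    using v0 \<phi>[OF v0(1) U(2)] by (simp add: act_ppoint)
  have "\<exists>i j. mval (F i) v0 * (u j ^ n * v0 j) \<noteq> mval (F j) v0 * (u i ^ n * v0 i)"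
  proof (rule ccontr)
    assume "\<not> ?thesis"
    then have "mval (F i) v0 * (u j ^ n * v0 j) = mval (F j) v0 * (u i ^ n * v0 i)" for i j by blast
    then have "ppoint (\<lambda>i. mval (F i) v0) = ppoint (\<lambda>i. u i ^ n * v0 i)"
      by (rule ppoint_eq_minors[OF nz u_scaled_nonzero[OF v0(1)]])
    with ne show False ..
  qed
  then obtain i j where ij: "mval (F i) v0 * (u j ^ n * v0 j) \<noteq> mval (F j) v0 * (u i ^ n * v0 i)"
    by blast
  define H where "H = t * (F i * (mconst (u j ^ n) * mvar j) - F j * (mconst (u i ^ n) * mvar i))"
  have H: "mval H v = mval t v * (mval (F i) v * (u j ^ n * v j) - mval (F j) v * (u i ^ n * v i))" for v
  proof -
    have diff: "mval (A - B) v = mval A v - mval B v" for A B :: "(3, 'k) mpol"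
      using mval_hom(1)[of "A - B" B v] by (simp add: eq_diff_eq)
    show ?thesis unfolding H_def by (simp add: mval_hom diff)
  qed
  have "H \<noteq> 0" using H[of v0] t0 ij by auto
  moreover have "\<phi> (ppoint v) \<noteq> act n (ppoint v)" if v: "v \<noteq> (\<lambda>_. 0)" "mval H v \<noteq> 0" for v
  proof
    assume eq: "\<phi> (ppoint v) = act n (ppoint v)"
    have "ppoint v \<in> U" unfolding U_eq using v H[of v] t(1) by auto
    then have "ppoint (\<lambda>i. mval (F i) v) = ppoint (\<lambda>i. u i ^ n * v i)"
      using \<phi>[OF v(1)] eq v(1) by (simp add: act_ppoint)
    then have "mval (F i) v * (u j ^ n * v j) = mval (F j) v * (u i ^ n * v i)"
      by (rule ppoint_eq_imp_minors)
    then show False using v(2) H[of v] by simp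
  qed
  ultimately show ?thesis by blast
qed

text \<open>If the map differed from each of the d group elements somewhere, the product of the
  witnesses H n would be nonzero at some v, and there the image would lie outside the orbit of v.
  But a deck transformation preserves fibres, which are orbits.\<close>

lemma deck_eq_act:
  assumes S: "gens S" and \<phi>: "\<phi> \<in> carrier (deck_group (form_map S))"
  shows "\<exists>n<d. \<phi> = act n"
proof (rule ccontr)
  assume neg: "\<not> ?thesis"
  have Bij: "\<phi> \<in> Bij P2" and reg: "regular_self_map \<phi>" and fib: "\<And>p. p \<in> P2 \<Longrightarrow> form_map S (\<phi> p) = form_map S p"
    using \<phi> unfolding carrier_deck by blast+
  have "\<forall>n\<in>{..<d}. \<exists>H. H \<noteq> 0 \<and>
      (\<forall>v. v \<noteq> (\<lambda>_. 0) \<longrightarrow> mval H v \<noteq> 0 \<longrightarrow> \<phi> (ppoint v) \<noteq> act n (ppoint v))"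
  proof
    fix n assume "n \<in> {..<d}"
    then have n: "n < d" by simp
    have "\<exists>p\<in>P2. \<phi> p \<noteq> act n p"
    proof (rule ccontr)
      assume "\<not> (\<exists>p\<in>P2. \<phi> p \<noteq> act n p)"
      then have "\<phi> = act n"
        using Bij_imp_extensional[OF Bij] Bij_imp_extensional[OF act_Bij]
        by (intro extensionalityI[of _ P2]) auto
      then show False using neg n by blast
    qed
    then obtain v0 where "v0 \<noteq> (\<lambda>_. 0)" "\<phi> (ppoint v0) \<noteq> act n (ppoint v0)"
      unfolding P2_def by blast
    then show "\<exists>H. H \<noteq> 0 \<and>
      (\<forall>v. v \<noteq> (\<lambda>_. 0) \<longrightarrow> mval H v \<noteq> 0 \<longrightarrow> \<phi> (ppoint v) \<noteq> act n (ppoint v))"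
      by (rule differs_on_open[OF reg])
  qed
  from bchoice[OF this] obtain H where H':
    "\<forall>n\<in>{..<d}. H n \<noteq> 0 \<and>
      (\<forall>v. v \<noteq> (\<lambda>_. 0) \<longrightarrow> mval (H n) v \<noteq> 0 \<longrightarrow> \<phi> (ppoint v) \<noteq> act n (ppoint v))" ..
  have H: "H n \<noteq> 0" "\<lbrakk>v \<noteq> (\<lambda>_. 0); mval (H n) v \<noteq> 0\<rbrakk> \<Longrightarrow> \<phi> (ppoint v) \<noteq> act n (ppoint v)"
    if "n < d" for n v
    using H' that by blast+
  have "(mvar 0 :: (3, 'k) mpol) \<noteq> 0"
  proof
    assume "(mvar 0 :: (3, 'k) mpol) = 0"
    then have "mval (mvar 0 :: (3, 'k) mpol) (\<lambda>_. 1) = mval (0 :: (3, 'k) mpol) (\<lambda>_. 1)" by (simp only:)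
    then show False by simp
  qed
  \<comment> \<open>The extra factor \<open>mvar 0\<close> ensures that the point found is not the
    zero vector.\<close>
  then have "mvar 0 * (\<Prod>n<d. H n) \<noteq> 0" using H(1) by simp
  then obtain v where "mval (mvar 0 * (\<Prod>n<d. H n)) v \<noteq> 0" using mpol3_nonzero_value by blast
  then have v: "v 0 \<noteq> 0" "\<And>n. n < d \<Longrightarrow> mval (H n) v \<noteq> 0" by (auto simp: mval_hom)
  then have v0: "v \<noteq> (\<lambda>_. 0)" by auto
  have "\<phi> (ppoint v) \<in> P2" using Bij_imp_funcset[OF Bij] ppoint_in_P2[OF v0] by blast
  then obtain w where w: "\<phi> (ppoint v) = ppoint w" by (rule P2E)
  have "form_map S (ppoint w) = form_map S (ppoint v)"
    using fib[OF ppoint_in_P2[OF v0]] w by simp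
  then obtain n where n: "n < d" "ppoint w = ppoint (\<lambda>i. u i ^ n * v i)"
    using fibre_eq_orbit[OF S] by blast
  then have "\<phi> (ppoint v) = act n (ppoint v)" using w v0 by (simp add: act_ppoint)
  then show False using H(2)[OF n(1) v0 v(2)[OF n(1)]] by simp
qed

lemma act_inj: "act m = act n \<Longrightarrow> m mod d = n mod d"
proof -
  assume eq: "act m = act n"
  \<comment> \<open>The point (1 : 1 : 1) has trivial stabiliser: its first two coordinates become 1
    and e^n.\<close>
  have "(\<lambda>_. 1 :: 'k) \<noteq> (\<lambda>_ :: 3. 0)" by (auto simp: fun_eq_iff)
  then have "ppoint (\<lambda>i. u i ^ m) = ppoint (\<lambda>i. u i ^ n)"
    using act_ppoint[of "\<lambda>_. 1" m] act_ppoint[of "\<lambda>_. 1" n] eq by simp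
  from ppoint_eq_imp_minors[OF this, of 0 1] show ?thesis
    by (simp add: u_def e_power_eq_iff)
qed

lemma deck_group_iso:
  assumes S: "gens S"
  shows "deck_group (form_map S) \<cong> integer_mod_group d"
proof -
  let ?D = "deck_group (form_map S)" and ?h = "\<lambda>g :: int. act (nat g)"
  have "?h \<in> iso (integer_mod_group d) ?D"
  proof (rule isoI)
    show "?h \<in> hom (integer_mod_group d) ?D"
    proof (rule homI)
      fix g h :: int assume gh: "g \<in> carrier (integer_mod_group d)" "h \<in> carrier (integer_mod_group d)"
      have "compose P2 (act (nat g)) (act (nat h)) = act (nat g + nat h)"
        by (rule extensionalityI[of _ P2])
          (auto simp: compose_eq act_act intro: Bij_imp_extensional[OF act_Bij])
      also have "\<dots> = act ((nat g + nat h) mod d)" by (simp add: act_mod)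
      also have "(nat g + nat h) mod d = nat ((g + h) mod int d)"
        using gh by (simp add: carrier_Zd nat_mod_distrib nat_add_distrib)
      finally show "?h (g \<otimes>\<^bsub>integer_mod_group d\<^esub> h) = ?h g \<otimes>\<^bsub>?D\<^esub> ?h h"
        using act_Bij by (simp add: deck_group_def BijGroup_def)
    qed (rule act_in_deck[OF S])
    show "bij_betw ?h (carrier (integer_mod_group d)) (carrier ?D)"
      unfolding bij_betw_def
    proof (intro conjI equalityI subsetI)
      show "inj_on ?h (carrier (integer_mod_group d))"
        using act_inj by (fastforce simp: inj_on_def carrier_Zd nat_less_iff)
      fix \<phi> assume "\<phi> \<in> carrier ?D"
      then obtain n where "n < d" "\<phi> = act n" using deck_eq_act[OF S] by blast
      then show "\<phi> \<in> ?h ` carrier (integer_mod_group d)"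
        by (intro image_eqI[of _ _ "int n"]) (auto simp: carrier_Zd)
    qed (use act_in_deck[OF S] in auto)
  qed
  then have "integer_mod_group d \<cong> ?D" by (auto simp: is_iso_def)
  then show ?thesis by (rule group.iso_sym[OF group_integer_mod_group])
qed

lemma deck_transitive:
  assumes S: "gens S" and pq: "p \<in> P2" "q \<in> P2" "form_map S p = form_map S q"
  shows "\<exists>\<phi>\<in>carrier (deck_group (form_map S)). \<phi> p = q"
proof -
  obtain v w where v: "v \<noteq> (\<lambda>_. 0)" "p = ppoint v" and w: "q = ppoint w" using pq by (metis P2E)
  obtain n where "n < d" "ppoint w = ppoint (\<lambda>i. u i ^ n * v i)"
    using fibre_eq_orbit[OF S, of w v] pq(3) v w by auto
  then have "act n p = q" using v w by (simp add: act_ppoint)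
  then show ?thesis using act_in_deck[OF S] by blast
qed

section \<open>Base points and finiteness of the morphism\<close>

lemma gens_base_point_free:
  assumes S: "gens S"
  shows "base_point_free S"
  unfolding base_point_free_def
proof (intro allI impI, rule ccontr)
  fix v :: "3 \<Rightarrow> 'k" assume v: "v \<noteq> (\<lambda>_. 0)" and neg: "\<not> (\<exists>f\<in>S. mval f v \<noteq> 0)"
  \<comment> \<open>Taking c = 0 in \<open>gens_mval_eq\<close> shows that a common zero of S is a
    zero of x^d, y^d and z^d.\<close>
  then have "mval f v = 0 * mval f v" if "f \<in> S" for f using that by simp
  then have zero: "mon_val v m = 0" if "m \<in> inv_mons" for m
    using gens_mval_eq[OF S, of v 0 v m] that by simp
  have "v i ^ d = 0" for i
    using zero[OF power_mons(1)] zero[OF power_mons(2)] zero[OF power_mons(3)] three_cases[of i]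
    by (auto simp: mon_val3)
  then show False using v by (auto simp: fun_eq_iff)
qed

text \<open>The target coordinates are the elements of S, whose span contains the invariant
  monomials; so each of these is the pullback of a linear form.\<close>

lemma gens_lift:
  assumes S: "gens S" and m: "m \<in> inv_mons"
  shows "\<exists>H\<in>forms 1. \<forall>v. mval H (form_coords S v) = mon_val v m"
proof -
  have fin: "finite S" using S by (simp add: gens_def)
  obtain q where q: "single m 1 = (\<Sum>s\<in>S. mconst (q s) * s)"
    using gens_span[OF S m] unfolding kvec.span_finite[OF fin] by blast
  let ?H = "\<Sum>s\<in>S. mconst (q s) * mvar s :: ((3, 'k) mpol, 'k) mpol"
  have "mval ?H (form_coords S v) = mon_val v m" for v
  proof -
    have "mval ?H (form_coords S v) = (\<Sum>s\<in>S. q s * mval s v)"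
      by (simp add: mval_hom form_coords_def)
    also have "\<dots> = mval (\<Sum>s\<in>S. mconst (q s) * s) v" by (simp add: mval_hom)
    also have "\<dots> = mon_val v m" unfolding q[symmetric] by simp
    finally show ?thesis .
  qed
  moreover have "?H \<in> forms 1" by (intro forms_sum forms_const_mult forms_var)
  ultimately show ?thesis by blast
qed

text \<open>
  Over the chart \<open>f \<noteq> 0\<close> the functions \<open>x\<^sup>r / f\<^sup>s\<close> with all exponents in \<open>r\<close> smaller than \<open>d\<close> and
  \<open>|r| = s d\<close> generate the coordinate ring, since \<open>x\<^sup>d\<close>, \<open>y\<^sup>d\<close>, \<open>z\<^sup>d\<close> are linear forms downstairs.
  Different \<open>r\<close> may yield the same function, so the terms are grouped by the function.
\<close>

lemma gens_finite_chart:
  assumes S: "gens S" and f: "f \<in> S"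
  shows "\<exists>B. finite B \<and> B \<subseteq> chart_ring d f \<and>
    (\<forall>g\<in>chart_ring d f. \<exists>h. (\<forall>b\<in>B. h b \<in> pulled_back_chart_ring S f) \<and> g = (\<lambda>v. \<Sum>b\<in>B. h b v * b v))"
proof -
  define b where "b r = (\<lambda>v. if mval f v = 0 then 0 else mon_val v r / mval f v ^ (mdeg r div d))"
    for r :: "3 \<Rightarrow>\<^sub>0 nat"
  define box where "box = {r \<in> (\<lambda>(i, j, k). mon3 i j k) ` ({..<d} \<times> {..<d} \<times> {..<d}). d dvd mdeg r}"
  have "finite box" unfolding box_def by (rule finite_subset[of _ "(\<lambda>(i, j, k). mon3 i j k) ` ({..<d} \<times> {..<d} \<times> {..<d})"]) auto
  moreover have "b ` box \<subseteq> chart_ring d f"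
  proof
    fix c assume "c \<in> b ` box"
    then obtain r where r: "d dvd mdeg r" "c = b r" by (auto simp: box_def)
    have "c = (\<lambda>v. if mval f v = 0 then 0 else mval (single r 1) v / mval f v ^ (mdeg r div d))"
      unfolding r(2) b_def by (rule ext) simp
    moreover have "single r 1 \<in> forms (mdeg r div d * d)" using r(1) by simp
    ultimately show "c \<in> chart_ring d f" unfolding chart_ring_def by blast
  qed
  moreover have "\<exists>h. (\<forall>b\<in>b ` box. h b \<in> pulled_back_chart_ring S f) \<and> g = (\<lambda>v. \<Sum>b\<in>b ` box. h b v * b v)"
    if g: "g \<in> chart_ring d f" for g
  proof -
    obtain G k where G: "G \<in> forms (k * d)"
      and g_eq: "g = (\<lambda>v. if mval f v = 0 then 0 else mval G v / mval f v ^ k)"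
      using g unfolding chart_ring_def by blast
    obtain X Y Z where X: "X \<in> forms 1" "\<And>v. mval X (form_coords S v) = v 0 ^ d"
      and Y: "Y \<in> forms 1" "\<And>v. mval Y (form_coords S v) = v 1 ^ d"
      and Z: "Z \<in> forms 1" "\<And>v. mval Z (form_coords S v) = v 2 ^ d"
      using gens_lift[OF S power_mons(1)] gens_lift[OF S power_mons(2)] gens_lift[OF S power_mons(3)]
      by (auto simp: mon_val3)
    define rm where "rm m = mon3 (lookup m 0 mod d) (lookup m 1 mod d) (lookup m 2 mod d)"
      for m :: "3 \<Rightarrow>\<^sub>0 nat"
    \<comment> \<open>The quotients of the exponents by d become powers of X, Y and Z. The power s =
      \<open>mdeg (rm m) div d\<close> of \<open>mvar f\<close> raises the degree to k and cancels
      the denominator f^s of \<open>b (rm m)\<close>.\<close>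
    define t where "t m = mconst (lookup G m) *
      (X ^ (lookup m 0 div d) * Y ^ (lookup m 1 div d) * Z ^ (lookup m 2 div d)) *
      mvar f ^ (mdeg (rm m) div d)" for m
    have deg: "d dvd mdeg (rm m)"
      "lookup m 0 div d + lookup m 1 div d + lookup m 2 div d + mdeg (rm m) div d = k"
      if "m \<in> keys G" for m
    proof -
      have m: "lookup m 0 + lookup m 1 + lookup m 2 = k * d"
        using G that by (auto simp: forms_def mdeg3)
      have split: "(lookup m 0 div d + lookup m 1 div d + lookup m 2 div d) * d + mdeg (rm m) =
          lookup m 0 + lookup m 1 + lookup m 2"
        using div_mult_mod_eq[of "lookup m 0" d] div_mult_mod_eq[of "lookup m 1" d]
          div_mult_mod_eq[of "lookup m 2" d]
        unfolding rm_def mdeg3 lookup_mon3 add_mult_distrib by linarith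
      then have "d dvd (lookup m 0 div d + lookup m 1 div d + lookup m 2 div d) * d + mdeg (rm m)"
        unfolding m by simp
      then show dv: "d dvd mdeg (rm m)" by (simp add: dvd_add_right_iff)
      have "(lookup m 0 div d + lookup m 1 div d + lookup m 2 div d + mdeg (rm m) div d) * d = k * d"
        using split dv unfolding m by (simp add: add_mult_distrib)
      then show "lookup m 0 div d + lookup m 1 div d + lookup m 2 div d + mdeg (rm m) div d = k"
        using d_pos by simp
    qed
    have t_forms: "t m \<in> forms k" if "m \<in> keys G" for m
    proof -
      have "t m \<in> forms (0 + (lookup m 0 div d * 1 + lookup m 1 div d * 1 + lookup m 2 div d * 1)
          + mdeg (rm m) div d * 1)"
        unfolding t_def by (intro forms_mult forms_power forms_const forms_var X Y Z)
      then show ?thesis using deg(2)[OF that] by simp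
    qed
    have t_val: "mval (t m) (form_coords S v) * b (rm m) v = lookup G m * mon_val v m"
      if "m \<in> keys G" "mval f v \<noteq> 0" for m v
    proof -
      have split: "v i ^ lookup m i = (v i ^ d) ^ (lookup m i div d) * v i ^ (lookup m i mod d)" for i
        by (simp flip: power_mult power_add)
      have "mval (t m) (form_coords S v) = lookup G m *
          ((v 0 ^ d) ^ (lookup m 0 div d) * (v 1 ^ d) ^ (lookup m 1 div d) * (v 2 ^ d) ^ (lookup m 2 div d))
          * mval f v ^ (mdeg (rm m) div d)"
      proof -
        have "form_coords S v f = mval f v" using f by (simp add: form_coords_def)
        then show ?thesis unfolding t_def by (simp add: mval_hom X Y Z)
      qed
      moreover have "b (rm m) v = (v 0 ^ (lookup m 0 mod d) * v 1 ^ (lookup m 1 mod d) * v 2 ^ (lookup m 2 mod d))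
          / mval f v ^ (mdeg (rm m) div d)"
        using that(2) by (simp add: b_def mon_val3 rm_def)
      ultimately show ?thesis
        unfolding mon_val3 split[of 0] split[of 1] split[of 2] using that(2) by simp
    qed
    define h where "h c = (\<lambda>v. if mval f v = 0 then 0 else
      mval (\<Sum>m | m \<in> keys G \<and> b (rm m) = c. t m) (form_coords S v) / mval f v ^ k)" for c
    have "h c \<in> pulled_back_chart_ring S f" for c
    proof -
      have "(\<Sum>m | m \<in> keys G \<and> b (rm m) = c. t m) \<in> forms k"
        by (rule forms_sum) (use t_forms in auto)
      then show ?thesis unfolding h_def pulled_back_chart_ring_def by blast
    qed
    moreover have "g v = (\<Sum>c\<in>b ` box. h c v * c v)" for v
    proof (cases "mval f v = 0")
      case False
      have sub: "(\<lambda>m. b (rm m)) ` keys G \<subseteq> b ` box"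
      proof (intro subsetI, elim imageE)
        fix c m assume cm: "c = b (rm m)" "m \<in> keys G"
        have "rm m \<in> (\<lambda>(i, j, k). mon3 i j k) ` ({..<d} \<times> {..<d} \<times> {..<d})"
          unfolding rm_def
          by (rule image_eqI[of _ _ "(lookup m 0 mod d, lookup m 1 mod d, lookup m 2 mod d)"])
            (use d_pos in auto)
        then show "c \<in> b ` box" using deg(1)[OF cm(2)] cm(1) by (simp add: box_def)
      qed
      have "g v = (\<Sum>m\<in>keys G. lookup G m * mon_val v m / mval f v ^ k)"
        using False by (simp add: g_eq mval_superset[OF finite_keys order_refl, of G] sum_divide_distrib)
      also have "\<dots> = (\<Sum>m\<in>keys G. mval (t m) (form_coords S v) / mval f v ^ k * b (rm m) v)"
        by (rule sum.cong[OF refl]) (use t_val False in \<open>simp add: times_divide_eq_left\<close>)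
      also have "\<dots> = (\<Sum>c\<in>b ` box. \<Sum>m | m \<in> keys G \<and> b (rm m) = c.
          mval (t m) (form_coords S v) / mval f v ^ k * b (rm m) v)"
        by (rule sum.group[symmetric]) (use sub \<open>finite box\<close> in auto)
      also have "\<dots> = (\<Sum>c\<in>b ` box. h c v * c v)"
      proof (rule sum.cong[OF refl])
        fix c
        have "(\<Sum>m | m \<in> keys G \<and> b (rm m) = c. mval (t m) (form_coords S v) / mval f v ^ k * b (rm m) v) =
            (\<Sum>m | m \<in> keys G \<and> b (rm m) = c. mval (t m) (form_coords S v) / mval f v ^ k * c v)"
          by (rule sum.cong) auto
        also have "\<dots> = h c v * c v"
          using False by (simp add: h_def mval_hom sum_divide_distrib sum_distrib_right)
        finally show "(\<Sum>m | m \<in> keys G \<and> b (rm m) = c. mval (t m) (form_coords S v) / mval f v ^ k * b (rm m) v) =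
          h c v * c v" .
      qed
      finally show ?thesis .
    qed (simp add: g_eq h_def)
    then have "g = (\<lambda>v. \<Sum>c\<in>b ` box. h c v * c v)" by (rule ext)
    ultimately show ?thesis by (intro exI[of _ h] conjI ballI)
  qed
  ultimately show ?thesis by (intro exI[of _ "b ` box"] conjI ballI finite_imageI)
qed

lemma gens_covering:
  assumes S: "gens S"
  shows "cyclic_galois_covering d d S"
  unfolding cyclic_galois_covering_def finite_form_map_def
  by (intro conjI ballI impI gens_base_point_free gens_finite_chart deck_group_iso deck_transitive S)

lemma gt_system_I: "gt_system d I"
  unfolding gt_system_def
proof (intro conjI togliatti_I exI allI impI)
  show "diag_rep d rep" by (rule diag_rep_rep)
  show "I = gen_ideal {F \<in> forms d. \<forall>g\<in>carrier (integer_mod_group d). diag_act (rep g) F = F}"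
    by (rule I_invariants)
  show "cyclic_galois_covering d d S" if "min_form_gens d I S" for S
    using that by (intro gens_covering) (simp add: min_form_gens_def gens_def)
qed

subsection \<open>The Ceva configuration\<close>

text \<open>The points where the lines meet the coordinate triangle; c is the index of the vanishing
  coordinate. Each line meets each side in one of them, which gives three points per line.\<close>

definition ceva_vec :: "3 \<Rightarrow> nat \<Rightarrow> 3 \<Rightarrow> 'k" where
  "ceva_vec c m = (if c = 0 then triple 0 1 (- (e ^ m)) else if c = 1 then triple 1 0 (- (e ^ m))
    else triple 1 (- (e ^ m)) 0)"

definition ceva_line :: "nat \<Rightarrow> nat \<Rightarrow> (3 \<Rightarrow> 'k) set set" where
  "ceva_line i j = line_of (lin_form 1 (e ^ i) (e ^ j))"

text \<open>The inverse of a residue m < d in Z/d; the outer \<open>mod\<close> takes care of m =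
  0.\<close>

definition neg :: "nat \<Rightarrow> nat" where
  "neg m = (d - m) mod d"

lemma neg_less [simp]: "neg m < d"
  using d_pos by (simp add: neg_def)

lemma add_mod_eq_0_iff: "i < d \<Longrightarrow> m < d \<Longrightarrow> (i + m) mod d = 0 \<longleftrightarrow> m = neg i"
  by (cases "i = 0") (auto simp: neg_def mod_if)

lemma add_mod_eq_iff: "i < d \<Longrightarrow> j < d \<Longrightarrow> m < d \<Longrightarrow> i = (j + m) mod d \<longleftrightarrow> m = (i + neg j) mod d"
  by (cases "j = 0") (auto simp: neg_def mod_if)

lemma ceva_vec_nonzero: "ceva_vec c m \<noteq> (\<lambda>_. 0)"
proof
  assume "ceva_vec c m = (\<lambda>_. 0)"
  then have "ceva_vec c m 0 = 0" "ceva_vec c m 1 = 0" by simp_all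
  then show False by (auto simp: ceva_vec_def split: if_splits)
qed

lemma ppoint_in_line_of:
  assumes L: "L \<in> forms 1" and v: "v \<noteq> (\<lambda>_. 0)"
  shows "ppoint v \<in> line_of L \<longleftrightarrow> mval L v = 0"
proof
  assume "ppoint v \<in> line_of L"
  then obtain w where w: "ppoint v = ppoint w" "mval L w = 0" by (auto simp: line_of_def)
  then obtain c where "v = (\<lambda>i. c * w i)" unfolding ppoint_eq_iff by blast
  then show "mval L v = 0" using w(2) L by (simp add: mval_scale)
qed (use v in \<open>auto simp: line_of_def\<close>)

lemma ceva_incidence:
  assumes "i < d" "j < d" "m < d"
  shows "ppoint (ceva_vec c m) \<in> ceva_line i j \<longleftrightarrow>
    (if c = 0 then i = (j + m) mod d else if c = 1 then m = neg j else m = neg i)"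
proof -
  have "ppoint (ceva_vec c m) \<in> ceva_line i j \<longleftrightarrow>
      (if c = 0 then e ^ i = e ^ (j + m) else if c = 1 then e ^ (j + m) = e ^ 0 else e ^ (i + m) = e ^ 0)"
    unfolding ceva_line_def ppoint_in_line_of[OF forms_lin_form ceva_vec_nonzero] mval_simps
    by (auto simp: ceva_vec_def power_add)
  then show ?thesis
    unfolding e_power_eq_iff using assms by (simp add: add_mod_eq_0_iff)
qed

lemma ceva_point_inj:
  assumes mn: "m < d" "n < d" and eq: "ppoint (ceva_vec c m) = ppoint (ceva_vec c' n)"
  shows "c = c' \<and> m = n"
proof -
  note minors = ppoint_eq_imp_minors[OF eq]
  have "c = c'"
    using minors[of 0 1] minors[of 0 2] minors[of 1 2] three_cases[of c] three_cases[of c']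
    by (auto simp: ceva_vec_def)
  moreover have "e ^ m = e ^ n"
    using minors[of 0 1] minors[of 0 2] minors[of 1 2] three_cases[of c] unfolding \<open>c = c'\<close>[symmetric]
    by (auto simp: ceva_vec_def)
  ultimately show ?thesis using mn by (simp add: e_power_eq_iff)
qed

text \<open>A line is recovered from its points on the sides y = 0 and z = 0, which reveal j and
  i.\<close>

lemma ceva_line_inj:
  assumes "i < d" "j < d" "i' < d" "j' < d" "ceva_line i j = ceva_line i' j'"
  shows "i = i' \<and> j = j'"
proof -
  have "ppoint (ceva_vec 1 (neg j)) \<in> ceva_line i' j'" "ppoint (ceva_vec 2 (neg i)) \<in> ceva_line i' j'"
    using assms ceva_incidence[of i j] by (auto simp flip: assms(5))
  then have "neg j = neg j'" "neg i = neg i'" using ceva_incidence[of i' j'] assms by auto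
  then show ?thesis
    using add_mod_eq_0_iff[of j "neg j"] add_mod_eq_0_iff[of "neg j" j] add_mod_eq_0_iff[of "neg j" j']
      add_mod_eq_0_iff[of i "neg i"] add_mod_eq_0_iff[of "neg i" i] add_mod_eq_0_iff[of "neg i" i']
      add_mod_eq_0_iff[of j' "neg j'"] add_mod_eq_0_iff[of i' "neg i'"] assms
    by (simp add: add.commute)
qed

lemma ceva_configuration:
  "\<exists>P. linear_configuration P
    {line_of (lin_form 1 (e ^ i) (e ^ j)) | i j. i \<le> d - 1 \<and> j \<le> d - 1} (3 * d) d (d ^ 2) 3"
proof -
  let ?pt = "\<lambda>(c, m). ppoint (ceva_vec c m)" and ?ln = "\<lambda>(i, j). ceva_line i j"
  let ?PI = "{0, 1, 2} \<times> {..<d} :: (3 \<times> nat) set" and ?LI = "{..<d} \<times> {..<d}"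
  have inj_pt: "inj_on ?pt ?PI" using ceva_point_inj by (auto simp: inj_on_def)
  have inj_ln: "inj_on ?ln ?LI" using ceva_line_inj by (auto simp: inj_on_def)
  have "i \<le> d - 1 \<longleftrightarrow> i < d" for i using d_pos by auto
  then have A: "{line_of (lin_form 1 (e ^ i) (e ^ j)) | i j. i \<le> d - 1 \<and> j \<le> d - 1} = ?ln ` ?LI"
    by (auto simp: ceva_line_def)
  have "linear_configuration (?pt ` ?PI) (?ln ` ?LI) (3 * d) d (d ^ 2) 3"
    unfolding linear_configuration_def
  proof (intro conjI ballI)
    show "?pt ` ?PI \<subseteq> P2" by (auto intro!: ppoint_in_P2[OF ceva_vec_nonzero])
    show "card (?pt ` ?PI) = 3 * d" using card_image[OF inj_pt] by (simp add: card_cartesian_product)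
    show "?ln ` ?LI \<subseteq> lines"
      unfolding lines_def ceva_line_def by (force simp: lin_form_eq_0 forms_lin_form[unfolded One_nat_def])
    show "card (?ln ` ?LI) = d ^ 2" using card_image[OF inj_ln] by (simp add: power2_eq_square)
  next
    fix x assume "x \<in> ?pt ` ?PI"
    then obtain c m where x: "x = ppoint (ceva_vec c m)" "m < d" by auto
    \<comment> \<open>Index pairs of the lines through x: the graph of a function of j when c = 0,
      otherwise a full row or column of the d x d grid, so d pairs in every case.\<close>
    define J where "J = (if c = 0 then (\<lambda>j. ((j + m) mod d, j)) ` {..<d}
      else if c = 1 then {..<d} \<times> {neg m} else {neg m} \<times> {..<d})"
    have neg_neg: "m = neg i \<longleftrightarrow> i = neg m" if "i < d" for i
      using add_mod_eq_0_iff[of i m] add_mod_eq_0_iff[of m i] that x(2) by (simp add: add.commute)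
    have J: "J = {(i, j). (i, j) \<in> ?LI \<and> x \<in> ceva_line i j}"
      unfolding J_def x(1) using ceva_incidence x(2) neg_neg d_pos by (auto split: if_splits)
    have "{M \<in> ?ln ` ?LI. x \<in> M} = ?ln ` J" unfolding J by auto
    moreover have "J \<subseteq> ?LI" unfolding J by auto
    then have "card (?ln ` J) = card J" by (rule card_image[OF inj_on_subset[OF inj_ln]])
    ultimately have "card {M \<in> ?ln ` ?LI. x \<in> M} = card J" by (simp only:)
    also have "\<dots> = d" unfolding J_def by (auto simp: card_image inj_on_def)
    finally show "card {M \<in> ?ln ` ?LI. x \<in> M} = d" .
  next
    fix M assume "M \<in> ?ln ` ?LI"
    then obtain i j where M: "M = ceva_line i j" "i < d" "j < d" by auto
    let ?K = "{(0, (i + neg j) mod d), (1, neg j), (2, neg i)} :: (3 \<times> nat) set"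
    have mem: "(c, m) \<in> ?K \<longleftrightarrow> (c, m) \<in> ?PI \<and> ppoint (ceva_vec c m) \<in> M" for c m
    proof (cases "m < d")
      case True
      show ?thesis
        unfolding M(1) ceva_incidence[OF M(2,3) True] add_mod_eq_iff[OF M(2,3) True]
        using three_cases[of c] True by (elim disjE) simp_all
    next
      case False
      then have "m \<noteq> (i + neg j) mod d" "m \<noteq> neg j" "m \<noteq> neg i"
        using mod_less_divisor[OF d_pos, of "i + neg j"] neg_less[of i] neg_less[of j] by metis+
      then show ?thesis using False by simp
    qed
    have K: "?K = {(c, m). (c, m) \<in> ?PI \<and> ppoint (ceva_vec c m) \<in> M}"
      by (rule Set.set_eqI) (simp only: split_paired_all mem mem_Collect_eq prod.case)
    have "{x \<in> ?pt ` ?PI. x \<in> M} = ?pt ` ?K" unfolding K by auto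
    moreover have "?K \<subseteq> ?PI" unfolding K by auto
    then have "card (?pt ` ?K) = card ?K" by (rule card_image[OF inj_on_subset[OF inj_pt]])
    ultimately have "card {x \<in> ?pt ` ?PI. x \<in> M} = card ?K" by (simp only:)
    also have "\<dots> = 3" by simp
    finally show "card {x \<in> ?pt ` ?PI. x \<in> M} = 3" .
  qed auto
  then show ?thesis unfolding A by blast
qed

end

theorem theorem8p1:
  fixes e :: "'k::{alg_closed_field, field_char_0}" and d a :: nat
  assumes "2 \<le> d" and "2 \<le> a" and "a \<le> d - 1" and "primitive_root_of_one d e"
  shows "(gt_system d (GT_ideal d e a) \<and> minimal_monomial_togliatti_system d (GT_ideal d e a)) \<and>
    (\<forall>\<alpha> \<beta> \<gamma>. lin_form \<alpha> \<beta> \<gamma> *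
        (\<Prod>j = 1..d - 1. lin_form \<alpha> (\<beta> * e ^ j) (\<gamma> * e ^ (a * j))) \<in> GT_ideal d e a) \<and>
    (\<exists>P. linear_configuration P
        {line_of (lin_form 1 (e ^ i) (e ^ j)) | i j. i \<le> d - 1 \<and> j \<le> d - 1}
        (3 * d) d (d ^ 2) 3)"
proof -
  interpret gt_setup e d a
    using assms by unfold_locales auto
  show ?thesis
    using gt_system_I minimal_I norm_form_in_I ceva_configuration
    unfolding I_def norm_form_alt by blast
qed

end
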